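(* Let $p$ be a prime and $K/\mathbb{Q}_p$ a ramified quadratic extension with associated quadratic character $\chi$. In the notation of the context, the $\chi$-isotypic subspace $\mathcal{S}_{L_0}^\chi$ of $\mathcal{S}_{L_0}$ (for the action of $\mathcal{H}$) is one-dimensional and is generated by $\mathfrak{u}_K$, and $\mathfrak{u}_K$ is invariant under $\mathrm{SL}_2(\mathbb{Z}_p)$ acting through the Weil representation.
   Context: $K/\mathbb{Q}_p$ is ramified quadratic with valuation ring $\mathcal{O}$, different $\mathfrak{d}$ and conjugation $x\mapsto x'$; $d=\mathrm{Nm}(\mathfrak{d})$ (so $d=p$ if $p$ is odd and $d=4$ or $8$ if $p=2$). $\chi$ is the quadratic character of $\mathbb{Q}_p^\times$ corresponding to $K/\mathbb{Q}_p$. Let $$L_0=\left\{d\begin{pmatrix}a&\nu\\\nu'&b\end{pmatrix}:a,b\in\mathbb{Z}_p,\ \nu\in\mathfrak{d}^{-1}\right\},\qquad V_0=L_0\otimes\mathbb{Q}_p,$$ with quadratic form $Q_0=\beta\cdot\det$, where $d\beta\in\mathbb{Z}_p^\times$. Its dual lattice is $L_0^\vee=M_2(\mathcal{O})\cap V_0$. $\mathcal{S}_{L_0}$ is the finite-dimensional space of functions in $\mathcal{S}(V_0)$ supported on $L_0^\vee$ and invariant under translation by $L_0$; it is stable under the action of $\mathrm{SL}_2(\mathbb{Z}_p)$ through the Weil representation attached to $(V_0,Q_0)$ and the standard additive character $\psi_p$ of $\mathbb{Q}_p$. The group $\mathcal{H}=\{h\in\mathrm{GL}_2(\mathcal{O}):\det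 h\in\mathbb{Z}_p^\times\}$ acts on $V_0$, preserving $L_0$ and $L_0^\vee$, by $h\cdot\lambda=h\lambda\,{}^t(h')/\det(h)$, hence on $\mathcal{S}_{L_0}$ by $(h\varphi)(x)=\varphi(h^{-1}\cdot x)$. View $\chi$ as the character $h\mapsto\chi(\det h)$ of $\mathcal{H}$. Put $\ell=\begin{pmatrix}1&0\\0&0\end{pmatrix}\in L_0^\vee$, let $\mathcal{H}_\ell\subset\mathcal{H}$ be the stabilizer of the coset $L_0+\ell$ (it is contained in $\ker\chi$), and define $$\mathfrak{u}_K=\sum_{h\in\mathcal{H}/\mathcal{H}_\ell}\chi(h)^{-1}\,\mathrm{Char}(L_0+h\cdot\ell)\in\mathcal{S}_{L_0},$$ where $\mathrm{Char}$ denotes the characteristic function. *)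

theory Defs
  imports "HOL-Analysis.Analysis" "HOL-Library.Function_Algebras"
    "HOL-Computational_Algebra.Primes"
begin

section \<open>Ramified quadratic extensions of the field of p-adic numbers\<close>

text \<open>
  The big field \<open>K\<close> is a type \<open>'k\<close> with an absolute value \<open>av\<close>, and \<open>\<rat>\<^sub>p\<close> is the subfield of \<open>K\<close>
  obtained by closing up \<open>\<rat>\<close>. A multiplicative ultrametric \<open>av\<close> with \<open>av p = 1/p\<close> restricts to
  the normalised p-adic absolute value on \<open>\<rat>\<close> (integers prime to \<open>p\<close> get value \<open>1\<close> by Bezout), so
  for complete \<open>K\<close> the closure of \<open>\<rat>\<close> is the field of p-adic numbers.
\<close>

definition Qp :: "('k::field_char_0 \<Rightarrow> real) \<Rightarrow> 'k set" where
  "Qp av = Metric_space.mtopology UNIV (\<lambda>x y. av (x - y)) closure_of \<rat>"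

text \<open>In the assumption \<open>ramified\<close>, the value group of \<open>K\<close> is strictly larger than that of \<open>\<rat>\<^sub>p\<close>,
  i.e. the ramification index is not \<open>1\<close>.\<close>

locale ramified_quadratic_extension =
  fixes p :: nat and av :: "'k::field_char_0 \<Rightarrow> real"
  assumes prime_p: "prime p"
    and av_nonneg: "0 \<le> av x"
    and av_eq_0_iff: "av x = 0 \<longleftrightarrow> x = 0"
    and av_mult: "av (x * y) = av x * av y"
    and av_ultrametric: "av (x + y) \<le> max (av x) (av y)"
    and av_p: "av (of_nat p) = 1 / real p"
    and complete: "Metric_space.mcomplete UNIV (\<lambda>x y. av (x - y))"
    and quadratic: "\<exists>e f. \<forall>x. \<exists>!(a, b). a \<in> Qp av \<and> b \<in> Qp av \<and> x = a * e + b * f"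
    and ramified: "\<exists>x. x \<noteq> 0 \<and> av x \<notin> av ` Qp av"

definition integers :: "('k::field_char_0 \<Rightarrow> real) \<Rightarrow> 'k set" where
  "integers av = {x. av x \<le> 1}"

definition Zp :: "('k::field_char_0 \<Rightarrow> real) \<Rightarrow> 'k set" where
  "Zp av = Qp av \<inter> integers av"

definition Zp_units :: "('k::field_char_0 \<Rightarrow> real) \<Rightarrow> 'k set" where
  "Zp_units av = {x \<in> Zp av. x \<noteq> 0 \<and> inverse x \<in> Zp av}"

definition gal :: "('k::field_char_0 \<Rightarrow> real) \<Rightarrow> 'k \<Rightarrow> 'k" where
  "gal av = (THE \<sigma>. (\<forall>x y. \<sigma> (x + y) = \<sigma> x + \<sigma> y) \<and> (\<forall>x y. \<sigma> (x * y) = \<sigma> x * \<sigma> y) \<and>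
                    (\<forall>x \<in> Qp av. \<sigma> x = x) \<and> \<sigma> \<noteq> id)"

definition gal_trace :: "('k::field_char_0 \<Rightarrow> real) \<Rightarrow> 'k \<Rightarrow> 'k" where
  "gal_trace av x = x + gal av x"

definition gal_norm :: "('k::field_char_0 \<Rightarrow> real) \<Rightarrow> 'k \<Rightarrow> 'k" where
  "gal_norm av x = x * gal av x"

definition inv_different :: "('k::field_char_0 \<Rightarrow> real) \<Rightarrow> 'k set" where
  "inv_different av = {x. \<forall>y \<in> integers av. gal_trace av (x * y) \<in> Zp av}"

definition different :: "('k::field_char_0 \<Rightarrow> real) \<Rightarrow> 'k set" where
  "different av = {x. \<forall>y \<in> inv_different av. x * y \<in> integers av}"

text \<open>The norm of the different as a positive integer: the number of its cosets in the
  valuation ring.\<close>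

definition different_norm :: "('k::field_char_0 \<Rightarrow> real) \<Rightarrow> nat" where
  "different_norm av = card ((\<lambda>x. (+) x ` different av) ` integers av)"

text \<open>The quadratic character of \<open>\<rat>\<^sub>p\<^sup>\<times>\<close> attached to \<open>K\<close> by class field theory: its kernel is the
  group of norms from \<open>K\<^sup>\<times>\<close>. It is only used on nonzero elements of \<open>\<rat>\<^sub>p\<close>.\<close>

definition quad_char :: "('k::field_char_0 \<Rightarrow> real) \<Rightarrow> 'k \<Rightarrow> complex" where
  "quad_char av x = (if \<exists>z. z \<noteq> 0 \<and> x = gal_norm av z then 1 else - 1)"

definition frac_part :: "nat \<Rightarrow> ('k::field_char_0 \<Rightarrow> real) \<Rightarrow> 'k \<Rightarrow> rat" where
  "frac_part p av x =
     (THE r. 0 \<le> r \<and> r < 1 \<and> (\<exists>n. r * of_nat p ^ n \<in> \<int>) \<and> x - of_rat r \<in> Zp av)"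

text \<open>The standard additive character. The other usual normalisation is the complex conjugate of
  this one; passing to it amounts to replacing the constant \<open>\<beta>\<close> below by \<open>- \<beta>\<close>.\<close>

definition add_char :: "nat \<Rightarrow> ('k::field_char_0 \<Rightarrow> real) \<Rightarrow> 'k \<Rightarrow> complex" where
  "add_char p av x = cis (2 * pi * of_rat (frac_part p av x))"


section \<open>The quadratic space and its lattices\<close>

abbreviation mat2 :: "'k::field_char_0 \<Rightarrow> 'k \<Rightarrow> 'k \<Rightarrow> 'k \<Rightarrow> 'k^2^2" where
  "mat2 a b c d \<equiv> vector [vector [a, b], vector [c, d]]"

definition mscale :: "'k::field_char_0 \<Rightarrow> 'k^2^2 \<Rightarrow> 'k^2^2" where
  "mscale c = map_matrix ((*) c)"

definition L0 :: "('k::field_char_0 \<Rightarrow> real) \<Rightarrow> ('k^2^2) set" where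
  "L0 av = {mscale (of_nat (different_norm av)) (mat2 a \<nu> (gal av \<nu>) b) | a b \<nu>.
              a \<in> Zp av \<and> b \<in> Zp av \<and> \<nu> \<in> inv_different av}"

definition V0 :: "('k::field_char_0 \<Rightarrow> real) \<Rightarrow> ('k^2^2) set" where
  "V0 av = {mscale c x | c x. c \<in> Qp av \<and> x \<in> L0 av}"

definition Q0 :: "'k::field_char_0 \<Rightarrow> 'k^2^2 \<Rightarrow> 'k" where
  "Q0 \<beta> x = \<beta> * det x"

definition B0 :: "'k::field_char_0 \<Rightarrow> 'k^2^2 \<Rightarrow> 'k^2^2 \<Rightarrow> 'k" where
  "B0 \<beta> x y = Q0 \<beta> (x + y) - Q0 \<beta> x - Q0 \<beta> y"

definition L0_dual :: "('k::field_char_0 \<Rightarrow> real) \<Rightarrow> 'k \<Rightarrow> ('k^2^2) set" where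
  "L0_dual av \<beta> = {x \<in> V0 av. \<forall>y \<in> L0 av. B0 \<beta> x y \<in> Zp av}"


section \<open>Schwartz functions\<close>

text \<open>
  Functions on \<open>V\<^sub>0\<close> are functions on all matrices vanishing outside \<open>V\<^sub>0\<close>. The sets \<open>p\<^sup>n L\<^sub>0\<close>
  (\<open>n \<ge> 0\<close>) are a basis of neighbourhoods of \<open>0\<close> in \<open>V\<^sub>0\<close>, and the sets \<open>p\<^sup>-\<^sup>n L\<^sub>0\<close> are an
  exhaustion by compact open subgroups; hence a function on \<open>V\<^sub>0\<close> is locally constant with compact
  support iff it vanishes outside some \<open>p\<^sup>-\<^sup>n L\<^sub>0\<close> and is \<open>p\<^sup>n L\<^sub>0\<close>-periodic.
\<close>

definition invariant_under :: "('k::field_char_0^2^2) set \<Rightarrow> ('k^2^2 \<Rightarrow> complex) \<Rightarrow> bool" where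
  "invariant_under M \<phi> \<longleftrightarrow> (\<forall>x. \<forall>y \<in> M. \<phi> (x + y) = \<phi> x)"

definition schwartz :: "nat \<Rightarrow> ('k::field_char_0 \<Rightarrow> real) \<Rightarrow> ('k^2^2 \<Rightarrow> complex) set" where
  "schwartz p av = {\<phi>. \<exists>n. (\<forall>x. \<phi> x \<noteq> 0 \<longrightarrow> x \<in> mscale (inverse (of_nat p ^ n)) ` L0 av) \<and>
                           invariant_under (mscale (of_nat p ^ n) ` L0 av) \<phi>}"

definition S_L0 :: "nat \<Rightarrow> ('k::field_char_0 \<Rightarrow> real) \<Rightarrow> 'k \<Rightarrow> ('k^2^2 \<Rightarrow> complex) set" where
  "S_L0 p av \<beta> = {\<phi> \<in> schwartz p av. (\<forall>x. \<phi> x \<noteq> 0 \<longrightarrow> x \<in> L0_dual av \<beta>) \<and>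
                                      invariant_under (L0 av) \<phi>}"

text \<open>
  The Haar integral on \<open>V\<^sub>0\<close> for which \<open>L\<^sub>0\<close> has volume \<open>1\<close>, on Schwartz functions. An integrand
  that is \<open>p\<^sup>n L\<^sub>0\<close>-periodic integrates to \<open>vol (p\<^sup>n L\<^sub>0) = p\<^sup>-\<^sup>4\<^sup>n\<close> times the sum of its values on the
  finitely many cosets of \<open>p\<^sup>n L\<^sub>0\<close> where it is nonzero, independently of the choice of \<open>n\<close>.
\<close>

definition haar_integral ::
    "nat \<Rightarrow> ('k::field_char_0 \<Rightarrow> real) \<Rightarrow> ('k^2^2 \<Rightarrow> complex) \<Rightarrow> complex" where
  "haar_integral p av \<phi> =
     (let M = (\<lambda>n. mscale (of_nat p ^ n) ` L0 av);
          n = (LEAST n. invariant_under (M n) \<phi>)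
      in inverse (of_nat p ^ (4 * n)) *
         (\<Sum>C \<in> {(+) x ` M n | x. \<phi> x \<noteq> 0}. \<phi> (SOME y. y \<in> C)))"

definition fscale :: "complex \<Rightarrow> ('a \<Rightarrow> complex) \<Rightarrow> 'a \<Rightarrow> complex" where
  "fscale c \<phi> = (\<lambda>x. c * \<phi> x)"

interpretation fun_space: vector_space "fscale :: complex \<Rightarrow> ('a \<Rightarrow> complex) \<Rightarrow> 'a \<Rightarrow> complex"
  by standard (auto simp: fscale_def fun_eq_iff algebra_simps)


section \<open>The Weil representation\<close>

definition SL2 :: "'k::field_char_0 set \<Rightarrow> ('k^2^2) set" where
  "SL2 R = {g. (\<forall>i j. g $ i $ j \<in> R) \<and> det g = 1}"

text \<open>
  \<open>\<omega>\<close> is the Weil representation of \<open>SL\<^sub>2(\<rat>\<^sub>p)\<close> on \<open>S(V\<^sub>0)\<close> attached to \<open>(V\<^sub>0, Q\<^sub>0)\<close> and the standard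
  additive character: a linear representation given on the generators by the usual formulas.
  Since \<open>dim V\<^sub>0 = 4\<close> and the determinant of \<open>V\<^sub>0\<close> is the discriminant of \<open>K\<close> up to squares (\<open>V\<^sub>0\<close> is
  a hyperbolic plane plus a multiple of the norm form of \<open>K\<close>), the quadratic character of \<open>V\<^sub>0\<close> that
  occurs in the formula for \<open>diag(a, a\<^sup>-\<^sup>1)\<close> is that of \<open>K\<close>, and the modulus factor is
  \<open>|a|\<^sup>2\<close>. The constant \<open>c\<close> combines the Weil index of \<open>(V\<^sub>0, Q\<^sub>0)\<close> with the passage to the self-dual
  Haar measure. It is determined by the other conditions: two representations satisfying these
  conditions differ by a character of \<open>SL\<^sub>2(\<rat>\<^sub>p)\<close>, and this group is perfect.
\<close>

definition weil_representation ::
    "nat \<Rightarrow> ('k::field_char_0 \<Rightarrow> real) \<Rightarrow> 'k \<Rightarrow>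
     ('k^2^2 \<Rightarrow> ('k^2^2 \<Rightarrow> complex) \<Rightarrow> 'k^2^2 \<Rightarrow> complex) \<Rightarrow> bool" where
  "weil_representation p av \<beta> \<omega> \<longleftrightarrow>
     (\<forall>g \<in> SL2 (Qp av). \<forall>\<phi> \<in> schwartz p av. \<omega> g \<phi> \<in> schwartz p av) \<and>
     (\<forall>g \<in> SL2 (Qp av). \<forall>\<phi> \<in> schwartz p av. \<forall>\<phi>' \<in> schwartz p av. \<forall>c.
        \<omega> g (\<phi> + \<phi>') = \<omega> g \<phi> + \<omega> g \<phi>' \<and> \<omega> g (fscale c \<phi>) = fscale c (\<omega> g \<phi>)) \<and>
     (\<forall>\<phi> \<in> schwartz p av. \<omega> (mat 1) \<phi> = \<phi>) \<and>
     (\<forall>g \<in> SL2 (Qp av). \<forall>h \<in> SL2 (Qp av). \<forall>\<phi> \<in> schwartz p av. \<omega> (g ** h) \<phi> = \<omega> g (\<omega> h \<phi>)) \<and>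
     (\<forall>b \<in> Qp av. \<forall>\<phi> \<in> schwartz p av.
        \<omega> (mat2 1 b 0 1) \<phi> = (\<lambda>x. add_char p av (b * Q0 \<beta> x) * \<phi> x)) \<and>
     (\<forall>a \<in> Qp av - {0}. \<forall>\<phi> \<in> schwartz p av.
        \<omega> (mat2 a 0 0 (inverse a)) \<phi> =
          (\<lambda>x. quad_char av a * complex_of_real (av a ^ 2) * \<phi> (mscale a x))) \<and>
     (\<exists>c. \<forall>\<phi> \<in> schwartz p av.
        \<omega> (mat2 0 (- 1) 1 0) \<phi> =
          (\<lambda>x. if x \<in> V0 av
               then c * haar_integral p av (\<lambda>y. \<phi> y * add_char p av (- B0 \<beta> x y)) else 0))"


section \<open>The group acting on the quadratic space\<close>

definition GL2 :: "'k::field_char_0 set \<Rightarrow> ('k^2^2) set" where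
  "GL2 R = {h. (\<forall>i j. h $ i $ j \<in> R) \<and>
               (\<exists>g. (\<forall>i j. g $ i $ j \<in> R) \<and> h ** g = mat 1 \<and> g ** h = mat 1)}"

definition HH :: "('k::field_char_0 \<Rightarrow> real) \<Rightarrow> ('k^2^2) set" where
  "HH av = {h \<in> GL2 (integers av). det h \<in> Zp_units av}"

definition act :: "('k::field_char_0 \<Rightarrow> real) \<Rightarrow> 'k^2^2 \<Rightarrow> 'k^2^2 \<Rightarrow> 'k^2^2" where
  "act av h x = mscale (inverse (det h)) (h ** x ** transpose (map_matrix (gal av) h))"

definition fun_act ::
    "('k::field_char_0 \<Rightarrow> real) \<Rightarrow> 'k^2^2 \<Rightarrow> ('k^2^2 \<Rightarrow> complex) \<Rightarrow> 'k^2^2 \<Rightarrow> complex" where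
  "fun_act av h \<phi> = (\<lambda>x. \<phi> (act av (matrix_inv h) x))"

definition chi :: "('k::field_char_0 \<Rightarrow> real) \<Rightarrow> 'k^2^2 \<Rightarrow> complex" where
  "chi av h = quad_char av (det h)"

definition S_L0_chi :: "nat \<Rightarrow> ('k::field_char_0 \<Rightarrow> real) \<Rightarrow> 'k \<Rightarrow> ('k^2^2 \<Rightarrow> complex) set" where
  "S_L0_chi p av \<beta> = {\<phi> \<in> S_L0 p av \<beta>. \<forall>h \<in> HH av. fun_act av h \<phi> = fscale (chi av h) \<phi>}"

definition ell :: "'k::field_char_0^2^2" where
  "ell = mat2 1 0 0 0"

definition L0_coset :: "('k::field_char_0 \<Rightarrow> real) \<Rightarrow> 'k^2^2 \<Rightarrow> ('k^2^2) set" where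
  "L0_coset av x = (\<lambda>y. y + x) ` L0 av"

definition HH_ell :: "('k::field_char_0 \<Rightarrow> real) \<Rightarrow> ('k^2^2) set" where
  "HH_ell av = {h \<in> HH av. act av h ` L0_coset av ell = L0_coset av ell}"

text \<open>The summation index \<open>C\<close> runs over the left cosets \<open>h H\<^sub>l\<close>, and \<open>h\<close> is a representative of \<open>C\<close>;
  the summand does not depend on its choice.\<close>

definition u_K :: "('k::field_char_0 \<Rightarrow> real) \<Rightarrow> 'k^2^2 \<Rightarrow> complex" where
  "u_K av = (\<lambda>x. \<Sum>C \<in> (\<lambda>h. (**) h ` HH_ell av) ` HH av.
       let h = (SOME h. h \<in> C)
       in inverse (chi av h) * indicator (L0_coset av (act av h ell)) x)"

end

theory Submission
  imports Defs "HOL-Number_Theory.Euler_Criterion"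
begin

text \<open>
  Write \<open>K = \<rat>\<^sub>p(\<theta>)\<close> with \<open>\<theta>\<^sup>2 = D\<close> chosen such that the valuation ring is \<open>\<int>\<^sub>p[\<theta>]\<close>; then the
  different is \<open>(2 \<theta>)\<close> and \<open>d\<close> is the p-part of \<open>4 D\<close>. Let \<open>\<phi>\<close> be \<open>\<chi>\<close>-isotypic and let
  \<open>x\<close> be in the dual lattice, with diagonal entries \<open>a\<close> and \<open>b\<close>. If neither of them is a unit, \<open>diag(u, 1)\<close>
  stabilises \<open>x + L\<^sub>0\<close> for a suitable unit \<open>u\<close> that is not a norm, so \<open>\<phi> x = 0\<close>. Otherwise \<open>x\<close> can be
  moved to \<open>diag(a, c)\<close> with \<open>a\<close> a unit. If \<open>d\<close> divides \<open>c\<close>, this lies in the orbit of \<open>\<ell> + L\<^sub>0\<close>; if not, the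
  matrices with rows \<open>(x, - a y')\<close> and \<open>(c y, x')\<close> stabilise it, and their determinants
  \<open>N x + a c N y\<close> take unit values that are not norms, so again \<open>\<phi> x = 0\<close>. Hence \<open>\<phi>\<close> is determined by \<open>\<phi> \<ell>\<close>.

  The Fourier transform preserves the functions on \<open>L\<^sub>0\<^sup>\<or> / L\<^sub>0\<close> and commutes with the group, so the
  Weyl element \<open>w\<close> multiplies \<open>u\<^sub>K\<close> by a scalar \<open>l\<close>, while the unipotent elements fix \<open>u\<^sub>K\<close>.
  As \<open>w\<^sup>2\<close> and \<open>(w n(1))\<^sup>3\<close> are both \<open>-1\<close>, we get \<open>l\<^sup>2 = l\<^sup>3\<close> and \<open>l = 1\<close>.
\<close>

section \<open>The subfield of p-adic numbers\<close>

text \<open>The character is encoded through the group of norms alone, so its properties are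
  established by congruences rather than by class field theory. The dyadic primes shape this: later
  statements are phrased with \<open>av (4 * D)\<close>, the absolute value of \<open>d\<close>, so
  that odd \<open>p\<close> (value \<open>1 / p\<close>) and the two dyadic types (values
  \<open>1 / 4\<close> and \<open>1 / 8\<close>) share them. Three facts about units carry the rest.
  Units congruent to 1 modulo \<open>d\<close> are norms, whence \<open>\<chi>\<close> is trivial on
  the stabiliser of \<open>ell\<close>. The product of two units that are not norms is a norm,
  whence \<open>\<chi>\<close> is multiplicative. Units that are not norms exist where the vanishing
  arguments look for them: with \<open>d\<close> dividing \<open>p (u - 1)\<close>, and among the
  values of \<open>N x + c N y\<close> when \<open>d\<close> does not divide \<open>c\<close>. On
  the analytic side the Haar integral is never summed. Only its invariance under substitutions that
  permute the cosets of every \<open>p^n L0\<close> enters, and this covers translations by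
  \<open>L0\<close> as well as the group.\<close>

context ramified_quadratic_extension
begin

lemma p_gt_1: "1 < p" and p_pos [simp]: "0 < p" and p_neq_0 [simp]: "p \<noteq> 0"
  using prime_p prime_gt_1_nat prime_gt_0_nat by auto

lemma av_0 [simp]: "av 0 = 0"
  by (simp add: av_eq_0_iff)

lemma av_pos: "x \<noteq> 0 \<Longrightarrow> 0 < av x"
  using av_nonneg[of x] av_eq_0_iff[of x] by linarith

lemma av_1 [simp]: "av 1 = 1"
proof -
  have "av 1 * av 1 = av 1" using av_mult[of 1 1] by simp
  moreover have "av 1 \<noteq> 0" by (simp add: av_eq_0_iff)
  ultimately show ?thesis by simp
qed

lemma av_minus [simp]: "av (- x) = av x"
proof -
  have "av (-1) * av (-1) = 1" using av_mult[of "-1" "-1"] by simp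
  then have "av (-1) = 1" using av_nonneg[of "-1"] by (simp add: square_eq_1_iff)
  then show ?thesis using av_mult[of "-1" x] by simp
qed

lemma av_diff: "av (x - y) \<le> max (av x) (av y)"
  using av_ultrametric[of x "- y"] by simp

lemma av_diff_commute: "av (x - y) = av (y - x)"
  using av_minus[of "x - y"] by simp

lemma av_add_le: "av x \<le> r \<Longrightarrow> av y \<le> r \<Longrightarrow> av (x + y) \<le> r"
  using av_ultrametric[of x y] by simp

lemma av_diff_le: "av x \<le> r \<Longrightarrow> av y \<le> r \<Longrightarrow> av (x - y) \<le> r"
  using av_diff[of x y] by simp

lemma av_add_less: "av x < r \<Longrightarrow> av y < r \<Longrightarrow> av (x + y) < r"
  using av_ultrametric[of x y] by simp

lemma av_diff_less: "av x < r \<Longrightarrow> av y < r \<Longrightarrow> av (x - y) < r"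
  using av_diff[of x y] by simp

lemma av_add_eq: "av y < av x \<Longrightarrow> av (x + y) = av x"
  using av_ultrametric[of x y] av_diff[of "x + y" y] by (auto simp: max_def split: if_splits)

lemma av_add_eq_max: "av x \<noteq> av y \<Longrightarrow> av (x + y) = max (av x) (av y)"
  using av_add_eq[of y x] av_add_eq[of x y] by (auto simp: add.commute max_def)

lemma av_inverse: "av (inverse x) = inverse (av x)"
proof (cases "x = 0")
  case False
  then have "av x * av (inverse x) = 1" using av_mult[of x "inverse x"] by simp
  then show ?thesis by (metis inverse_unique)
qed simp

lemma av_divide: "av (x / y) = av x / av y"
  by (simp add: divide_inverse av_mult av_inverse)

lemma av_power: "av (x ^ n) = av x ^ n"
  by (induction n) (auto simp: av_mult)

section \<open>Values on the rational integers\<close>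

lemma av_of_nat_le_1: "av (of_nat n) \<le> 1"
  by (induction n) (auto intro: av_add_le)

lemma av_of_int_le_1: "av (of_int n) \<le> 1"
  by (cases n rule: int_cases2) (auto simp: av_of_nat_le_1)

lemma av_p_power: "av (of_nat p ^ n) = 1 / real p ^ n"
  by (simp add: av_power av_p power_one_over)

lemma av_of_int_eq_1:
  assumes "\<not> int p dvd m"
  shows "av (of_int m) = 1"
proof -
  have "coprime m (int p)"
    using assms prime_p prime_imp_coprime[of "int p" m] by (simp add: coprime_commute)
  then obtain u v where "u * m + v * int p = 1"
    by (metis bezout_int coprime_imp_gcd_eq_1)
  then have "of_int u * of_int m + of_int v * of_nat p = (1 :: 'k)"
    by (metis of_int_1 of_int_add of_int_mult of_int_of_nat_eq)
  then have "1 \<le> max (av (of_int u * of_int m)) (av (of_int v * of_nat p))"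
    using av_ultrametric by (metis av_1)
  moreover have "av (of_int v * of_nat p) < 1"
  proof -
    have "av (of_int v) * (1 / real p) \<le> 1 * (1 / real p)"
      by (intro mult_right_mono av_of_int_le_1) simp
    also have "\<dots> < 1" using p_gt_1 by simp
    finally show ?thesis by (simp add: av_mult av_p)
  qed
  ultimately have "1 \<le> av (of_int u) * av (of_int m)" by (simp add: av_mult)
  also have "\<dots> \<le> 1 * av (of_int m)"
    by (intro mult_right_mono av_of_int_le_1 av_nonneg)
  finally show ?thesis using av_of_int_le_1[of m] by simp
qed

lemma av_of_int_le_iff: "av (of_int m) \<le> 1 / real p ^ k \<longleftrightarrow> int p ^ k dvd m"
proof (induction k arbitrary: m)
  case 0
  then show ?case by (simp add: av_of_int_le_1)
next
  case (Suc k)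
  show ?case
  proof (cases "int p dvd m")
    case True
    then obtain l where l: "m = int p * l" by blast
    have m: "av (of_int m) = av (of_int l) / real p" by (simp add: l av_mult av_p)
    have "av (of_int m) \<le> 1 / real p ^ Suc k \<longleftrightarrow> av (of_int l) \<le> 1 / real p ^ k"
      unfolding m using p_pos by (simp add: divide_simps)
    then show ?thesis by (simp add: Suc.IH l)
  next
    case False
    then have "\<not> int p ^ Suc k dvd m" by (metis dvd_mult_left power_Suc)
    moreover have "1 / real p ^ Suc k < 1" using p_gt_1 
      by (metis divide_less_eq_1_pos less_eq_real_def not_less of_nat_1 of_nat_less_iff one_less_power zero_less_Suc zero_less_one order_less_trans)
    ultimately show ?thesis using av_of_int_eq_1[OF False] by simp
  qed
qed

lemma av_of_int_power:
  assumes "m \<noteq> 0"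
  shows "\<exists>k. av (of_int m) = 1 / real p ^ k"
proof -
  have "int p \<noteq> 0" "\<not> is_unit (int p)" using p_gt_1 by auto
  with assms obtain l where "m = int p ^ multiplicity (int p) m * l" "\<not> int p dvd l"
    using multiplicity_decompose' by blast
  then show ?thesis
    by (metis av_mult av_of_int_eq_1 av_p_power mult.right_neutral of_int_mult of_int_of_nat_eq of_int_power)
qed

section \<open>The closure of the rationals is a field with the same value group\<close>

lemma Metric: "Metric_space UNIV (\<lambda>x y. av (x - y))"
proof
  fix x y z :: 'k
  show "av (x - z) \<le> av (x - y) + av (y - z)"
    using av_ultrametric[of "x - y" "y - z"] av_nonneg[of "x - y"] av_nonneg[of "y - z"] by simp
qed (auto simp: av_nonneg av_eq_0_iff av_diff_commute)

lemma Qp_iff: "x \<in> Qp av \<longleftrightarrow> (\<forall>e>0. \<exists>q\<in>\<rat>. av (x - q) < e)"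
  using Metric_space.metric_closure_of[OF Metric, of \<rat>]
  by (simp add: Qp_def Metric_space.mball_def[OF Metric])

lemma Rats_subset_Qp: "q \<in> \<rat> \<Longrightarrow> q \<in> Qp av"
  by (auto simp: Qp_iff intro!: bexI[of _ q])

lemma Qp_of_int [simp]: "of_int m \<in> Qp av" and Qp_of_nat [simp]: "of_nat n \<in> Qp av"
  and Qp_numeral [simp]: "numeral w \<in> Qp av" and Qp_0 [simp]: "0 \<in> Qp av" and Qp_1 [simp]: "1 \<in> Qp av"
  by (auto intro: Rats_subset_Qp)

lemma Qp_limit:
  assumes "\<And>e. e > 0 \<Longrightarrow> \<exists>y\<in>Qp av. av (x - y) < e"
  shows "x \<in> Qp av"
  unfolding Qp_iff
proof (intro allI impI)
  fix e :: real assume e: "e > 0"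
  then obtain y where y: "y \<in> Qp av" "av (x - y) < e" using assms by blast
  then obtain q where q: "q \<in> \<rat>" "av (y - q) < e" using e Qp_iff by blast
  have "av (x - q) < e" using av_add_less[OF y(2) q(2)] by simp
  with q show "\<exists>q\<in>\<rat>. av (x - q) < e" by blast
qed

lemma Qp_add [intro]: assumes "x \<in> Qp av" "y \<in> Qp av" shows "x + y \<in> Qp av"
  unfolding Qp_iff
proof (intro allI impI)
  fix e :: real assume e: "e > 0"
  obtain q r where q: "q \<in> \<rat>" "av (x - q) < e" and r: "r \<in> \<rat>" "av (y - r) < e"
    using assms e Qp_iff by meson
  have "av (x + y - (q + r)) < e" using av_add_less[OF q(2) r(2)] by (simp add: algebra_simps)
  with q r show "\<exists>q\<in>\<rat>. av (x + y - q) < e" by (meson Rats_add)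
qed

lemma Qp_minus [intro]: assumes "x \<in> Qp av" shows "- x \<in> Qp av"
  unfolding Qp_iff
proof (intro allI impI)
  fix e :: real assume e: "e > 0"
  obtain q where q: "q \<in> \<rat>" "av (x - q) < e" using assms e Qp_iff by meson
  have "av (- x - (- q)) = av (x - q)" using av_minus[of "x - q"] by (simp add: algebra_simps)
  with q show "\<exists>q\<in>\<rat>. av (- x - q) < e" by (metis Rats_minus_iff)
qed

lemma Qp_diff [intro]: "x \<in> Qp av \<Longrightarrow> y \<in> Qp av \<Longrightarrow> x - y \<in> Qp av"
  using Qp_add[of x "- y"] by auto

lemma Qp_mult [intro]: assumes "x \<in> Qp av" "y \<in> Qp av" shows "x * y \<in> Qp av"
proof (cases "y = 0")
  case False
  show ?thesis
    unfolding Qp_iff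
  proof (intro allI impI)
    fix e :: real assume e: "e > 0"
    have y: "av y > 0" using False by (rule av_pos)
    obtain q where q: "q \<in> \<rat>" "av (x - q) < e / av y"
      using assms(1) e y Qp_iff divide_pos_pos by meson
    \<comment> \<open>The error splits as \<open>(x - q) y + q (y - r)\<close>. The tolerance for
      \<open>r\<close> depends on \<open>q\<close>, which is fixed first; the summand 1 keeps the
      denominator positive when \<open>q = 0\<close>.\<close>
    define e' where "e' = e / (av q + 1)"
    have q1: "av q + 1 > 0" using av_nonneg[of q] by simp
    have e': "e' > 0" using e q1 by (simp add: e'_def)
    obtain r where r: "r \<in> \<rat>" "av (y - r) < e'" using assms(2) e' Qp_iff by meson
    have "av ((x - q) * y) < e" using q(2) y by (simp add: av_mult pos_less_divide_eq)
    moreover have "av (q * (y - r)) < e"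
    proof -
      have "av q * av (y - r) \<le> av q * e'" using r(2) av_nonneg[of q] by (intro mult_left_mono) auto
      also have "\<dots> < (av q + 1) * e'" using e' by (simp add: algebra_simps)
      also have "\<dots> = e" using q1 by (simp add: e'_def)
      finally show ?thesis by (simp add: av_mult)
    qed
    ultimately have "av ((x - q) * y + q * (y - r)) < e" by (rule av_add_less)
    then have "av (x * y - q * r) < e" by (simp add: algebra_simps)
    with q r show "\<exists>q\<in>\<rat>. av (x * y - q) < e" by (meson Rats_mult)
  qed
qed simp


lemma Qp_near_Rats:
  assumes "x \<in> Qp av" "x \<noteq> 0"
  obtains q where "q \<in> \<rat>" "av (x - q) < av x" "av q = av x"
proof -
  obtain q where q: "q \<in> \<rat>" "av (x - q) < av x"
    using assms Qp_iff av_pos by blast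
  moreover have "av q = av x"
    using av_add_eq[of "q - x" x] q(2) by (simp add: av_diff_commute)
  ultimately show ?thesis using that by blast
qed

text \<open>A rational closer to \<open>x\<close> than the size of \<open>x\<close> has the same
  absolute value, so taking the closure creates no new values.\<close>

lemma Qp_av_power_int:
  assumes "x \<in> Qp av" "x \<noteq> 0"
  shows "\<exists>k::int. av x = real p powi k"
proof -
  obtain q where q: "q \<in> \<rat>" "av q = av x" using Qp_near_Rats[OF assms] .
  obtain a b :: int where ab: "b \<noteq> 0" "q = of_int a / of_int b"
    using q(1) by (metis Rats_cases' less_irrefl)
  have "a \<noteq> 0" using q(2) ab assms av_pos[of x] by auto
  then obtain k l where "av (of_int a) = 1 / real p ^ k" "av (of_int b) = 1 / real p ^ l"
    using ab av_of_int_power by blast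
  then have "av x = real p powi (int l - int k)"
    using q ab p_pos by (simp add: av_divide power_int_diff)
  then show ?thesis by blast
qed

lemma Qp_inverse [intro]: assumes "x \<in> Qp av" shows "inverse x \<in> Qp av"
proof (cases "x = 0")
  case False
  show ?thesis
    unfolding Qp_iff
  proof (intro allI impI)
    fix e :: real assume e: "e > 0"
    have x: "av x > 0" using False by (rule av_pos)
    define e' where "e' = min (av x) (e * (av x * av x))"
    have "e' > 0" using e x by (simp add: e'_def)
    then obtain q where q: "q \<in> \<rat>" "av (x - q) < e'"
      using assms Qp_iff by blast
    have qx: "av q = av x"
      using av_add_eq[of "q - x" x] q(2) by (simp add: av_diff_commute e'_def)
    then have "q \<noteq> 0" using x by auto
    then have "inverse x - inverse q = (q - x) / (x * q)" using False by (simp add: field_simps)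
    then have "av (inverse x - inverse q) = av (x - q) / (av x * av x)"
      by (simp add: av_divide av_mult qx av_diff_commute)
    also have "\<dots> < e" using q(2) x by (simp add: e'_def pos_divide_less_eq)
    finally show "\<exists>q\<in>\<rat>. av (inverse x - q) < e" using q(1) Rats_inverse by blast
  qed
qed simp

lemma Qp_divide [intro]: "x \<in> Qp av \<Longrightarrow> y \<in> Qp av \<Longrightarrow> x / y \<in> Qp av"
  by (auto simp: divide_inverse)

lemma Qp_power [intro]: "x \<in> Qp av \<Longrightarrow> x ^ n \<in> Qp av"
  by (induction n) auto

lemma Qp_power_int [intro]: "x \<in> Qp av \<Longrightarrow> x powi n \<in> Qp av"
  by (auto simp: power_int_def)

lemma Qp_av_less_powi:
  assumes "x \<in> Qp av" "av x < real p powi k"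
  shows "av x \<le> real p powi (k - 1)"
proof (cases "x = 0")
  case False
  then obtain l where l: "av x = real p powi l" using assms(1) Qp_av_power_int by blast
  have "l < k"
  proof (rule ccontr)
    assume "\<not> l < k"
    then have "real p powi k \<le> real p powi l" using p_gt_1 by (intro power_int_increasing) auto
    then show False using assms(2) l by simp
  qed
  then show ?thesis unfolding l using p_gt_1 by (intro power_int_increasing) auto
qed simp

lemma Qp_av_less_power:
  assumes "x \<in> Qp av" "av x < 1 / real p ^ k"
  shows "av x \<le> 1 / real p ^ Suc k"
proof -
  have "real p powi (- int k) = 1 / real p ^ k" for k
    by (simp add: power_int_minus divide_inverse)
  moreover have "- int k - 1 = - int (Suc k)" by simp
  ultimately have "real p powi (- int k - 1) = 1 / real p ^ Suc k" by metis
  with Qp_av_less_powi[OF assms(1), of "- int k"] \<open>real p powi (- int k) = 1 / real p ^ k\<close> assms(2)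
  show ?thesis by metis
qed

lemma Qp_av_less_1: "x \<in> Qp av \<Longrightarrow> av x < 1 \<Longrightarrow> av x \<le> 1 / real p"
  using Qp_av_less_power[of x 0] by simp

lemma Zp_iff: "x \<in> Zp av \<longleftrightarrow> x \<in> Qp av \<and> av x \<le> 1"
  by (auto simp: Zp_def integers_def)

lemma Zp_Qp: "x \<in> Zp av \<Longrightarrow> x \<in> Qp av"
  by (simp add: Zp_iff)

lemma Zp_0 [simp]: "0 \<in> Zp av" and Zp_1 [simp]: "1 \<in> Zp av"
  and Zp_of_int [simp]: "of_int m \<in> Zp av" and Zp_of_nat [simp]: "of_nat n \<in> Zp av"
  and Zp_numeral [simp]: "numeral w \<in> Zp av"
  using av_of_int_le_1[of m] av_of_nat_le_1[of n] av_of_nat_le_1[of "numeral w"]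
  by (auto simp: Zp_iff)

lemma Zp_add [intro]: "x \<in> Zp av \<Longrightarrow> y \<in> Zp av \<Longrightarrow> x + y \<in> Zp av"
  and Zp_diff [intro]: "x \<in> Zp av \<Longrightarrow> y \<in> Zp av \<Longrightarrow> x - y \<in> Zp av"
  and Zp_minus [intro]: "x \<in> Zp av \<Longrightarrow> - x \<in> Zp av"
  and Zp_mult [intro]: "x \<in> Zp av \<Longrightarrow> y \<in> Zp av \<Longrightarrow> x * y \<in> Zp av"
  by (auto simp: Zp_iff av_mult av_nonneg intro: av_add_le av_diff_le mult_le_one)

lemma Zp_power [intro]: "x \<in> Zp av \<Longrightarrow> x ^ n \<in> Zp av"
  by (induction n) auto

lemma Zp_units_iff: "x \<in> Zp_units av \<longleftrightarrow> x \<in> Qp av \<and> av x = 1"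
proof -
  have "av x = 1" if "av x \<le> 1" "inverse (av x) \<le> 1" "x \<noteq> 0"
  proof -
    have "1 \<le> av x" using that av_pos[of x] by (simp add: inverse_eq_divide)
    with that show ?thesis by simp
  qed
  then show ?thesis by (auto simp: Zp_units_def Zp_iff av_inverse)
qed

text \<open>Density gives a rational \<open>a / b\<close> near \<open>x\<close>. It is integral, so
  \<open>b\<close> is prime to \<open>p\<close> and can be inverted modulo \<open>p ^ k\<close>,
  which turns the fraction into an integer.\<close>

lemma Zp_approx:
  assumes "x \<in> Zp av"
  shows "\<exists>m::int. av (x - of_int m) \<le> 1 / real p ^ k"
proof -
  have pk: "1 / real p ^ k > 0" using p_pos by simp
  then obtain q where q: "q \<in> \<rat>" "av (x - q) < 1 / real p ^ k"
    using assms by (meson Qp_iff Zp_Qp)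
  have pk1: "1 / real p ^ k \<le> 1" using p_gt_1 by simp
  then have "av (x - q) \<le> 1" using q(2) by linarith
  then have "av q \<le> 1" using av_diff_le[of x 1 "x - q"] assms by (auto simp: Zp_iff)
  obtain a b :: int where ab: "b > 0" "coprime a b" "q = of_int a / of_int b"
    using q(1) by (metis Rats_cases')
  have "\<not> int p dvd b"
  proof
    assume "int p dvd b"
    have "\<not> int p dvd a"
    proof
      assume "int p dvd a"
      then have "is_unit (int p)" using coprime_common_divisor[OF ab(2)] \<open>int p dvd b\<close> by blast
      then show False using p_gt_1 by simp
    qed
    then have a1: "av (of_int a) = 1" by (rule av_of_int_eq_1)
    have "av (of_int b) \<le> 1 / real p ^ 1"
      unfolding av_of_int_le_iff using \<open>int p dvd b\<close> by simp
    also have "\<dots> < 1" using p_gt_1 by simp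
    finally have "av (of_int b) < 1" .
    moreover have "av (of_int b) > 0" using ab(1) by (intro av_pos) simp
    moreover have "av q = 1 / av (of_int b)" unfolding ab(3) av_divide a1 ..
    ultimately have "av q > 1" by simp
    then show False using \<open>av q \<le> 1\<close> by simp
  qed
  then have b1: "av (of_int b) = 1" by (rule av_of_int_eq_1)
  have "coprime b (int p ^ k)"
    using \<open>\<not> int p dvd b\<close> prime_p prime_imp_coprime[of "int p" b] by (simp add: coprime_commute)
  then obtain c where c: "[b * c = 1] (mod int p ^ k)" using cong_solve_coprime_int by blast
  have "av (q - of_int (a * c)) = av (of_int b * (q - of_int (a * c)))" by (simp add: av_mult b1)
  also have "of_int b * (q - of_int (a * c)) = (of_int (a * (1 - b * c)) :: 'k)"
    using ab by (simp add: algebra_simps)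
  also have "av \<dots> \<le> 1 / real p ^ k"
    using c by (subst av_of_int_le_iff) (metis cong_iff_dvd_diff cong_sym dvd_mult)
  finally have "av (q - of_int (a * c)) \<le> 1 / real p ^ k" .
  with q(2) have "av ((x - q) + (q - of_int (a * c))) \<le> 1 / real p ^ k"
    by (intro av_add_le) auto
  then show ?thesis by (intro exI[of _ "a * c"]) simp
qed

lemma Zp_approx_nat:
  assumes "x \<in> Zp av"
  shows "\<exists>m<p ^ k. av (x - of_nat m) \<le> 1 / real p ^ k"
proof -
  obtain m where m: "av (x - of_int m) \<le> 1 / real p ^ k" using Zp_approx[OF assms] by blast
  define n where "n = nat (m mod int p ^ k)"
  have n: "int n = m mod int p ^ k" using p_pos by (simp add: n_def)
  have "int p ^ k dvd m - int n" by (simp add: n minus_mod_eq_mult_div)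
  then have "av (of_int (m - int n)) \<le> 1 / real p ^ k" by (simp only: av_of_int_le_iff)
  with m have "av ((x - of_int m) + of_int (m - int n)) \<le> 1 / real p ^ k" by (intro av_add_le)
  moreover have "int n < int (p ^ k)" using p_pos by (simp add: n)
  ultimately show ?thesis by auto
qed

lemma av_of_nat_diff_le_iff:
  "i < p ^ k \<Longrightarrow> j < p ^ k \<Longrightarrow> av (of_nat i - of_nat j) \<le> 1 / real p ^ k \<longleftrightarrow> i = j"
proof -
  assume "i < p ^ k" "j < p ^ k"
  then have "int p ^ k dvd int i - int j \<longleftrightarrow> i = j"
    by (metis mod_eq_dvd_iff mod_less of_nat_eq_iff of_nat_mod of_nat_power)
  then show ?thesis using av_of_int_le_iff[of "int i - int j" k] by simp
qed

lemma Qp_scale_Zp: "x \<in> Qp av \<Longrightarrow> \<exists>n. of_nat p ^ n * x \<in> Zp av"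
proof -
  assume x: "x \<in> Qp av"
  obtain n where "av x < real p ^ n" using p_gt_1 real_arch_pow[of "real p"] by auto
  then have "av (of_nat p ^ n * x) \<le> 1" by (simp add: av_mult av_p_power)
  with x show ?thesis by (metis Qp_mult Qp_of_nat Qp_power Zp_iff)
qed

text \<open>A root of \<open>z\<^sup>2 + z - w\<close> is a fixed point of the contraction \<open>z \<mapsto> w - z\<^sup>2\<close> of the maximal ideal.\<close>

lemma Zp_root:
  assumes w: "w \<in> Qp av" "av w < 1"
  shows "\<exists>z\<in>Zp av. z + z ^ 2 = w"
proof -
  interpret M: Metric_space UNIV "\<lambda>x y. av (x - y)" by (rule Metric)
  define r where "r = 1 / real p"
  have r: "0 < r" "r < 1" using p_gt_1 by (auto simp: r_def)
  define z where "z = rec_nat 0 (\<lambda>_ y. w - y ^ 2)"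
  have z0: "z 0 = 0" and zS: "z (Suc n) = w - z n ^ 2" for n by (simp_all add: z_def)
  have z: "z n \<in> Qp av \<and> av (z n) \<le> r" for n
  proof (induction n)
    case (Suc n)
    have "av (z n ^ 2) \<le> r * 1"
      unfolding power2_eq_square av_mult using Suc r av_nonneg by (intro mult_mono) auto
    moreover have "av w \<le> r" using w Qp_av_less_1 by (simp add: r_def)
    ultimately show ?case using Suc w by (auto simp: zS intro: av_diff_le)
  qed (use r in \<open>auto simp: z0\<close>)
  have step: "av (z (Suc n) - z n) \<le> r ^ n" for n
  proof (induction n)
    case 0
    then show ?case using z[of 1] r by (simp add: z0)
  next
    case (Suc n)
    have "z (Suc (Suc n)) - z (Suc n) = - ((z (Suc n) + z n) * (z (Suc n) - z n))"
      by (simp add: zS algebra_simps power2_eq_square)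
    then have "av (z (Suc (Suc n)) - z (Suc n)) = av (z (Suc n) + z n) * av (z (Suc n) - z n)"
      by (simp add: av_mult)
    also have "\<dots> \<le> r * r ^ n"
      using z[of n] z[of "Suc n"] Suc r av_nonneg by (intro mult_mono av_add_le) auto
    finally show ?case by simp
  qed
  have cauchy: "av (z (n + k) - z n) \<le> r ^ n" for n k
  proof (induction k)
    case (Suc k)
    have "av (z (Suc (n + k)) - z (n + k)) \<le> r ^ n"
      using order_trans[OF step[of "n + k"] power_decreasing[of n "n + k" r]] r by simp
    from av_add_le[OF this Suc] show ?case by simp
  qed (use r in auto)
  have "M.MCauchy z"
    unfolding M.MCauchy_def
  proof (intro conjI allI impI)
    fix e :: real assume "e > 0"
    then obtain N where N: "r ^ N < e" using r real_arch_pow_inv by blast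
    have "av (z m - z n) < e" if "N \<le> m" "N \<le> n" for m n
      using av_diff_le[OF cauchy[of N "m - N"] cauchy[of N "n - N"]] that N by simp
    then show "\<exists>N. \<forall>n n'. N \<le> n \<longrightarrow> N \<le> n' \<longrightarrow> av (z n - z n') < e" by blast
  qed simp
  then obtain x where "limitin M.mtopology z x sequentially"
    using complete by (auto simp: M.mcomplete_def)
  then have lim: "\<exists>n. av (z n - x) < e \<and> av (z (Suc n) - x) < e" if "e > 0" for e
    using that unfolding M.limit_metric_sequentially by (metis UNIV_I le_Suc_eq order_refl)
  have xQ: "x \<in> Qp av"
  proof (rule Qp_limit)
    fix e :: real assume "e > 0"
    then show "\<exists>y\<in>Qp av. av (x - y) < e" using lim[of e] z by (metis av_diff_commute)
  qed
  obtain n where "av (z n - x) < 1" using lim[of 1] by auto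
  then have x1: "av x \<le> 1"
    using av_diff_le[of "z n" 1 "z n - x"] z[of n] r by simp
  \<comment> \<open>Continuity in ultrametric form: the residual at \<open>x\<close> is, up to sign,
    a sum of two terms, each smaller than it for a suitable \<open>n\<close> unless it
    vanishes.\<close>
  have "x + x ^ 2 = w"
  proof (rule ccontr)
    assume "x + x ^ 2 \<noteq> w"
    then have "av (x + x ^ 2 - w) > 0" by (intro av_pos) simp
    then obtain n where n: "av (z n - x) < av (x + x ^ 2 - w)" "av (z (Suc n) - x) < av (x + x ^ 2 - w)"
      using lim by blast
    have "av (z n + x) * av (z n - x) \<le> 1 * av (z n - x)"
      using z[of n] x1 r av_nonneg by (intro mult_right_mono av_add_le) auto
    with n have "av (z n + x) * av (z n - x) < av (x + x ^ 2 - w)" by simp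
    then have "av ((z n + x) * (z n - x)) < av (x + x ^ 2 - w)" by (simp add: av_mult)
    from av_add_less[OF this n(2)]
    have "av ((z n + x) * (z n - x) + (z (Suc n) - x)) < av (x + x ^ 2 - w)" .
    moreover have "(z n + x) * (z n - x) + (z (Suc n) - x) = - (x + x ^ 2 - w)"
      by (simp add: zS algebra_simps power2_eq_square)
    ultimately show False by (simp only: av_minus)
  qed
  then show ?thesis using xQ x1 by (auto simp: Zp_iff)
qed

text \<open>Writing \<open>u = (1 + 2 z)^2\<close> leads to \<open>z + z^2 = (u - 1) / 4\<close>.
  The bound \<open>av 4\<close> treats all primes alike: it means congruent to 1 modulo
  \<open>p\<close> for odd \<open>p\<close> and modulo 8 for \<open>p = 2\<close>.\<close>

lemma Zp_square:
  assumes "u \<in> Qp av" "av (u - 1) < av 4"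
  shows "\<exists>y\<in>Zp av. y ^ 2 = u"
proof -
  have "av 4 > 0" by (intro av_pos) simp
  then have "av ((u - 1) / 4) < 1" using assms(2) by (simp add: av_divide)
  moreover have "(u - 1) / 4 \<in> Qp av" using assms(1) by (intro Qp_divide Qp_diff) simp_all
  ultimately obtain z where z: "z \<in> Zp av" "z + z ^ 2 = (u - 1) / 4" using Zp_root by blast
  then have "(1 + 2 * z) ^ 2 = u" by (simp add: power2_eq_square field_simps)
  moreover have "1 + 2 * z \<in> Zp av" using z by (intro Zp_add Zp_mult) simp_all
  ultimately show ?thesis by blast
qed

end

section \<open>Normal form of a ramified quadratic extension\<close>

lemma coset_eq_iff:
  fixes M :: "'a::ab_group_add set"
  assumes "0 \<in> M" "\<And>x y. x \<in> M \<Longrightarrow> y \<in> M \<Longrightarrow> x - y \<in> M"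
  shows "(+) x ` M = (+) y ` M \<longleftrightarrow> x - y \<in> M"
proof
  assume "(+) x ` M = (+) y ` M"
  then have "x + 0 \<in> (+) y ` M" using assms(1) by blast
  then show "x - y \<in> M" by auto
next
  have neg: "- z \<in> M" if "z \<in> M" for z using assms(2)[OF assms(1) that] by simp
  have add: "z + w \<in> M" if "z \<in> M" "w \<in> M" for z w using assms(2)[OF that(1) neg[OF that(2)]] by simp
  assume xy: "x - y \<in> M"
  have "(+) x ` M \<subseteq> (+) y ` M" if "x - y \<in> M" for x y
  proof
    fix z assume "z \<in> (+) x ` M"
    then obtain m where "m \<in> M" "z = y + ((x - y) + m)" by auto
    then show "z \<in> (+) y ` M" using add that by blast
  qed
  moreover have "y - x \<in> M" using neg[OF xy] by simp
  ultimately show "(+) x ` M = (+) y ` M" using xy by blast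
qed

context ramified_quadratic_extension
begin

lemma powi_le_iff: "real p powi i \<le> real p powi j \<longleftrightarrow> i \<le> j"
proof
  show "i \<le> j \<Longrightarrow> real p powi i \<le> real p powi j" using p_gt_1 by (intro power_int_increasing) auto
  have "real p powi j < real p powi i" if "j < i"
    using that p_gt_1 by (intro power_int_strict_increasing) auto
  then show "real p powi i \<le> real p powi j \<Longrightarrow> i \<le> j" by (meson not_le)
qed

lemma powi_eq_iff: "real p powi i = real p powi j \<longleftrightarrow> i = j"
  using powi_le_iff by (metis order_antisym order_refl)

lemma av_p_powi: "av (of_nat p powi k) = real p powi (- k)"
  by (cases k rule: int_cases2)
    (auto simp: power_int_minus av_inverse av_power av_p power_one_over inverse_eq_divide av_divide)

lemma powi_square: "(real p powi j) ^ 2 = real p powi (2 * j)"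
proof -
  have "real p powi (j + j) = real p powi j * real p powi j" by (rule power_int_add) simp
  then show ?thesis unfolding power2_eq_square mult_2 by (rule sym)
qed

text \<open>Cramer's rule passes from the given basis to \<open>1, x\<close>. The determinant
  \<open>d\<close> cannot vanish, since otherwise \<open>x\<close> would be a quotient of elements
  of \<open>Qp\<close>.\<close>

lemma basis:
  assumes "x \<notin> Qp av"
  shows "\<exists>a\<in>Qp av. \<exists>b\<in>Qp av. y = a + b * x"
proof -
  obtain e f where "\<forall>x. \<exists>!(a, b). a \<in> Qp av \<and> b \<in> Qp av \<and> x = a * e + b * f"
    using quadratic by blast
  then have coord: "\<exists>a\<in>Qp av. \<exists>b\<in>Qp av. z = a * e + b * f" for z by blast
  obtain a1 b1 where 1: "a1 \<in> Qp av" "b1 \<in> Qp av" "1 = a1 * e + b1 * f" using coord by blast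
  obtain a2 b2 where 2: "a2 \<in> Qp av" "b2 \<in> Qp av" "x = a2 * e + b2 * f" using coord by blast
  obtain a b where y: "a \<in> Qp av" "b \<in> Qp av" "y = a * e + b * f" using coord by blast
  define d where "d = a1 * b2 - a2 * b1"
  have e: "d * e = b2 * 1 - b1 * x"
    unfolding d_def by (subst 1(3), subst 2(3)) (simp add: algebra_simps)
  have f: "d * f = a1 * x - a2 * 1"
    unfolding d_def by (subst 1(3), subst 2(3)) (simp add: algebra_simps)
  have d: "d \<noteq> 0"
  proof
    assume "d = 0"
    with e f have *: "b1 * x = b2" "a1 * x = a2" by simp_all
    have "b1 = 0" using * assms 1 2 by (metis Qp_divide nonzero_mult_div_cancel_left)
    moreover have "a1 = 0" using * assms 1 2 by (metis Qp_divide nonzero_mult_div_cancel_left)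
    ultimately show False using 1(3) by simp
  qed
  have "d * y = a * (d * e) + b * (d * f)" by (simp add: y algebra_simps)
  also have "\<dots> = (a * b2 - b * a2) + (b * a1 - a * b1) * x" unfolding e f by (simp add: algebra_simps)
  finally have "y = ((a * b2 - b * a2) + (b * a1 - a * b1) * x) / d"
    using d by (simp add: eq_divide_eq mult.commute)
  then have "y = (a * b2 - b * a2) / d + ((b * a1 - a * b1) / d) * x"
    by (simp add: add_divide_distrib)
  moreover have "(a * b2 - b * a2) / d \<in> Qp av" "(b * a1 - a * b1) / d \<in> Qp av"
    unfolding d_def using 1 2 y by (auto intro!: Qp_divide Qp_diff Qp_mult)
  ultimately show ?thesis by blast
qed

text \<open>For nonzero \<open>a\<close> and \<open>b\<close> the squares of \<open>av a\<close> and
  \<open>av (b * y)\<close> are an even and an odd power of \<open>p\<close>, so the two values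
  differ and nothing cancels in the sum.\<close>

lemma uniformizer_coords:
  assumes y: "av y ^ 2 = 1 / real p" and ab: "a \<in> Qp av" "b \<in> Qp av" "av (a + b * y) \<le> 1"
  shows "av a \<le> 1 \<and> av b \<le> 1"
proof (cases "b = 0")
  case False
  then obtain j where j: "av b = real p powi j" using ab Qp_av_power_int by blast
  have b2: "av (b * y) ^ 2 = real p powi (2 * j - 1)"
  proof -
    have "av (b * y) ^ 2 = (real p powi j) ^ 2 * (1 / real p)" by (simp add: av_mult power_mult_distrib j y)
    also have "(real p powi j) ^ 2 = real p powi (2 * j)" by (rule powi_square)
    finally show ?thesis by (simp add: power_int_diff)
  qed
  have "av a \<noteq> av (b * y)"
  proof
    assume eq: "av a = av (b * y)"
    have "av (b * y) \<noteq> 0" using b2 by auto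
    with eq have "a \<noteq> 0" by auto
    then obtain i where i: "av a = real p powi i" using ab Qp_av_power_int by blast
    then have "av a ^ 2 = real p powi (2 * i)" by (simp add: powi_square)
    with eq b2 have "2 * i = 2 * j - 1" by (simp only: powi_eq_iff)
    then show False by presburger
  qed
  from av_add_eq_max[OF this] ab have *: "av a \<le> 1" "av (b * y) \<le> 1" by auto
  then have "av (b * y) ^ 2 \<le> real p powi 0" using av_nonneg by (simp add: power_le_one)
  then have "2 * j - 1 \<le> 0" unfolding b2 powi_le_iff .
  then have "j \<le> 0" by presburger
  then have "av b \<le> real p powi 0" unfolding j powi_le_iff .
  with * show ?thesis by simp
qed (use ab in auto)

lemma unit_2_adic:
  assumes "p = 2" "u \<in> Qp av" "av u = 1"
  shows "av (u - 1) \<le> 1 / 2"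
proof -
  have "u \<in> Zp av" using assms by (simp add: Zp_iff)
  from Zp_approx_nat[OF this, of 1] obtain m where m: "m < 2" "av (u - of_nat m) \<le> 1 / 2"
    unfolding assms(1) by auto
  have "m \<noteq> 0"
  proof
    assume "m = 0"
    then show False using m(2) assms(3) by simp
  qed
  with m have "m = 1" by simp
  with m show ?thesis by simp
qed

lemma av_2_cases: "(p = 2 \<and> av 2 = 1 / 2) \<or> (odd p \<and> av 2 = 1)"
proof (cases "p = 2")
  case True
  then show ?thesis using av_p by simp
next
  case False
  then have "\<not> p dvd 2" using prime_p by (metis primes_dvd_imp_eq two_is_prime_nat)
  then have "\<not> int p dvd 2" by presburger
  moreover have "odd p" using prime_odd_nat[OF prime_p] False p_gt_1 by linarith
  ultimately show ?thesis using av_of_int_eq_1[of 2] by simp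
qed

text \<open>Completing the square gives a generator whose square \<open>D\<close> can be scaled to
  value \<open>1 / p\<close> or 1. In the first case \<open>\<theta>\<close> is a uniformizer. In
  the second, ramification yields a unit \<open>c\<close> of \<open>Qp\<close> such that
  \<open>c + \<theta>\<close> is a uniformizer, which is possible only for \<open>p = 2\<close> and
  \<open>D\<close> congruent to -1 modulo 4.\<close>

lemma normal_form:
  "\<exists>\<theta> D. \<theta> ^ 2 = D \<and> D \<in> Zp av \<and> \<theta> \<notin> Qp av \<and>
     (\<forall>a\<in>Qp av. \<forall>b\<in>Qp av. av (a + b * \<theta>) \<le> 1 \<longrightarrow> av a \<le> 1 \<and> av b \<le> 1) \<and>
     (av D = 1 / real p \<or> p = 2 \<and> av (D + 1) \<le> 1 / 4)"
proof -
  obtain x where x: "x \<noteq> 0" "av x \<notin> av ` Qp av" using ramified by blast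
  have x': "av x \<noteq> real p powi k" for k
  proof
    assume "av x = real p powi k"
    then have "av x = av (of_nat p powi (- k))" by (simp add: av_p_powi)
    then show False using x(2) by (metis Qp_of_nat Qp_power_int imageI)
  qed
  have xQ: "x \<notin> Qp av" using x by blast
  obtain s t where st: "s \<in> Qp av" "t \<in> Qp av" "x ^ 2 = s + t * x" using basis[OF xQ] by blast
  define \<eta> where "\<eta> = x - t / 2"
  define C where "C = s + t ^ 2 / 4"
  have C: "C \<in> Qp av" using st unfolding C_def by (intro Qp_add Qp_divide) auto
  have \<eta>: "\<eta> ^ 2 = C" unfolding \<eta>_def C_def power2_diff st(3) by (simp add: field_simps power2_eq_square)
  have \<eta>Q: "\<eta> \<notin> Qp av"
  proof
    assume "\<eta> \<in> Qp av"
    then have "\<eta> + t / 2 \<in> Qp av" using st by (intro Qp_add Qp_divide) auto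
    then show False using xQ by (simp add: \<eta>_def)
  qed
  then have "C \<noteq> 0" using \<eta> by auto
  then obtain k where k: "av C = real p powi k" using C Qp_av_power_int by blast
  \<comment> \<open>Rounding up makes \<open>k - 2 * j\<close> equal to 0 or -1; rounding down would
    produce the value \<open>p\<close> in place of \<open>1 / p\<close>.\<close>
  define j where "j = (k + 1) div 2"
  define \<theta> where "\<theta> = \<eta> * of_nat p powi j"
  define D where "D = C * (of_nat p powi j) ^ 2"
  have pj: "of_nat p powi j \<in> Qp av" "of_nat p powi j \<noteq> (0::'k)" by auto
  have D: "D \<in> Qp av" unfolding D_def using C pj by auto
  have \<theta>: "\<theta> ^ 2 = D" by (simp add: \<theta>_def D_def power_mult_distrib \<eta>)
  have \<theta>Q: "\<theta> \<notin> Qp av"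
  proof
    assume "\<theta> \<in> Qp av"
    then have "\<theta> / of_nat p powi j \<in> Qp av" using pj by blast
    then show False using \<eta>Q pj by (simp add: \<theta>_def)
  qed
  have "av D = real p powi k * (real p powi (- j)) ^ 2"
    by (simp only: D_def av_mult av_power k av_p_powi)
  also have "\<dots> = real p powi (k - 2 * j)"
    unfolding powi_square by (simp add: power_int_diff power_int_minus divide_inverse)
  finally have avD: "av D = real p powi (k - 2 * j)" .
  have "k - 2 * j = 0 \<or> k - 2 * j = - 1" unfolding j_def by presburger
  then consider "av D = 1 / real p" | "av D = 1"
    using avD by (auto simp: power_int_minus divide_inverse)
  then show ?thesis
  proof cases
    case 1
    have DZ: "D \<in> Zp av" using 1 D p_gt_1 by (simp add: Zp_iff)
    have "av \<theta> ^ 2 = 1 / real p" using 1 \<theta> by (metis av_power)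
    then show ?thesis using 1 uniformizer_coords \<theta>Q \<theta> DZ by blast
  next
    case 2
    then have "av \<theta> ^ 2 = 1" using \<theta> by (metis av_power)
    then have av\<theta>: "av \<theta> = 1" using av_nonneg[of \<theta>] by (simp add: power2_eq_1_iff)
    obtain a b where ab: "a \<in> Qp av" "b \<in> Qp av" "x = a + b * \<theta>" using basis[OF \<theta>Q] by blast
    have "b \<noteq> 0" using ab xQ by auto
    then obtain i where i: "av b = real p powi i" using ab Qp_av_power_int by blast
    \<comment> \<open>Unequal values would make \<open>av x\<close> the value of an element of
      \<open>Qp\<close>, against the choice of \<open>x\<close>.\<close>
    have ab_eq: "av a = av b"
    proof (rule ccontr)
      assume ne: "av a \<noteq> av b"
      then have "av x = max (av a) (av b)" using av_add_eq_max[of a "b * \<theta>"] ab av\<theta> by (simp add: av_mult)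
      moreover have "av b \<noteq> 0" using \<open>b \<noteq> 0\<close> by (simp add: av_eq_0_iff)
      ultimately have "av x = av a \<and> a \<noteq> 0 \<or> av x = av b"
        using av_nonneg[of b] by (auto simp: max_def split: if_splits)
      then show False using x' ab i Qp_av_power_int by metis
    qed
    define c where "c = a / b"
    have c: "c \<in> Qp av" "av c = 1" using ab ab_eq \<open>b \<noteq> 0\<close> av_eq_0_iff[of b] by (auto simp: c_def av_divide)
    define y where "y = c + \<theta>"
    have xy: "x = b * y" using ab \<open>b \<noteq> 0\<close> by (simp add: y_def c_def field_simps)
    have y': "av y \<noteq> real p powi l" for l
    proof
      assume "av y = real p powi l"
      then have "av x = real p powi (i + l)" using xy i by (simp add: av_mult power_int_add)
      then show False using x' by blast
    qed
    have y1: "av y < 1" using y'[of 0] av_add_le[of c 1 \<theta>] c av\<theta> by (simp add: y_def)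
    have yc: "y * (y - 2 * c) = D - c ^ 2"
      using \<theta> by (simp add: y_def power2_eq_square algebra_simps)
    have "D - c ^ 2 \<noteq> 0"
    proof
      assume "D - c ^ 2 = 0"
      then have "\<theta> ^ 2 = c ^ 2" using \<theta> by simp
      then have "\<theta> = c \<or> \<theta> = - c" by (simp add: power2_eq_iff)
      then show False using c \<theta>Q by auto
    qed
    moreover have "D - c ^ 2 \<in> Qp av" using D c by auto
    ultimately obtain l where l: "av (D - c ^ 2) = real p powi l" using Qp_av_power_int by blast
    have av2c: "av (2 * c) = av 2" using c by (simp add: av_mult)
    obtain t where t: "av 2 = real p powi t"
      using Qp_av_power_int[of 2] by auto
    \<comment> \<open>The product of \<open>y\<close> and \<open>y - 2 * c\<close> lies in
      \<open>Qp\<close>. If the second factor had value \<open>av 2\<close>, then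
      \<open>av y\<close> would lie in the value group. Hence \<open>av 2 < av y < 1\<close>, which
      forces \<open>p = 2\<close> and makes both factors equally large.\<close>
    have "\<not> av y < av 2"
    proof
      assume "av y < av 2"
      then have "av (y - 2 * c) = av 2" using av_add_eq[of y "- (2 * c)"] av2c by simp
      then have "av y * real p powi t = real p powi l" using yc l t by (metis av_mult)
      then have "av y = real p powi (l - t)" by (simp add: power_int_diff field_simps)
      then show False using y' by blast
    qed
    moreover have "av y \<noteq> av 2" using y' t by metis
    ultimately have y2: "av 2 < av y" by simp
    then have p2: "p = 2" "av 2 = 1 / 2" using y1 av_2_cases by auto
    have "av (y - 2 * c) = av y" using av_add_eq[of "- (2 * c)" y] y2 av2c by simp
    then have yl: "av y ^ 2 = 2 powi l" using yc l p2 by (metis av_mult of_nat_numeral power2_eq_square)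
    have "(2::real) powi l < 2 powi 0" "(2::real) powi (-2) < 2 powi l"
    proof -
      have "av y ^ 2 < 1 ^ 2" using y1 av_nonneg by (intro power_strict_mono) auto
      then show "(2::real) powi l < 2 powi 0" by (simp add: yl)
      have "(1 / 2) ^ 2 < av y ^ 2" using y2 p2 by (intro power_strict_mono) auto
      then show "(2::real) powi (-2) < 2 powi l" by (simp add: yl power_int_minus power_divide)
    qed
    then have "l < 0" "-2 < l" using powi_le_iff[of 0 l] powi_le_iff[of l "-2"] p2 by auto
    then have l1: "l = -1" by simp
    then have y2: "av y ^ 2 = 1 / real p" using yl p2 by (simp add: power_int_minus)
    \<comment> \<open>Modulo 4, \<open>m\<close> is 2 and \<open>c ^ 2\<close> is 1, so
      \<open>D = c ^ 2 + m\<close> is -1.\<close>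
    define m where "m = D - c ^ 2"
    have m: "m \<in> Qp av" "av m = 1 / 2" using \<open>D - c ^ 2 \<in> Qp av\<close> l l1 p2
      by (auto simp: m_def power_int_minus)
    have "av (m / 2 - 1) \<le> 1 / 2"
      using m p2 by (intro unit_2_adic) (auto simp: av_divide)
    then have "av (2 * (m / 2 - 1)) \<le> 1 / 4" unfolding av_mult p2 by simp
    then have m2: "av (m - 2) \<le> 1 / 4" by (simp add: algebra_simps)
    have c1: "av (c - 1) \<le> 1 / 2" using c p2 by (intro unit_2_adic) auto
    have "av (c - 1) * av (c - 1) \<le> 1 / 2 * (1 / 2)" using c1 av_nonneg by (intro mult_mono) auto
    then have "av ((c - 1) * (c - 1)) \<le> 1 / 4" by (simp add: av_mult)
    moreover have "av (2 * (c - 1)) \<le> 1 / 4" unfolding av_mult p2 using c1 by simp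
    ultimately have "av ((c - 1) * (c - 1) + 2 * (c - 1)) \<le> 1 / 4" by (rule av_add_le)
    with m2 have "av ((m - 2) + ((c - 1) * (c - 1) + 2 * (c - 1))) \<le> 1 / 4" by (rule av_add_le)
    moreover have "av 4 \<le> 1 / 4" using av_mult[of 2 2] unfolding p2 by simp
    ultimately have "av (((m - 2) + ((c - 1) * (c - 1) + 2 * (c - 1))) + 4) \<le> 1 / 4" by (rule av_add_le)
    moreover have "((m - 2) + ((c - 1) * (c - 1) + 2 * (c - 1))) + 4 = D + 1"
      by (simp add: m_def algebra_simps power2_eq_square)
    ultimately have D1: "av (D + 1) \<le> 1 / 4" by simp
    have "av u \<le> 1 \<and> av v \<le> 1" if uv: "u \<in> Qp av" "v \<in> Qp av" "av (u + v * \<theta>) \<le> 1" for u v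
    proof -
      have "av ((u - v * c) + v * y) \<le> 1" using uv by (simp add: y_def algebra_simps)
      then have *: "av (u - v * c) \<le> 1 \<and> av v \<le> 1" using uv c by (intro uniformizer_coords[OF y2]) auto
      then have "av (v * c) \<le> 1" using c by (simp add: av_mult)
      then have "av ((u - v * c) + v * c) \<le> 1" using * by (intro av_add_le) auto
      with * show ?thesis by simp
    qed
    then show ?thesis using \<theta> \<theta>Q D 2 D1 p2 by (auto simp: Zp_iff)
  qed
qed

end

section \<open>Galois conjugation and the different\<close>

text \<open>Fixes one choice of the data found in \<open>normal_form\<close>. Here
  \<open>integer_coords_le\<close> says that the valuation ring is \<open>Zp[\<theta>]\<close>, and
  \<open>D_cases\<close> separates the uniformizer case from the dyadic unit case.\<close>

locale ramified_quadratic_basis = ramified_quadratic_extension p av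
  for p :: nat and av :: "'k::field_char_0 \<Rightarrow> real" +
  fixes \<theta> D :: 'k
  assumes \<theta>_square: "\<theta> ^ 2 = D"
    and D_Zp: "D \<in> Zp av"
    and \<theta>_notin_Qp: "\<theta> \<notin> Qp av"
    and integer_coords_le: "\<And>a b. a \<in> Qp av \<Longrightarrow> b \<in> Qp av \<Longrightarrow> av (a + b * \<theta>) \<le> 1 \<Longrightarrow> av a \<le> 1 \<and> av b \<le> 1"
    and D_cases: "av D = 1 / real p \<or> p = 2 \<and> av (D + 1) \<le> 1 / 4"
begin

lemma \<theta>_mult: "\<theta> * \<theta> = D" "\<theta> * (\<theta> * x) = D * x"
  using \<theta>_square by (simp_all add: power2_eq_square flip: mult.assoc)

lemma D_Qp: "D \<in> Qp av"
  using D_Zp by (rule Zp_Qp)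

lemma \<theta>_neq_0: "\<theta> \<noteq> 0" and D_neq_0: "D \<noteq> 0"
  using \<theta>_notin_Qp \<theta>_square by auto

lemma av_\<theta>_le_1: "av \<theta> \<le> 1"
proof -
  have "av \<theta> ^ 2 \<le> 1 ^ 2" using D_Zp \<theta>_square by (metis Zp_iff av_power one_power2)
  then show ?thesis by (rule power2_le_imp_le) simp
qed

lemma coords:
  obtains a b where "a \<in> Qp av" "b \<in> Qp av" "x = a + b * \<theta>"
  using basis[OF \<theta>_notin_Qp] by blast

lemma coords_unique:
  assumes "a \<in> Qp av" "b \<in> Qp av" "a' \<in> Qp av" "b' \<in> Qp av" "a + b * \<theta> = a' + b' * \<theta>"
  shows "a = a' \<and> b = b'"
proof -
  have "(b - b') * \<theta> = a' - a" using assms(5) by (simp add: algebra_simps)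
  moreover have "b = b'"
  proof (rule ccontr)
    assume "b \<noteq> b'"
    with calculation have "\<theta> = (a' - a) / (b - b')" by (simp add: field_simps)
    then show False using assms \<theta>_notin_Qp by (metis Qp_diff Qp_divide)
  qed
  ultimately show ?thesis by simp
qed

lemma integer_coords:
  assumes "av x \<le> 1"
  obtains a b where "a \<in> Zp av" "b \<in> Zp av" "x = a + b * \<theta>"
  using coords[of x] integer_coords_le assms by (metis Zp_iff)

lemma av_coords_le_1: "av a \<le> 1 \<Longrightarrow> av b \<le> 1 \<Longrightarrow> av (a + b * \<theta>) \<le> 1"
  using av_\<theta>_le_1 by (intro av_add_le) (auto simp: av_mult av_nonneg mult_le_one)

text \<open>As \<open>gal\<close> is a definite description, existence and uniqueness are both
  shown: changing the sign of \<open>\<theta>\<close> is an automorphism, and any automorphism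
  fixing \<open>Qp\<close> sends \<open>\<theta>\<close> to a square root of \<open>D\<close>, where
  \<open>\<theta>\<close> itself would give the identity.\<close>

lemma gal_coords:
  assumes "a \<in> Qp av" "b \<in> Qp av"
  shows "gal av (a + b * \<theta>) = a - b * \<theta>"
proof -
  let ?P = "\<lambda>\<sigma>. (\<forall>x y. \<sigma> (x + y) = \<sigma> x + \<sigma> y) \<and> (\<forall>x y. \<sigma> (x * y) = \<sigma> x * \<sigma> y) \<and>
                    (\<forall>x \<in> Qp av. \<sigma> x = x) \<and> \<sigma> \<noteq> id"
  have "\<forall>x. \<exists>z. \<exists>a\<in>Qp av. \<exists>b\<in>Qp av. x = a + b * \<theta> \<and> z = a - b * \<theta>"
    using coords by metis
  then obtain \<sigma> where \<sigma>: "\<And>x. \<exists>a\<in>Qp av. \<exists>b\<in>Qp av. x = a + b * \<theta> \<and> \<sigma> x = a - b * \<theta>" by metis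
  have \<sigma>_eq: "\<sigma> (a + b * \<theta>) = a - b * \<theta>" if "a \<in> Qp av" "b \<in> Qp av" for a b
    using \<sigma>[of "a + b * \<theta>"] coords_unique that by blast
  have "?P \<sigma>"
  proof (intro conjI allI ballI)
    fix x y
    obtain a b where x: "a \<in> Qp av" "b \<in> Qp av" "x = a + b * \<theta>" by (rule coords)
    obtain c d where y: "c \<in> Qp av" "d \<in> Qp av" "y = c + d * \<theta>" by (rule coords)
    have xy: "x + y = (a + c) + (b + d) * \<theta>" by (simp add: x y algebra_simps)
    have "\<sigma> (x + y) = (a + c) - (b + d) * \<theta>"
      unfolding xy using x y by (intro \<sigma>_eq Qp_add)
    also have "\<dots> = (a - b * \<theta>) + (c - d * \<theta>)" by (simp add: algebra_simps)
    finally show "\<sigma> (x + y) = \<sigma> x + \<sigma> y" unfolding x(3) y(3) using \<sigma>_eq x y by metis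
    have xy: "x * y = (a * c + b * d * D) + (a * d + b * c) * \<theta>"
      by (simp add: x y algebra_simps \<theta>_mult)
    have "\<sigma> (x * y) = (a * c + b * d * D) - (a * d + b * c) * \<theta>"
      unfolding xy using x y D_Qp by (intro \<sigma>_eq Qp_add Qp_mult)
    also have "\<dots> = (a - b * \<theta>) * (c - d * \<theta>)" by (simp add: algebra_simps \<theta>_mult)
    finally show "\<sigma> (x * y) = \<sigma> x * \<sigma> y" unfolding x(3) y(3) using \<sigma>_eq x y by metis
  next
    fix x assume "x \<in> Qp av"
    then show "\<sigma> x = x" using \<sigma>_eq[of x 0] by simp
  next
    have "\<sigma> \<theta> = - \<theta>" using \<sigma>_eq[of 0 1] by simp
    then have "\<sigma> \<theta> \<noteq> \<theta>" using \<theta>_neq_0 by simp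
    then show "\<sigma> \<noteq> id" by auto
  qed
  moreover have "\<tau> = \<sigma>" if "?P \<tau>" for \<tau>
  proof
    fix x
    obtain a b where x: "a \<in> Qp av" "b \<in> Qp av" "x = a + b * \<theta>" by (rule coords)
    have \<tau>_eq: "\<tau> (a + b * \<theta>) = a + b * \<tau> \<theta>" if "a \<in> Qp av" "b \<in> Qp av" for a b
      using that \<open>?P \<tau>\<close> by metis
    have "\<tau> \<theta> * \<tau> \<theta> = \<theta> * \<theta>" using \<open>?P \<tau>\<close> \<theta>_mult(1) D_Qp by metis
    then have "\<tau> \<theta> = \<theta> \<or> \<tau> \<theta> = - \<theta>" by (simp add: square_eq_iff)
    moreover have "\<tau> \<theta> \<noteq> \<theta>"
    proof
      assume "\<tau> \<theta> = \<theta>"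
      then have "\<tau> y = y" for y using coords[of y] \<tau>_eq by metis
      then have "\<tau> = id" by auto
      then show False using \<open>?P \<tau>\<close> by blast
    qed
    ultimately show "\<tau> x = \<sigma> x" using \<tau>_eq[of a b] \<sigma>_eq[of a b] x by simp
  qed
  ultimately have "gal av = \<sigma>" unfolding gal_def by (intro the_equality)
  then show ?thesis using \<sigma>_eq assms by simp
qed

lemma gal_Qp: "x \<in> Qp av \<Longrightarrow> gal av x = x"
  using gal_coords[of x 0] by simp

lemma gal_simps [simp]:
  "gal av 0 = 0" "gal av 1 = 1" "gal av (of_nat n) = of_nat n" "gal av (numeral w) = numeral w"
  by (simp_all add: gal_Qp)

lemma gal_\<theta>: "gal av \<theta> = - \<theta>"
  using gal_coords[of 0 1] by simp

lemma gal_add: "gal av (x + y) = gal av x + gal av y"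
proof -
  obtain a b where x: "a \<in> Qp av" "b \<in> Qp av" "x = a + b * \<theta>" by (rule coords)
  obtain c d where y: "c \<in> Qp av" "d \<in> Qp av" "y = c + d * \<theta>" by (rule coords)
  have xy: "x + y = (a + c) + (b + d) * \<theta>" by (simp add: x y algebra_simps)
  have "gal av (x + y) = (a + c) - (b + d) * \<theta>"
    unfolding xy using x y by (intro gal_coords Qp_add)
  also have "\<dots> = (a - b * \<theta>) + (c - d * \<theta>)" by (simp add: algebra_simps)
  finally show ?thesis unfolding x(3) y(3) using gal_coords x y by metis
qed

lemma gal_mult: "gal av (x * y) = gal av x * gal av y"
proof -
  obtain a b where x: "a \<in> Qp av" "b \<in> Qp av" "x = a + b * \<theta>" by (rule coords)
  obtain c d where y: "c \<in> Qp av" "d \<in> Qp av" "y = c + d * \<theta>" by (rule coords)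
  have xy: "x * y = (a * c + b * d * D) + (a * d + b * c) * \<theta>"
    by (simp add: x y algebra_simps \<theta>_mult)
  have "gal av (x * y) = (a * c + b * d * D) - (a * d + b * c) * \<theta>"
    unfolding xy using x y D_Qp by (intro gal_coords Qp_add Qp_mult)
  also have "\<dots> = (a - b * \<theta>) * (c - d * \<theta>)" by (simp add: algebra_simps \<theta>_mult)
  finally show ?thesis unfolding x(3) y(3) using gal_coords x y by metis
qed

lemma gal_gal [simp]: "gal av (gal av x) = x"
proof -
  obtain a b where x: "a \<in> Qp av" "b \<in> Qp av" "x = a + b * \<theta>" by (rule coords)
  then have "gal av x = a + (- b) * \<theta>" using gal_coords by simp
  then show ?thesis using gal_coords[of a "- b"] x Qp_minus by simp
qed

lemma gal_minus: "gal av (- x) = - gal av x"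
  using gal_mult[of "-1" x] gal_Qp[of "-1"] by (simp add: Qp_minus)

lemma gal_diff: "gal av (x - y) = gal av x - gal av y"
  using gal_add[of x "- y"] by (simp add: gal_minus)

lemma gal_eq_0_iff [simp]: "gal av x = 0 \<longleftrightarrow> x = 0"
  using gal_gal[of x] by (metis gal_simps(1))

lemma gal_inverse: "gal av (inverse x) = inverse (gal av x)"
proof (cases "x = 0")
  case False
  then have "gal av x * gal av (inverse x) = 1" using gal_mult[of x "inverse x"] by simp
  then show ?thesis by (metis inverse_unique)
qed simp

lemma gal_divide: "gal av (x / y) = gal av x / gal av y"
  by (simp add: divide_inverse gal_mult gal_inverse)

lemma gal_power: "gal av (x ^ n) = gal av x ^ n"
  by (induction n) (auto simp: gal_mult)

lemma gal_integer: "av x \<le> 1 \<Longrightarrow> av (gal av x) \<le> 1"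
proof -
  assume "av x \<le> 1"
  then obtain a b where ab: "a \<in> Zp av" "b \<in> Zp av" "x = a + b * \<theta>" by (rule integer_coords)
  then have "gal av x = a + (- b) * \<theta>" using gal_coords by (simp add: Zp_iff)
  then show ?thesis using av_coords_le_1[of a "- b"] ab by (simp add: Zp_iff)
qed

section \<open>Norm, trace and the different\<close>

lemma gal_norm_coords:
  "a \<in> Qp av \<Longrightarrow> b \<in> Qp av \<Longrightarrow> gal_norm av (a + b * \<theta>) = a ^ 2 - D * b ^ 2"
  unfolding gal_norm_def by (subst gal_coords) (simp_all add: algebra_simps power2_eq_square \<theta>_mult)

lemma gal_norm_Qp: "gal_norm av x \<in> Qp av"
  using coords[of x] gal_norm_coords D_Qp by (metis Qp_diff Qp_mult Qp_power)

lemma gal_trace_coords: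
  "a \<in> Qp av \<Longrightarrow> b \<in> Qp av \<Longrightarrow> gal_trace av (a + b * \<theta>) = 2 * a"
  by (simp add: gal_trace_def gal_coords)

lemma gal_trace_Qp: "gal_trace av x \<in> Qp av"
  using coords[of x] gal_trace_coords by (metis Qp_mult Qp_numeral)

lemma gal_norm_mult: "gal_norm av (x * y) = gal_norm av x * gal_norm av y"
  by (simp add: gal_norm_def gal_mult)

text \<open>Division by \<open>2 * \<theta>\<close>, the derivative of \<open>X^2 - D\<close> at
  \<open>\<theta>\<close>, is Euler's construction of the trace dual basis; the generator of the
  different comes from here.\<close>

lemma gal_trace_half_\<theta>:
  assumes "u \<in> Qp av" "v \<in> Qp av"
  shows "gal_trace av ((u + v * \<theta>) / (2 * \<theta>)) = v"
proof -
  have "gal av ((u + v * \<theta>) / (2 * \<theta>)) = (u - v * \<theta>) / (2 * - \<theta>)"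
    by (simp only: gal_divide gal_coords[OF assms] gal_mult gal_simps gal_\<theta>)
  then show ?thesis using \<theta>_neq_0 by (simp add: gal_trace_def field_simps)
qed

text \<open>The integers are spanned by 1 and \<open>\<theta>\<close>, and the traces of
  \<open>x\<close> and \<open>x * \<theta>\<close> return the two coordinates of
  \<open>x * (2 * \<theta>)\<close>.\<close>

lemma inv_different_iff: "x \<in> inv_different av \<longleftrightarrow> av (x * (2 * \<theta>)) \<le> 1"
proof -
  define y where "y = x * (2 * \<theta>)"
  have xy: "x * z = (y * z) / (2 * \<theta>)" for z using \<theta>_neq_0 by (simp add: y_def)
  obtain u v where uv: "u \<in> Qp av" "v \<in> Qp av" "y = u + v * \<theta>" by (rule coords)
  show ?thesis
  proof
    assume x: "x \<in> inv_different av"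
    have tr: "gal_trace av (x * z) \<in> Zp av" if "av z \<le> 1" for z
      using x that by (simp add: inv_different_def integers_def)
    have "gal_trace av (x * 1) \<in> Zp av" by (rule tr) simp
    moreover have "gal_trace av (x * 1) = v" unfolding xy using uv by (simp add: gal_trace_half_\<theta>)
    ultimately have v: "av v \<le> 1" by (simp add: Zp_iff)
    have "y * \<theta> = v * D + u * \<theta>" by (simp add: uv algebra_simps \<theta>_mult)
    then have "gal_trace av (x * \<theta>) = u"
      unfolding xy using uv D_Qp by (simp add: gal_trace_half_\<theta> Qp_mult)
    moreover have "gal_trace av (x * \<theta>) \<in> Zp av"
      using av_\<theta>_le_1 by (rule tr)
    ultimately have u: "av u \<le> 1" by (simp add: Zp_iff)
    show "av (x * (2 * \<theta>)) \<le> 1" using av_coords_le_1[OF u v] uv by (simp add: y_def)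
  next
    assume y1: "av (x * (2 * \<theta>)) \<le> 1"
    show "x \<in> inv_different av"
      unfolding inv_different_def integers_def
    proof (intro CollectI ballI)
      fix z assume "z \<in> {x. av x \<le> 1}"
      then have "av (y * z) \<le> 1" using y1 by (simp add: y_def av_mult av_nonneg mult_le_one)
      then obtain a b where ab: "a \<in> Zp av" "b \<in> Zp av" "y * z = a + b * \<theta>" by (rule integer_coords)
      then have "gal_trace av (x * z) = b" unfolding xy by (simp add: gal_trace_half_\<theta> Zp_iff)
      then show "gal_trace av (x * z) \<in> Zp av" using ab by simp
    qed
  qed
qed

lemma different_iff: "x \<in> different av \<longleftrightarrow> av x \<le> av (2 * \<theta>)"
proof -
  have pos: "av (2 * \<theta>) > 0" using \<theta>_neq_0 by (intro av_pos) simp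
  show ?thesis
  proof
    assume "x \<in> different av"
    moreover have "1 / (2 * \<theta>) \<in> inv_different av" using \<theta>_neq_0 by (simp add: inv_different_iff)
    ultimately have "x * (1 / (2 * \<theta>)) \<in> integers av" unfolding different_def by blast
    then have "av (x * (1 / (2 * \<theta>))) \<le> 1" by (simp only: integers_def mem_Collect_eq)
    then show "av x \<le> av (2 * \<theta>)" using pos by (simp add: av_divide)
  next
    assume x: "av x \<le> av (2 * \<theta>)"
    have "av (x * y) \<le> 1" if "y \<in> inv_different av" for y
    proof -
      have "av x * av y \<le> av (2 * \<theta>) * av y" using x av_nonneg by (intro mult_right_mono)
      also have "\<dots> = av (y * (2 * \<theta>))" by (simp only: av_mult mult.commute)
      also have "\<dots> \<le> 1" using that by (simp only: inv_different_iff)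
      finally show ?thesis by (simp only: av_mult)
    qed
    then show "x \<in> different av" by (simp add: different_def integers_def)
  qed
qed

lemma different_coords_iff:
  assumes "a \<in> Qp av" "b \<in> Qp av"
  shows "a + b * \<theta> \<in> different av \<longleftrightarrow> av a \<le> av (2 * D) \<and> av b \<le> av 2"
proof -
  have pos: "av (2 * \<theta>) > 0" "av (2 * D) > 0" "av 2 > 0"
    using \<theta>_neq_0 D_neq_0 by (intro av_pos; simp)+
  have *: "(a + b * \<theta>) / (2 * \<theta>) = b / 2 + (a / (2 * D)) * \<theta>"
    using \<theta>_neq_0 D_neq_0 by (simp add: field_simps \<theta>_mult)
  have "a + b * \<theta> \<in> different av \<longleftrightarrow> av ((a + b * \<theta>) / (2 * \<theta>)) \<le> 1"
    using pos by (simp add: different_iff av_divide)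
  also have "\<dots> \<longleftrightarrow> av (b / 2) \<le> 1 \<and> av (a / (2 * D)) \<le> 1"
    unfolding * using integer_coords_le[of "b / 2" "a / (2 * D)"] av_coords_le_1[of "b / 2" "a / (2 * D)"]
      assms D_Qp by (meson Qp_divide Qp_mult Qp_numeral)
  also have "\<dots> \<longleftrightarrow> av a \<le> av (2 * D) \<and> av b \<le> av 2"
    using pos by (auto simp: av_divide)
  finally show ?thesis .
qed

lemma av_2_power: "\<exists>k. av 2 = 1 / real p ^ k" and av_D_power: "\<exists>k. av D = 1 / real p ^ k"
proof -
  show "\<exists>k. av 2 = 1 / real p ^ k" using av_of_int_power[of 2] by simp
  have "av D = 1" if "av (D + 1) \<le> 1 / 4"
    using av_add_eq[of "D + 1" "-1"] that by simp
  then have "av D = 1 / real p ^ 0 \<or> av D = 1 / real p ^ 1" using D_cases by auto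
  then show "\<exists>k. av D = 1 / real p ^ k" by blast
qed

text \<open>Representatives of the integers modulo the different are \<open>i + j \<theta>\<close>
  with \<open>i\<close> running modulo \<open>2 * D\<close> and \<open>j\<close> modulo 2.\<close>

lemma different_norm: "\<exists>f. different_norm av = p ^ f \<and> av (4 * D) = 1 / real p ^ f"
proof -
  obtain l where l: "av 2 = 1 / real p ^ l" using av_2_power by blast
  obtain k' where "av D = 1 / real p ^ k'" using av_D_power by blast
  then have "av (2 * D) = 1 / real p ^ (l + k')" by (simp add: av_mult l power_add)
  then obtain k where k: "av (2 * D) = 1 / real p ^ k" by blast
  have sub: "0 \<in> different av" "\<And>x y. x \<in> different av \<Longrightarrow> y \<in> different av \<Longrightarrow> x - y \<in> different av"
    by (auto simp: different_iff av_nonneg intro: av_diff_le)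
  note coset = coset_eq_iff[OF sub]
  define F where "F = (\<lambda>(i, j). (+) (of_nat i + of_nat j * \<theta>) ` different av)"
  define A where "A = {..<p ^ k} \<times> {..<p ^ l}"
  have "(\<lambda>x. (+) x ` different av) ` integers av = F ` A"
  proof (intro equalityI subsetI)
    fix C assume "C \<in> (\<lambda>x. (+) x ` different av) ` integers av"
    then obtain x where x: "av x \<le> 1" "C = (+) x ` different av" by (auto simp: integers_def)
    obtain a b where ab: "a \<in> Zp av" "b \<in> Zp av" "x = a + b * \<theta>" using x(1) by (rule integer_coords)
    obtain i where i: "i < p ^ k" "av (a - of_nat i) \<le> 1 / real p ^ k" using Zp_approx_nat[OF ab(1)] by blast
    obtain j where j: "j < p ^ l" "av (b - of_nat j) \<le> 1 / real p ^ l" using Zp_approx_nat[OF ab(2)] by blast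
    have "(a - of_nat i) + (b - of_nat j) * \<theta> \<in> different av"
      using i j ab by (subst different_coords_iff) (auto simp: k l Zp_iff)
    then have "x - (of_nat i + of_nat j * \<theta>) \<in> different av" by (simp add: ab algebra_simps)
    then have "C = F (i, j)" by (simp add: x F_def coset)
    then show "C \<in> F ` A" using i j by (auto simp: A_def)
  next
    fix C assume "C \<in> F ` A"
    then obtain i j where "C = (+) (of_nat i + of_nat j * \<theta>) ` different av" by (auto simp: F_def)
    moreover have "av (of_nat i + of_nat j * \<theta>) \<le> 1" by (intro av_coords_le_1 av_of_nat_le_1)
    ultimately show "C \<in> (\<lambda>x. (+) x ` different av) ` integers av" by (auto simp: integers_def)
  qed
  moreover have "inj_on F A"
  proof (rule inj_onI)
    fix x y assume xy: "x \<in> A" "y \<in> A" "F x = F y"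
    obtain i j i' j' where ij: "x = (i, j)" "y = (i', j')" by (metis surj_pair)
    have "(of_nat i + of_nat j * \<theta>) - (of_nat i' + of_nat j' * \<theta>) \<in> different av"
      using xy(3) by (simp add: F_def ij coset)
    then have "(of_nat i - of_nat i') + (of_nat j - of_nat j') * \<theta> \<in> different av"
      by (simp add: algebra_simps)
    then have "av (of_nat i - of_nat i') \<le> 1 / real p ^ k \<and> av (of_nat j - of_nat j') \<le> 1 / real p ^ l"
      by (subst (asm) different_coords_iff) (auto simp: k l)
    then have "i = i' \<and> j = j'" using xy(1,2) av_of_nat_diff_le_iff by (auto simp: A_def ij)
    then show "x = y" by (simp add: ij)
  qed
  ultimately have "different_norm av = card A" by (simp add: different_norm_def card_image)
  also have "\<dots> = p ^ (k + l)" by (simp add: A_def power_add)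
  finally have "different_norm av = p ^ (k + l)" .
  moreover have "av (4 * D) = 1 / real p ^ (k + l)"
    using av_mult[of 2 "2 * D"] k l by (simp add: power_add)
  ultimately show ?thesis by blast
qed

end

section \<open>Norms of units\<close>

text \<open>Otherwise squaring would be a surjection of the finite set of residues onto itself,
  hence injective, although 1 and \<open>p - 1\<close> have the same square.\<close>

lemma quad_nonresidue_exists:
  assumes "prime p" "odd p"
  shows "\<exists>r::nat. \<not> QuadRes (int p) (int r)"
proof (rule ccontr)
  assume "\<nexists>r::nat. \<not> QuadRes (int p) (int r)"
  then have qr: "\<exists>y. [y ^ 2 = int r] (mod int p)" for r by (auto simp: QuadRes_def)
  define S where "S = {0..<int p}"
  define f where "f = (\<lambda>x::int. x ^ 2 mod int p)"
  have p2: "2 < p" using assms prime_ge_2_nat[of p] by (cases "p = 2") auto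
  have "S \<subseteq> f ` S"
  proof
    fix r assume r: "r \<in> S"
    then obtain y where "[y ^ 2 = r] (mod int p)" using qr[of "nat r"] by (auto simp: S_def)
    then have "f (y mod int p) = r" using r by (simp add: f_def S_def cong_def power_mod)
    moreover have "y mod int p \<in> S" using p2 by (simp add: S_def)
    ultimately show "r \<in> f ` S" by blast
  qed
  then have "inj_on f S"
    by (intro finite_surj_inj) (auto simp: S_def)
  moreover have "f 1 = f (int p - 1)"
  proof -
    have "(int p - 1) ^ 2 = 1 + int p * (int p - 2)" by (simp add: power2_eq_square algebra_simps)
    then show ?thesis by (simp add: f_def)
  qed
  moreover have "1 \<in> S" "int p - 1 \<in> S" using p2 by (auto simp: S_def)
  ultimately have "1 = int p - 1" by (rule inj_onD)
  then show False using p2 by simp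
qed

text \<open>If the product were a nonresidue, Euler's criterion would make its power with exponent
  \<open>(p - 1) / 2\<close> both 1 and -1 modulo \<open>p\<close>.\<close>

lemma quad_nonresidue_mult:
  assumes "prime p" "2 < p" "\<not> QuadRes (int p) m" "\<not> QuadRes (int p) n"
  shows "QuadRes (int p) (m * n)"
proof (rule ccontr)
  assume mn: "\<not> QuadRes (int p) (m * n)"
  define k where "k = (p - 1) div 2"
  have ec: "[Legendre a (int p) = a ^ k] (mod int p)" for a
    unfolding k_def using assms by (intro euler_criterion)
  have not0: "\<not> [a = 0] (mod int p)" if "\<not> QuadRes (int p) a" for a
    using that unfolding QuadRes_def by (metis cong_sym zero_power2)
  then have L: "Legendre a (int p) = -1" if "\<not> QuadRes (int p) a" for a
    using that by (simp add: Legendre_def)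
  have "[(m * n) ^ k = (-1) * (-1)] (mod int p)"
    unfolding power_mult_distrib using ec[of m] ec[of n] L assms cong_mult cong_sym by metis
  moreover have "[(m * n) ^ k = -1] (mod int p)" using ec[of "m * n"] L mn cong_sym by metis
  ultimately have "[(-1) * (-1) = (-1::int)] (mod int p)" by (metis cong_sym cong_trans)
  then have "int p dvd 2" by (simp add: cong_iff_dvd_diff)
  then show False using assms(2) zdvd_imp_le by fastforce
qed

section \<open>The norm group: conductor, index, and units that are not norms\<close>

context ramified_quadratic_basis
begin

definition is_norm :: "'k \<Rightarrow> bool" where
  "is_norm u \<longleftrightarrow> (\<exists>z. z \<noteq> 0 \<and> u = gal_norm av z)"

lemma quad_char_eq: "quad_char av x = (if is_norm x then 1 else - 1)"
  by (simp add: quad_char_def is_norm_def)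

lemma is_norm_mult: "is_norm u \<Longrightarrow> is_norm v \<Longrightarrow> is_norm (u * v)"
  unfolding is_norm_def by (metis gal_norm_mult no_zero_divisors)

lemma is_norm_inverse: "is_norm u \<Longrightarrow> is_norm (inverse u)"
  unfolding is_norm_def by (metis gal_norm_def gal_inverse inverse_mult_distrib nonzero_imp_inverse_nonzero)

lemma is_norm_nonzero: "is_norm u \<Longrightarrow> u \<noteq> 0"
  by (auto simp: is_norm_def gal_norm_def)

lemma is_norm_divide: "is_norm u \<Longrightarrow> is_norm v \<Longrightarrow> is_norm (u / v)"
  by (simp add: divide_inverse is_norm_mult is_norm_inverse)

lemma is_norm_mult_iff: "is_norm v \<Longrightarrow> is_norm (u * v) \<longleftrightarrow> is_norm u"
  using is_norm_mult[of u v] is_norm_divide[of "u * v" v] is_norm_nonzero[of v] by auto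

lemma is_norm_square: "y \<in> Qp av \<Longrightarrow> y \<noteq> 0 \<Longrightarrow> is_norm (y ^ 2)"
  unfolding is_norm_def by (intro exI[of _ y]) (simp add: gal_norm_def gal_Qp power2_eq_square)

lemma is_norm_1: "is_norm 1"
  using is_norm_square[of 1] by simp

lemma is_norm_square_mult_iff: "y \<in> Qp av \<Longrightarrow> y \<noteq> 0 \<Longrightarrow> is_norm (u * y ^ 2) \<longleftrightarrow> is_norm u"
  by (simp add: is_norm_mult_iff is_norm_square)

lemma is_norm_near_1: "u \<in> Qp av \<Longrightarrow> av (u - 1) < av 4 \<Longrightarrow> is_norm u"
proof -
  assume u: "u \<in> Qp av" "av (u - 1) < av 4"
  then obtain y where y: "y \<in> Zp av" "y ^ 2 = u" using Zp_square by blast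
  have "u \<noteq> 0"
  proof
    assume "u = 0"
    then show False using u(2) av_of_nat_le_1[of 4] by simp
  qed
  then show "is_norm u" using y is_norm_square[of y] by (auto simp: Zp_iff)
qed

lemma unit_near_1: "x \<in> Qp av \<Longrightarrow> av (x - 1) < 1 \<Longrightarrow> x \<in> Zp_units av"
  using av_add_eq[of "x - 1" 1] by (simp add: Zp_units_iff)

lemma even_cases:
  assumes "p = 2"
  obtains "av D = 1" "av (D + 1) \<le> 1 / 4" "av (4 * D) = 1 / 4"
    | "av D = 1 / 2" "av (4 * D) = 1 / 8"
proof -
  have av2: "av 2 = 1 / 2" using av_2_cases assms by auto
  have 4: "av 4 = 1 / 4" using av_mult[of 2 2] by (simp add: av2)
  show ?thesis
  proof (cases "av (D + 1) \<le> 1 / 4")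
    case True
    then have "av D = 1" using av_add_eq[of "D + 1" "-1"] by simp
    then show ?thesis using that(1) True 4 by (simp add: av_mult)
  next
    case False
    then have "av D = 1 / 2" using D_cases assms by simp
    then show ?thesis using that(2) 4 by (simp add: av_mult)
  qed
qed

lemma unit_2_adic_diff:
  assumes "p = 2" "u \<in> Zp_units av" "v \<in> Zp_units av"
  shows "av (u - v) \<le> 1 / 2"
  using av_diff_le[of "u - 1" "1 / 2" "v - 1"] unit_2_adic assms by (simp add: Zp_units_iff)

text \<open>If \<open>D\<close> is not a unit, then \<open>av (4 * D) < av 4\<close> and
  \<open>u\<close> is even a square. For a dyadic unit \<open>D\<close> squares do not suffice:
  \<open>u\<close> may be 1 or 5 modulo 8, and \<open>1 - 4 * D\<close>, the norm of
  \<open>1 + 2 * \<theta>\<close>, supplies the class of 5.\<close>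

lemma is_norm_conductor_1:
  assumes u: "u \<in> Qp av" "av (u - 1) \<le> av (4 * D)"
  shows "is_norm u"
proof (cases "av D < 1")
  case True
  have "av 4 > 0" by (intro av_pos) simp
  with True have "av (4 * D) < av 4" by (simp add: av_mult)
  then show ?thesis using u by (intro is_norm_near_1) auto
next
  case False
  then have p2: "p = 2" using D_cases p_gt_1 by auto
  then have D: "av D = 1" "av (D + 1) \<le> 1 / 4" "av (4 * D) = 1 / 4"
    using False by (auto elim: even_cases)
  have 4: "av 4 = 1 / 4" using D by (simp add: av_mult)
  show ?thesis
  proof (cases "av (u - 1) < 1 / 4")
    case True
    then show ?thesis using u 4 by (intro is_norm_near_1) auto
  next
    case False
    then have u1: "av (u - 1) = 1 / 4" using u D by simp
    define n where "n = 1 - 4 * D"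
    have nQ: "n \<in> Qp av" using D_Qp unfolding n_def by (intro Qp_diff Qp_mult) auto
    have "n \<in> Zp_units av" by (rule unit_near_1[OF nQ]) (simp add: n_def D)
    then have n1: "av n = 1" by (simp add: Zp_units_iff)
    have "n = gal_norm av (1 + 2 * \<theta>)"
      using gal_norm_coords[of 1 2] by (simp add: n_def power2_eq_square)
    moreover have "1 + 2 * \<theta> \<noteq> 0" using calculation n1 by (auto simp: gal_norm_def)
    ultimately have n: "is_norm n" unfolding is_norm_def by blast
    \<comment> \<open>Both \<open>e\<close> and \<open>-D\<close> are congruent to 1 modulo 2, so
      \<open>u\<close> and \<open>n\<close> agree modulo 8 and their quotient is a square.\<close>
    define e where "e = (u - 1) / 4"
    have "e \<in> Qp av" unfolding e_def using u by (intro Qp_divide Qp_diff) auto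
    moreover have "av e = 1" using u1 4 by (simp add: e_def av_divide)
    ultimately have "av (e - 1) \<le> 1 / 2" using p2 by (intro unit_2_adic)
    moreover have "av (D + 1) \<le> 1 / 2" using D by simp
    ultimately have "av ((e - 1) + (D + 1)) \<le> 1 / 2" by (rule av_add_le)
    then have "1 / 4 * av (e + D) < 1 / 4" by simp
    then have "av (4 * (e + D)) < 1 / 4" unfolding av_mult 4 .
    moreover have "u / n - 1 = 4 * (e + D) / n"
      using is_norm_nonzero[OF n] by (simp add: e_def n_def field_simps)
    ultimately have "av (u / n - 1) < av 4" by (simp add: av_divide n1 4)
    moreover have "u / n \<in> Qp av" using u nQ by auto
    ultimately have "is_norm (u / n)" by (intro is_norm_near_1)
    then have "is_norm (u / n * n)" using n by (rule is_norm_mult)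
    then show ?thesis using is_norm_nonzero[OF n] by simp
  qed
qed

lemma is_norm_cong:
  assumes "is_norm u" "u \<in> Zp_units av" "v \<in> Qp av" "av (v - u) \<le> av (4 * D)"
  shows "is_norm v"
proof -
  have "u \<noteq> 0" using assms(1) by (rule is_norm_nonzero)
  then have "v / u - 1 = (v - u) / u" by (simp add: field_simps)
  then have "av (v / u - 1) \<le> av (4 * D)" using assms by (simp add: av_divide Zp_units_iff)
  then have "is_norm (v / u)" using assms by (intro is_norm_conductor_1) (auto simp: Zp_units_iff)
  then have "is_norm (v / u * u)" using assms(1) by (rule is_norm_mult)
  then show ?thesis using \<open>u \<noteq> 0\<close> by simp
qed

text \<open>Conjugation preserves integrality. Applied to \<open>z\<close> or to its inverse, this
  excludes \<open>av z < 1\<close> and \<open>av z > 1\<close> in turn.\<close>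

lemma norm_unit_integer:
  assumes "av (gal_norm av z) = 1"
  shows "av z = 1"
proof -
  have 1: "av z * av (gal av z) = 1" using assms by (simp add: gal_norm_def av_mult)
  then have z: "av z > 0" using av_nonneg[of z] by (cases "av z = 0") auto
  show ?thesis
  proof (cases "av z \<le> 1")
    case True
    then have "av z * av (gal av z) \<le> av z * 1" using gal_integer av_nonneg by (intro mult_left_mono) auto
    then show ?thesis using 1 True by simp
  next
    case False
    then have "av (inverse z) \<le> 1" by (simp add: av_inverse inverse_le_1_iff)
    then have "av (gal av (inverse z)) \<le> 1" by (rule gal_integer)
    then have "av (gal av z) \<ge> 1"
      using 1 av_nonneg[of "gal av z"] by (auto simp: gal_inverse av_inverse inverse_le_1_iff)
    then have "av z * 1 \<le> av z * av (gal av z)" using z by (intro mult_left_mono) auto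
    then show ?thesis using 1 False by simp
  qed
qed

text \<open>For \<open>a = 1 + 2 b\<close> the difference \<open>a^2 - 1\<close> is
  \<open>4 b (b + 1)\<close>, and \<open>b (b + 1)\<close> is even; so odd squares are 1 modulo 8,
  while even squares are 0 modulo 4.\<close>

lemma square_near:
  assumes "p = 2" "a \<in> Qp av" "av a \<le> 1"
  shows "av a = 1 \<and> av (a ^ 2 - 1) \<le> 1 / 8 \<or> av a \<le> 1 / 2 \<and> av (a ^ 2) \<le> 1 / 4"
proof (cases "av a = 1")
  case True
  define b where "b = (a - 1) / 2"
  have 2: "av 2 = 1 / 2" using av_2_cases assms by auto
  have a1: "av (a - 1) \<le> 1 / 2" using assms True by (intro unit_2_adic)
  have b: "b \<in> Qp av" "av b \<le> 1" using assms(2) a1 by (auto simp: b_def av_divide 2 intro!: Qp_divide Qp_diff)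
  have a: "a ^ 2 - 1 = 4 * (b * (b + 1))" by (simp add: b_def power2_eq_square field_simps)
  have "av (b * (b + 1)) \<le> 1 / 2"
  proof (cases "av b = 1")
    case True
    then have "av (b - 1) \<le> 1 / 2" using assms b by (intro unit_2_adic)
    moreover have "av 2 \<le> 1 / 2" using 2 by simp
    ultimately have "av ((b - 1) + 2) \<le> 1 / 2" by (rule av_add_le)
    then show ?thesis by (simp add: av_mult True add.commute)
  next
    case False
    then have "av b \<le> 1 / 2" using Qp_av_less_1[of b] b assms by simp
    moreover have "av (b + 1) \<le> 1" using b by (intro av_add_le) auto
    ultimately have "av b * av (b + 1) \<le> 1 / 2 * 1" using av_nonneg by (intro mult_mono) auto
    then show ?thesis by (simp add: av_mult)
  qed
  then have *: "1 / 4 * av (b * (b + 1)) \<le> 1 / 8" by simp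
  have av4: "av 4 = 1 / 4" using av_mult[of 2 2] by (simp add: 2)
  from * have "av (a ^ 2 - 1) \<le> 1 / 8" unfolding a av_mult[of 4] av4 .
  then show ?thesis using True by simp
next
  case False
  then have "av a \<le> 1 / 2" using Qp_av_less_1[of a] assms by simp
  moreover have "av a * av a \<le> 1 / 2 * (1 / 2)" using calculation av_nonneg by (intro mult_mono) auto
  ultimately show ?thesis by (simp add: power2_eq_square av_mult)
qed

lemma av_D_mult_le: "av x \<le> r \<Longrightarrow> av (D * x) \<le> r"
proof -
  assume "av x \<le> r"
  have "av D * av x \<le> 1 * av x" using D_Zp by (intro mult_right_mono av_nonneg) (simp add: Zp_iff)
  then show ?thesis using \<open>av x \<le> r\<close> by (simp add: av_mult)
qed

text \<open>For \<open>p = 2\<close> the unit \<open>u\<close> fails to be a norm as soon as it is congruent to \<open>1\<close> modulo \<open>d / 2\<close>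
  but not modulo \<open>d\<close>: modulo \<open>d\<close> the only norms of units are \<open>1\<close> and \<open>1 - D\<close> if \<open>D\<close> is not a
  unit, and \<open>1\<close> otherwise.\<close>

lemma not_norm_even:
  assumes p2: "p = 2" and u: "u \<in> Qp av" "av (u - 1) = av (2 * D)"
  shows "\<not> is_norm u"
proof
  assume "is_norm u"
  then obtain z where z: "u = gal_norm av z" by (auto simp: is_norm_def)
  have av2: "av 2 = 1 / 2" using av_2_cases p2 by auto
  have "av D \<le> 1" using D_Zp by (simp add: Zp_iff)
  then have "av (u - 1) < 1" unfolding u av_mult av2 by simp
  then have u1: "av u = 1" using unit_near_1[OF u(1)] by (simp add: Zp_units_iff)
  then have "av z \<le> 1" using norm_unit_integer z by simp
  then obtain a b where ab: "a \<in> Zp av" "b \<in> Zp av" "z = a + b * \<theta>" by (rule integer_coords)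
  then have abQ: "a \<in> Qp av" "b \<in> Qp av" "av a \<le> 1" "av b \<le> 1" by (auto simp: Zp_iff)
  have uab: "u = a ^ 2 - D * b ^ 2" using gal_norm_coords[OF abQ(1,2)] z ab by simp
  show False
  proof (cases rule: even_cases[OF p2])
    case 1
    have uD: "av (u - 1) = 1 / 2" using u 1 by (simp add: av_mult av2)
    \<comment> \<open>Parities of \<open>a\<close> and \<open>b\<close>. Equal parities make
      \<open>a^2 - D b^2\<close> even, against \<open>u\<close> being a unit; opposite parities make
      it 1 modulo 4, whereas \<open>u - 1\<close> has value exactly \<open>1 / 2\<close>.\<close>
    consider "av (a ^ 2 - 1) \<le> 1 / 8" "av (b ^ 2 - 1) \<le> 1 / 8"
      | "av (a ^ 2 - 1) \<le> 1 / 8" "av (b ^ 2) \<le> 1 / 4"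
      | "av (a ^ 2) \<le> 1 / 4" "av (b ^ 2 - 1) \<le> 1 / 8"
      | "av (a ^ 2) \<le> 1 / 4" "av (b ^ 2) \<le> 1 / 4"
      using square_near[OF p2 abQ(1,3)] square_near[OF p2 abQ(2,4)] by blast
    then show False
    proof cases
      case c: 1
      have "av ((a ^ 2 - 1) - D * (b ^ 2 - 1)) \<le> 1 / 2"
        by (rule av_diff_le) (use c 1 in \<open>simp_all add: av_mult\<close>)
      moreover have "av (2 - (D + 1)) \<le> 1 / 2"
        by (rule av_diff_le) (use 1 av2 in simp_all)
      ultimately have "av (((a ^ 2 - 1) - D * (b ^ 2 - 1)) + (2 - (D + 1))) \<le> 1 / 2"
        by (rule av_add_le)
      also have "((a ^ 2 - 1) - D * (b ^ 2 - 1)) + (2 - (D + 1)) = u" by (simp add: uab algebra_simps)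
      finally show False using u1 by simp
    next
      case c: 2
      have "av ((a ^ 2 - 1) - D * b ^ 2) \<le> 1 / 4"
        by (rule av_diff_le) (use c 1 in \<open>simp_all add: av_mult\<close>)
      also have "(a ^ 2 - 1) - D * b ^ 2 = u - 1" by (simp add: uab)
      finally show False using uD by simp
    next
      case c: 3
      have "av (a ^ 2 - D * (b ^ 2 - 1)) \<le> 1 / 4"
        by (rule av_diff_le) (use c 1 in \<open>simp_all add: av_mult\<close>)
      then have "av ((a ^ 2 - D * (b ^ 2 - 1)) - (D + 1)) \<le> 1 / 4"
        using 1(2) by (rule av_diff_le)
      also have "(a ^ 2 - D * (b ^ 2 - 1)) - (D + 1) = u - 1" by (simp add: uab algebra_simps)
      finally show False using uD by simp
    next
      case c: 4
      have "av (a ^ 2 - D * b ^ 2) \<le> 1 / 4"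
        by (rule av_diff_le) (use c 1 in \<open>simp_all add: av_mult\<close>)
      then show False using u1 uab by simp
    qed
  next
    case 2
    \<comment> \<open>As \<open>D\<close> is even, \<open>a\<close> must be odd. Then
      \<open>u - 1\<close> is congruent to \<open>-D\<close> or to 0 modulo 8, according to the
      parity of \<open>b\<close>, and so cannot have value \<open>1 / 4\<close>.\<close>
    have uD: "av (u - 1) = 1 / 4" using u 2 by (simp add: av_mult av2)
    have a: "av (a ^ 2 - 1) \<le> 1 / 8"
    proof (rule ccontr)
      assume "\<not> av (a ^ 2 - 1) \<le> 1 / 8"
      then have "av (a ^ 2) \<le> 1 / 2" using square_near[OF p2 abQ(1,3)] by auto
      moreover have "av (D * b ^ 2) \<le> 1 / 2 * 1" unfolding av_mult
        by (rule mult_mono) (use 2 abQ in \<open>simp_all add: av_power av_nonneg power_le_one\<close>)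
      ultimately have "av (a ^ 2 - D * b ^ 2) \<le> 1 / 2" by (intro av_diff_le) simp_all
      then show False using u1 uab by simp
    qed
    consider "av (b ^ 2 - 1) \<le> 1 / 8" | "av (b ^ 2) \<le> 1 / 4" using square_near[OF p2 abQ(2,4)] by auto
    then show False
    proof cases
      case c: 1
      have "av ((a ^ 2 - 1) - D * (b ^ 2 - 1)) \<le> 1 / 8"
        by (intro av_diff_le[OF a] av_D_mult_le c)
      then have "av (- D + ((a ^ 2 - 1) - D * (b ^ 2 - 1))) = av (- D)"
        using 2 by (intro av_add_eq) auto
      also have "- D + ((a ^ 2 - 1) - D * (b ^ 2 - 1)) = u - 1" by (simp add: uab algebra_simps)
      finally show False using uD 2 by simp
    next
      case c: 2
      have "av (D * b ^ 2) \<le> 1 / 8" unfolding av_mult 2(1) using c by simp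
      with a have "av ((a ^ 2 - 1) - D * b ^ 2) \<le> 1 / 8" by (rule av_diff_le)
      also have "(a ^ 2 - 1) - D * b ^ 2 = u - 1" by (simp add: uab)
      finally show False using uD by simp
    qed
  qed
qed

lemma av_2_adic_less:
  assumes "p = 2" "x \<in> Qp av" "av x < av (2 * D)"
  shows "av x \<le> av (4 * D)"
proof (cases rule: even_cases[OF assms(1)])
  case 1
  have "av (2 * D) = 1 / real p ^ 1" using 1 av_2_cases assms(1) by (auto simp: av_mult)
  then show ?thesis using Qp_av_less_power[OF assms(2), of 1] assms(1,3) 1 by simp
next
  case 2
  have av2: "av 2 = 1 / 2" using av_2_cases assms(1) by auto
  have "av (2 * D) = 1 / real p ^ 2" by (simp add: av_mult av2 2(1) assms(1))
  then show ?thesis using Qp_av_less_power[OF assms(2), of 2] assms(1,3) 2 by simp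
qed

lemma is_norm_1_minus_D: "p = 2 \<Longrightarrow> av D = 1 / 2 \<Longrightarrow> 1 - D \<in> Zp_units av \<and> is_norm (1 - D)"
proof -
  assume "p = 2" "av D = 1 / 2"
  then have u: "1 - D \<in> Zp_units av" using D_Qp by (intro unit_near_1) auto
  have "1 - D = gal_norm av (1 + \<theta>)" using gal_norm_coords[of 1 1] by simp
  moreover have "1 + \<theta> \<noteq> 0"
  proof
    assume "1 + \<theta> = 0"
    then show False using u calculation by (simp add: gal_norm_def Zp_units_iff)
  qed
  ultimately show ?thesis using u unfolding is_norm_def by blast
qed

text \<open>If \<open>D\<close> is a unit, the modulus \<open>2 * D\<close> amounts to 2 and every
  unit is already congruent to 1. Otherwise it amounts to 4, and the unit classes 1 and 3 contain
  the norms 1 and \<open>1 - D\<close>.\<close>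

lemma unit_mod_norm_even:
  assumes p2: "p = 2" and u: "u \<in> Zp_units av"
  shows "\<exists>n. is_norm n \<and> n \<in> Zp_units av \<and> av (u / n - 1) \<le> av (2 * D)"
proof -
  have av2: "av 2 = 1 / 2" using av_2_cases p2 by auto
  have u1: "av (u - 1) \<le> 1 / 2" using unit_2_adic[OF p2] u by (simp add: Zp_units_iff)
  have one: "is_norm 1" "1 \<in> Zp_units av" using is_norm_1 by (auto simp: Zp_units_iff)
  show ?thesis
  proof (cases "av (u - 1) \<le> av (2 * D)")
    case True
    then show ?thesis using one by (intro exI[of _ 1]) auto
  next
    case False
    show ?thesis
    proof (cases rule: even_cases[OF p2])
      case 1
      then show ?thesis using False u1 by (simp add: av_mult av2)
    next
      case 2
      have uQ: "u - 1 \<in> Qp av" using u by (auto simp: Zp_units_iff)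
      have "\<not> av (u - 1) < 1 / 2"
        using Qp_av_less_power[OF uQ, of 1] False p2 2 by (auto simp: av_mult av2)
      then have "(u - 1) / 2 \<in> Zp_units av" "- D / 2 \<in> Zp_units av"
        using u1 uQ D_Qp 2 by (auto simp: Zp_units_iff av_divide av2 intro!: Qp_divide Qp_minus)
      then have "av ((u - 1) / 2 - (- D / 2)) \<le> 1 / 2" by (rule unit_2_adic_diff[OF p2])
      then have "av (2 * ((u - 1) / 2 - (- D / 2))) \<le> 1 / 4" unfolding av_mult av2 by simp
      moreover have "2 * ((u - 1) / 2 - (- D / 2)) = u - (1 - D)" by (simp add: field_simps)
      ultimately have "av (u - (1 - D)) \<le> 1 / 4" by metis
      then have *: "av (u - (1 - D)) \<le> av (2 * D)" unfolding av_mult[of 2] av2 2(1) by simp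
      have n: "1 - D \<in> Zp_units av" "is_norm (1 - D)" using is_norm_1_minus_D p2 2 by auto
      have "u / (1 - D) - 1 = (u - (1 - D)) / (1 - D)"
        using is_norm_nonzero[OF n(2)] by (simp add: field_simps)
      then have "av (u / (1 - D) - 1) \<le> av (2 * D)"
        using * n(1) by (simp add: av_divide Zp_units_iff)
      then show ?thesis using n by blast
    qed
  qed
qed

text \<open>Up to a norm, a unit that is not a norm is \<open>1 + 2 D e\<close> with
  \<open>e\<close> a unit. In a product of two such elements the linear term is
  \<open>2 D (e + f)\<close> with \<open>e + f\<close> even, so the product is 1 modulo
  \<open>4 D\<close>.\<close>

lemma not_norm_mult_even:
  assumes p2: "p = 2" and u: "u \<in> Zp_units av" "\<not> is_norm u" and v: "v \<in> Zp_units av" "\<not> is_norm v"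
  shows "is_norm (u * v)"
proof -
  have av2: "av 2 = 1 / 2" using av_2_cases p2 by auto
  have reduce: "\<exists>n e. is_norm n \<and> e \<in> Zp_units av \<and> u = n * (1 + 2 * D * e)"
    if u: "u \<in> Zp_units av" "\<not> is_norm u" for u
  proof -
    obtain n where n: "is_norm n" "n \<in> Zp_units av" "av (u / n - 1) \<le> av (2 * D)"
      using unit_mod_norm_even[OF p2 u(1)] by blast
    have unQ: "u / n \<in> Qp av" using u n by (auto simp: Zp_units_iff)
    have "\<not> is_norm (u / n)"
      using is_norm_mult[OF _ n(1), of "u / n"] is_norm_nonzero[OF n(1)] u(2) by auto
    then have "\<not> av (u / n - 1) \<le> av (4 * D)" using is_norm_conductor_1[OF unQ] by blast
    then have eq: "av (u / n - 1) = av (2 * D)"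
      using av_2_adic_less[OF p2, of "u / n - 1"] unQ n(3) by fastforce
    define e where "e = (u / n - 1) / (2 * D)"
    have "av (2 * D) > 0" using D_neq_0 by (intro av_pos) simp
    then have "e \<in> Zp_units av"
      using unQ D_Qp eq by (auto simp: Zp_units_iff e_def av_divide intro!: Qp_divide Qp_diff Qp_mult)
    moreover have "u = n * (1 + 2 * D * e)"
      using is_norm_nonzero[OF n(1)] D_neq_0 by (simp add: e_def)
    ultimately show ?thesis using n by blast
  qed
  obtain n e where n: "is_norm n" "e \<in> Zp_units av" "u = n * (1 + 2 * D * e)" using reduce u by blast
  obtain m f where m: "is_norm m" "f \<in> Zp_units av" "v = m * (1 + 2 * D * f)" using reduce v by blast
  have "- f \<in> Zp_units av" using m by (auto simp: Zp_units_iff)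
  with n(2) have "av (e - (- f)) \<le> 1 / 2" by (rule unit_2_adic_diff[OF p2])
  then have "av (2 * D) * av (e + f) \<le> av (2 * D) * (1 / 2)" using av_nonneg by (intro mult_left_mono) auto
  also have "\<dots> = av (4 * D)" using av_mult[of 2 "2 * D"] by (simp add: av2)
  finally have 1: "av (2 * D * (e + f)) \<le> av (4 * D)" by (simp only: av_mult)
  have "av (2 * D * (2 * D) * (e * f)) = av (4 * D) * av D"
    using n(2) m(2) av_mult[of 2 2] by (simp add: av_mult Zp_units_iff)
  also have "\<dots> \<le> av (4 * D) * 1" using D_Zp av_nonneg by (intro mult_left_mono) (auto simp: Zp_iff)
  finally have "av (2 * D * (2 * D) * (e * f)) \<le> av (4 * D)" by simp
  with 1 have "av (2 * D * (e + f) + 2 * D * (2 * D) * (e * f)) \<le> av (4 * D)" by (rule av_add_le)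
  then have "is_norm ((1 + 2 * D * e) * (1 + 2 * D * f))"
    using n(2) m(2) D_Qp
    by (intro is_norm_conductor_1) (auto simp: algebra_simps Zp_units_iff intro!: Qp_add Qp_mult)
  then have "is_norm (n * m * ((1 + 2 * D * e) * (1 + 2 * D * f)))"
    by (rule is_norm_mult[OF is_norm_mult[OF n(1) m(1)]])
  then show ?thesis by (simp add: n(3) m(3) mult_ac)
qed

text \<open>For odd \<open>p\<close> the element \<open>D\<close> has value \<open>1 / p\<close>, so
  a norm \<open>a^2 - D b^2\<close> reduces to a square modulo \<open>p\<close>. Conversely, a unit
  with square residue is a square times an element close to 1.\<close>

lemma is_norm_odd_iff:
  assumes odd: "odd p" and u: "u \<in> Zp_units av" "av (u - of_int m) < 1"
  shows "is_norm u \<longleftrightarrow> QuadRes (int p) m"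
proof
  have D: "av D = 1 / real p" using D_cases odd by auto
  assume "is_norm u"
  then obtain z where z: "u = gal_norm av z" by (auto simp: is_norm_def)
  then have "av z \<le> 1" using norm_unit_integer u by (simp add: Zp_units_iff)
  then obtain a b where ab: "a \<in> Zp av" "b \<in> Zp av" "z = a + b * \<theta>" by (rule integer_coords)
  have uab: "u = a ^ 2 - D * b ^ 2" using gal_norm_coords[of a b] z ab by (simp add: Zp_iff)
  obtain k where k: "av (a - of_int k) \<le> 1 / real p ^ 1" using Zp_approx[OF ab(1)] by blast
  have "av (D * b ^ 2) < 1"
  proof -
    have "av D * av (b ^ 2) \<le> 1 / real p * 1"
      using D ab by (intro mult_mono) (auto simp: av_power av_nonneg Zp_iff power_le_one)
    then show ?thesis using p_gt_1 by (simp add: av_mult order_le_less_trans)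
  qed
  moreover have "av ((a - of_int k) * (a + of_int k)) < 1"
  proof -
    have "av (a - of_int k) * av (a + of_int k) \<le> 1 / real p * 1"
      using k ab av_of_int_le_1 by (intro mult_mono av_add_le) (auto simp: av_nonneg Zp_iff)
    then show ?thesis using p_gt_1 by (simp add: av_mult order_le_less_trans)
  qed
  ultimately have "av ((a - of_int k) * (a + of_int k) - D * b ^ 2) < 1" by (intro av_diff_less)
  with u(2) have "av ((u - of_int m) - ((a - of_int k) * (a + of_int k) - D * b ^ 2)) < 1"
    by (rule av_diff_less)
  moreover have "(u - of_int m) - ((a - of_int k) * (a + of_int k) - D * b ^ 2) = of_int (k ^ 2 - m)"
    by (simp add: uab algebra_simps power2_eq_square)
  ultimately have "int p dvd k ^ 2 - m" using av_of_int_eq_1[of "k ^ 2 - m"] by fastforce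
  then show "QuadRes (int p) m" by (auto simp: QuadRes_def cong_iff_dvd_diff)
next
  have av4: "av 4 = 1" using odd av_2_cases av_mult[of 2 2] by auto
  assume "QuadRes (int p) m"
  then obtain k where k: "int p dvd k ^ 2 - m" by (auto simp: QuadRes_def cong_iff_dvd_diff)
  have "av (of_int (k ^ 2 - m)) < 1"
    using k av_of_int_le_iff[of "k ^ 2 - m" 1] p_gt_1 by (simp add: order_le_less_trans)
  from u(2) this have "av ((u - of_int m) - of_int (k ^ 2 - m)) < 1" by (rule av_diff_less)
  then have uk: "av (u - of_int k ^ 2) < 1" by simp
  then have "av (- (u - of_int k ^ 2)) < av u" using u by (simp only: av_minus Zp_units_iff)
  from av_add_eq[OF this] have "av (of_int k ^ 2) = 1" using u by (simp add: Zp_units_iff)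
  then have k1: "av (of_int k ^ 2) = 1" "of_int k \<noteq> (0::'k)" by auto
  have "u / of_int k ^ 2 - 1 = (u - of_int k ^ 2) / of_int k ^ 2" using k1 by (simp add: field_simps)
  then have "av (u / of_int k ^ 2 - 1) < av 4" using uk k1 by (simp add: av_divide av4)
  then have "is_norm (u / of_int k ^ 2)"
    using u by (intro is_norm_near_1) (auto simp: Zp_units_iff intro!: Qp_divide Qp_power)
  then have "is_norm (u / of_int k ^ 2 * of_int k ^ 2)" using k1 by (subst is_norm_square_mult_iff) auto
  then show "is_norm u" using k1 by simp
qed

text \<open>The norms thus have index at most two among the units. As \<open>quad_char\<close> only
  records whether its argument is a norm, its multiplicativity on units rests on this.\<close>

lemma not_norm_mult:
  assumes u: "u \<in> Zp_units av" "\<not> is_norm u" and v: "v \<in> Zp_units av" "\<not> is_norm v"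
  shows "is_norm (u * v)"
proof (cases "p = 2")
  case True
  then show ?thesis using assms not_norm_mult_even by blast
next
  case False
  then have p: "odd p" "2 < p" using av_2_cases p_gt_1 by auto
  have "\<exists>m. av (x - of_int m) < 1" if "x \<in> Zp_units av" for x
    using Zp_approx[of x 1] that p_gt_1 by (force simp: Zp_units_iff Zp_iff intro: order_le_less_trans)
  then obtain m n where m: "av (u - of_int m) < 1" and n: "av (v - of_int n) < 1" using u v by metis
  have "QuadRes (int p) (m * n)"
    using quad_nonresidue_mult[OF prime_p p(2)] is_norm_odd_iff[OF p(1)] u v m n by blast
  moreover have "u * v \<in> Zp_units av" using u v by (auto simp: Zp_units_iff av_mult)
  moreover have "av (u * v - of_int (m * n)) < 1"
  proof -
    have "av ((u - of_int m) * v) < 1" using m v by (simp add: av_mult Zp_units_iff)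
    moreover have "av (of_int m * (v - of_int n)) < 1"
    proof -
      have "av (of_int m) * av (v - of_int n) \<le> 1 * av (v - of_int n)"
        by (intro mult_right_mono av_of_int_le_1 av_nonneg)
      then show ?thesis using n by (simp add: av_mult)
    qed
    ultimately have "av ((u - of_int m) * v + of_int m * (v - of_int n)) < 1" by (rule av_add_less)
    then show ?thesis by (simp add: algebra_simps)
  qed
  ultimately show ?thesis using is_norm_odd_iff[OF p(1)] by blast
qed

text \<open>The witness is \<open>1 + \<theta>\<close> if \<open>D\<close> is a unit and
  \<open>\<theta>\<close> otherwise. Its powers serve to lower the value of \<open>c N y\<close> by
  any power of 2.\<close>

lemma uniformizer_norm_even: "p = 2 \<Longrightarrow> \<exists>\<pi>. av \<pi> \<le> 1 \<and> av (gal_norm av \<pi>) = 1 / 2"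
proof -
  assume p2: "p = 2"
  then show ?thesis
  proof (cases rule: even_cases)
    case 1
    have av2: "av 2 = 1 / 2" using av_2_cases p2 by auto
    have "gal_norm av (1 + \<theta>) = 2 + - (D + 1)" using gal_norm_coords[of 1 1] by simp
    moreover have "av (- (D + 1)) < av 2" unfolding av_minus using 1 av2 by simp
    then have "av (2 + - (D + 1)) = 1 / 2" using av_add_eq av2 by metis
    moreover have "av (1 + \<theta>) \<le> 1" using av_\<theta>_le_1 by (intro av_add_le) auto
    ultimately show ?thesis by metis
  next
    case 2
    have "gal_norm av \<theta> = - D" using gal_norm_coords[of 0 1] by simp
    then show ?thesis using 2 av_\<theta>_le_1 by (metis av_minus)
  qed
qed

text \<open>The bound on \<open>c\<close> means \<open>av c \<ge> av (2 * D)\<close>. Powers of an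
  element whose norm has value \<open>1 / 2\<close> bring \<open>c N y\<close> down to exactly
  \<open>av (2 * D)\<close>, where \<open>not_norm_even\<close> applies.\<close>

lemma binary_form_not_norm_even:
  assumes p2: "p = 2" and c: "c \<in> Zp av" "av c > av (4 * D)"
  shows "\<exists>y. av y \<le> 1 \<and> 1 + c * gal_norm av y \<in> Zp_units av \<and> \<not> is_norm (1 + c * gal_norm av y)"
proof -
  have av2: "av 2 = 1 / 2" using av_2_cases p2 by auto
  have cQ: "c \<in> Qp av" "av c \<le> 1" using c by (auto simp: Zp_iff)
  obtain k where k: "av (2 * D) = 1 / 2 ^ k" "av (2 * D) \<le> 1 / 2"
  proof (cases rule: even_cases[OF p2])
    case 1
    then show ?thesis using that[of 1] by (simp add: av_mult av2)
  next
    case 2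
    then show ?thesis using that[of 2] by (simp add: av_mult av2)
  qed
  have ck: "av c \<ge> av (2 * D)" using av_2_adic_less[OF p2 cQ(1)] c(2) by linarith
  obtain i where i: "av c = 2 powi i"
    using Qp_av_power_int[OF cQ(1)] c(2) av_nonneg[of "4 * D"] p2 by force
  have "2 powi (- int k) \<le> (2::real) powi i" using ck unfolding i k(1) by (simp add: power_int_minus divide_inverse)
  then have "- int k \<le> i" using powi_le_iff[of "- int k" i] p2 by simp
  define j where "j = nat (int k + i)"
  have j: "av c / 2 ^ j = 1 / 2 ^ k"
  proof -
    have "i = int j - int k" using \<open>- int k \<le> i\<close> by (simp add: j_def)
    then show ?thesis unfolding i by (simp add: power_int_diff)
  qed
  obtain \<pi> where \<pi>: "av \<pi> \<le> 1" "av (gal_norm av \<pi>) = 1 / 2" using uniformizer_norm_even[OF p2] by blast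
  define y where "y = \<pi> ^ j"
  have "gal_norm av y = gal_norm av \<pi> ^ j" by (simp add: y_def gal_norm_def gal_power power_mult_distrib)
  then have N: "av (c * gal_norm av y) = av (2 * D)"
    using j by (simp add: av_mult[of c] av_power \<pi> k(1) power_divide)
  have uQ: "1 + c * gal_norm av y \<in> Qp av" by (intro Qp_add Qp_mult gal_norm_Qp cQ Qp_1)
  have "1 + c * gal_norm av y \<in> Zp_units av" using N k(2) by (intro unit_near_1[OF uQ]) auto
  moreover have "\<not> is_norm (1 + c * gal_norm av y)" using N by (intro not_norm_even[OF p2 uQ]) simp
  moreover have "av y \<le> 1" using \<pi> av_nonneg by (simp add: y_def av_power power_le_one)
  ultimately show ?thesis by blast
qed

text \<open>If \<open>c\<close> is a norm, it can be scaled to 1. For the least nonresidue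
  \<open>r\<close>, the number \<open>r - 1\<close> is a square \<open>s^2\<close> modulo
  \<open>p\<close>, and the sum of norms \<open>s^2 + 1\<close> is congruent to
  \<open>r\<close>.\<close>

lemma binary_form_not_norm_odd:
  assumes p: "odd p" and c: "c \<in> Zp_units av"
  shows "\<exists>x y. av x \<le> 1 \<and> av y \<le> 1 \<and> gal_norm av x + c * gal_norm av y \<in> Zp_units av \<and>
           \<not> is_norm (gal_norm av x + c * gal_norm av y)"
proof (cases "is_norm c")
  case False
  then show ?thesis using c by (intro exI[of _ 0] exI[of _ 1]) (auto simp: gal_norm_def)
next
  case True
  then obtain w where w: "w \<noteq> 0" "c = gal_norm av w" by (auto simp: is_norm_def)
  then have "av w = 1" using norm_unit_integer c by (simp add: Zp_units_iff)
  define y where "y = inverse w"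
  have y: "av y \<le> 1" "c * gal_norm av y = 1"
    using w \<open>av w = 1\<close>
    by (simp_all add: y_def av_inverse flip: gal_norm_mult) (simp add: gal_norm_def)
  define r where "r = (LEAST r::nat. \<not> QuadRes (int p) (int r))"
  have r: "\<not> QuadRes (int p) (int r)"
    unfolding r_def using quad_nonresidue_exists[OF prime_p p] by (rule LeastI_ex)
  have "QuadRes (int p) (int 0)" unfolding QuadRes_def by (intro exI[of _ 0]) simp
  then have "r \<noteq> 0" using r by metis
  then have "r - 1 < r" by simp
  then have "QuadRes (int p) (int (r - 1))" unfolding r_def using not_less_Least by blast
  then obtain s where s: "int p dvd s ^ 2 - int (r - 1)" by (auto simp: QuadRes_def cong_iff_dvd_diff)
  define u where "u = (of_int (s ^ 2 + 1) :: 'k)"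
  have "\<not> int p dvd s ^ 2 + 1"
  proof
    assume *: "int p dvd s ^ 2 + 1"
    have "int r = (s ^ 2 + 1) - (s ^ 2 - int (r - 1))" using \<open>r \<noteq> 0\<close> by simp
    then have "int p dvd int r" using * s by (metis dvd_diff)
    then have "QuadRes (int p) (int r)"
      unfolding QuadRes_def by (intro exI[of _ 0]) (simp add: cong_iff_dvd_diff)
    then show False using r by blast
  qed
  then have "av u = 1" unfolding u_def by (rule av_of_int_eq_1)
  then have u: "u \<in> Zp_units av" unfolding Zp_units_iff u_def using Qp_of_int by blast
  have "\<not> is_norm u"
  proof -
    have "s ^ 2 + 1 - int r = s ^ 2 - int (r - 1)" using \<open>r \<noteq> 0\<close> by simp
    moreover have "av (of_int (s ^ 2 - int (r - 1))) \<le> 1 / real p ^ 1"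
      unfolding av_of_int_le_iff using s by simp
    ultimately have "av (of_int (s ^ 2 + 1 - int r)) \<le> 1 / real p ^ 1" by (simp only:)
    then have "av (u - of_int (int r)) < 1" using p_gt_1 by (simp add: u_def order_le_less_trans)
    then show ?thesis using is_norm_odd_iff[OF p u] r by blast
  qed
  moreover have "gal_norm av (of_int s) + c * gal_norm av y = u"
    unfolding y(2) by (simp add: u_def gal_norm_def gal_Qp power2_eq_square)
  ultimately show ?thesis using u y(1) av_of_int_le_1[of s] by metis
qed

lemma binary_form_not_norm:
  assumes c: "c \<in> Zp av" "av c > av (4 * D)"
  shows "\<exists>x y. av x \<le> 1 \<and> av y \<le> 1 \<and> gal_norm av x + c * gal_norm av y \<in> Zp_units av \<and>
           \<not> is_norm (gal_norm av x + c * gal_norm av y)"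
proof (cases "p = 2")
  case True
  have "gal_norm av 1 = 1" by (simp add: gal_norm_def)
  then show ?thesis using binary_form_not_norm_even[OF True c] by (metis av_1 order_refl)
next
  case False
  then have "odd p" "av 2 = 1" "av D = 1 / real p" using av_2_cases D_cases by auto
  then have "av (4 * D) = 1 / real p" using av_mult[of 2 2] by (simp add: av_mult)
  then have "\<not> av c < 1" using Qp_av_less_1[of c] c by (auto simp: Zp_iff)
  then have "c \<in> Zp_units av" using c by (auto simp: Zp_iff Zp_units_iff)
  then show ?thesis using binary_form_not_norm_odd \<open>odd p\<close> by blast
qed

text \<open>Multiplication by such a \<open>u\<close> does not change a multiple of \<open>p\<close>
  modulo \<open>d\<close>. For \<open>p = 2\<close> the unit \<open>1 + 2 * D\<close> serves; for
  odd \<open>p\<close> the value of \<open>d\<close> is \<open>1 / p\<close>, so any unit that is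
  not a norm does.\<close>

lemma not_norm_near_1:
  "\<exists>u. u \<in> Zp_units av \<and> \<not> is_norm u \<and> av (of_nat p * (u - 1)) \<le> av (4 * D)"
proof (cases "p = 2")
  case True
  have av2: "av 2 = 1 / 2" using av_2_cases True by auto
  have av4: "av (4 * D) = av (2 * D) / 2" using av_mult[of 2 "2 * D"] by (simp add: av2)
  have "av (4 * D) < av (2 * D)" using D_neq_0 av_pos[of "2 * D"] av4 by simp
  have "av D \<le> 1" using D_Zp by (simp add: Zp_iff)
  then have "av (2 * D) < 1" unfolding av_mult av2 by simp
  then have "1 + 2 * D \<in> Zp_units av" using D_Qp by (intro unit_near_1) (auto intro!: Qp_add Qp_mult)
  moreover have "\<not> is_norm (1 + 2 * D)"
    using D_Qp by (intro not_norm_even[OF True]) (auto intro!: Qp_add Qp_mult)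
  moreover have "av (of_nat p * (1 + 2 * D - 1)) \<le> av (4 * D)" using True by simp
  ultimately show ?thesis by blast
next
  case False
  then have p: "odd p" "av 2 = 1" "av D = 1 / real p" using av_2_cases D_cases by auto
  have "1 \<in> Zp_units av" by (simp add: Zp_units_iff)
  then obtain x y where "gal_norm av x + 1 * gal_norm av y \<in> Zp_units av"
      "\<not> is_norm (gal_norm av x + 1 * gal_norm av y)"
    using binary_form_not_norm_odd[OF p(1)] by blast
  then obtain u where u: "u \<in> Zp_units av" "\<not> is_norm u" by blast
  have "av (u - 1) \<le> 1" using u by (intro av_diff_le) (auto simp: Zp_units_iff)
  then have "av (of_nat p * (u - 1)) \<le> 1 / real p" by (simp add: av_mult av_p divide_right_mono)
  also have "\<dots> = av (4 * D)" using p av_mult[of 2 2] by (simp add: av_mult)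
  finally show ?thesis using u by blast
qed

end

section \<open>The additive character and the Haar integral\<close>

context ramified_quadratic_extension
begin

text \<open>Clearing the denominator turns integrality into divisibility by \<open>p ^ n\<close>.
  Uniqueness of the fractional part and additivity of the character both reduce to this.\<close>

lemma Zp_rat_imp_int:
  assumes "t * of_nat p ^ n \<in> \<int>" "av (of_rat t) \<le> 1"
  shows "t \<in> \<int>"
proof -
  obtain k where k: "t * of_nat p ^ n = of_int k" using assms(1) by (rule Ints_cases)
  then have "of_rat t * of_nat p ^ n = (of_int k :: 'k)"
    by (metis of_rat_mult of_rat_of_int_eq of_rat_of_nat_eq of_rat_power)
  then have "av (of_int k) = av (of_rat t) / real p ^ n"
    by (metis av_mult av_p_power times_divide_eq_right mult.right_neutral)
  also have "\<dots> \<le> 1 / real p ^ n" using assms(2) by (intro divide_right_mono) auto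
  finally obtain l where "k = int p ^ n * l" unfolding av_of_int_le_iff by blast
  with k have "t * of_nat p ^ n = of_int l * of_nat p ^ n" by simp
  then have "t = of_int l" by simp
  then show ?thesis by simp
qed

lemma frac_part_ex1:
  assumes "x \<in> Qp av"
  shows "\<exists>!r. 0 \<le> r \<and> r < 1 \<and> (\<exists>n. r * of_nat p ^ n \<in> \<int>) \<and> x - of_rat r \<in> Zp av"
proof (rule ex_ex1I)
  obtain n where n: "of_nat p ^ n * x \<in> Zp av" using Qp_scale_Zp[OF assms] by blast
  obtain m where m: "m < p ^ n" "av (of_nat p ^ n * x - of_nat m) \<le> 1 / real p ^ n"
    using Zp_approx_nat[OF n] by blast
  define r where "r = (of_nat m / of_nat p ^ n :: rat)"
  have rp: "r * of_nat p ^ n = of_int (int m)" by (simp add: r_def)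
  have "of_rat r = (of_nat m / of_nat p ^ n :: 'k)" by (simp add: r_def of_rat_divide of_rat_power)
  then have "of_nat p ^ n * (x - of_rat r) = of_nat p ^ n * x - of_nat m" by (simp add: algebra_simps)
  then have "av (of_nat p ^ n * (x - of_rat r)) \<le> 1 / real p ^ n" using m by simp
  then have "av (x - of_rat r) / real p ^ n \<le> 1 / real p ^ n" by (simp only: av_mult av_p_power) simp
  then have "av (x - of_rat r) \<le> 1" by (simp add: divide_le_cancel)
  moreover have "x - of_rat r \<in> Qp av" using assms Rats_subset_Qp[OF Rats_of_rat] by (rule Qp_diff)
  moreover have "r < 1"
  proof -
    have "(of_nat m :: rat) < of_nat (p ^ n)" using m(1) by (simp only: of_nat_less_iff)
    then show ?thesis by (simp add: r_def)
  qed
  moreover have "0 \<le> r" by (simp add: r_def)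
  ultimately show "\<exists>r. 0 \<le> r \<and> r < 1 \<and> (\<exists>n. r * of_nat p ^ n \<in> \<int>) \<and> x - of_rat r \<in> Zp av"
    using rp by (metis Ints_of_int Zp_iff)
next
  fix r s
  assume r: "0 \<le> r \<and> r < 1 \<and> (\<exists>n. r * of_nat p ^ n \<in> \<int>) \<and> x - of_rat r \<in> Zp av"
    and s: "0 \<le> s \<and> s < 1 \<and> (\<exists>n. s * of_nat p ^ n \<in> \<int>) \<and> x - of_rat s \<in> Zp av"
  obtain n m where nm: "r * of_nat p ^ n \<in> \<int>" "s * of_nat p ^ m \<in> \<int>" using r s by blast
  have "(r * of_nat p ^ n) * of_nat (p ^ m) - (s * of_nat p ^ m) * of_nat (p ^ n) \<in> \<int>"
    by (intro Ints_diff Ints_mult[OF nm(1)] Ints_mult[OF nm(2)]) auto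
  then have "(r - s) * of_nat p ^ (n + m) \<in> \<int>" by (simp add: algebra_simps power_add)
  moreover have "av (of_rat (r - s)) \<le> 1"
    using av_diff_le[of "x - of_rat s" 1 "x - of_rat r"] r s by (simp add: Zp_iff of_rat_diff)
  ultimately have "r - s \<in> \<int>" by (rule Zp_rat_imp_int)
  then obtain k where k: "r - s = of_int k" by (rule Ints_cases)
  have "of_int (-1) < (of_int k :: rat)" "of_int k < (of_int 1 :: rat)" using r s by (simp_all flip: k)
  then have "k = 0" by (simp only: of_int_less_iff)
  then show "r = s" using k by simp
qed

lemma frac_part:
  assumes "x \<in> Qp av"
  shows "0 \<le> frac_part p av x" "frac_part p av x < 1"
    "\<exists>n. frac_part p av x * of_nat p ^ n \<in> \<int>" "x - of_rat (frac_part p av x) \<in> Zp av"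
  using theI'[OF frac_part_ex1[OF assms]] by (simp_all add: frac_part_def)

lemma add_char_add:
  assumes "x \<in> Qp av" "y \<in> Qp av"
  shows "add_char p av (x + y) = add_char p av x * add_char p av y"
proof -
  define r where "r = frac_part p av x"
  define s where "s = frac_part p av y"
  define q where "q = frac_part p av (x + y)"
  have xy: "x + y \<in> Qp av" using assms by (rule Qp_add)
  note r = frac_part[OF assms(1), folded r_def]
  note s = frac_part[OF assms(2), folded s_def]
  note q = frac_part[OF xy, folded q_def]
  obtain k l m where klm: "r * of_nat p ^ k \<in> \<int>" "s * of_nat p ^ l \<in> \<int>" "q * of_nat p ^ m \<in> \<int>"
    using r(3) s(3) q(3) by blast
  have "(r * of_nat p ^ k) * of_nat (p ^ (l + m)) + (s * of_nat p ^ l) * of_nat (p ^ (k + m))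
      - (q * of_nat p ^ m) * of_nat (p ^ (k + l)) \<in> \<int>"
    by (intro Ints_diff Ints_add Ints_mult[OF klm(1)] Ints_mult[OF klm(2)] Ints_mult[OF klm(3)]) auto
  then have "(r + s - q) * of_nat p ^ (k + l + m) \<in> \<int>" by (simp add: algebra_simps power_add)
  moreover have "av (of_rat (r + s - q)) \<le> 1"
  proof -
    have "(x + y - of_rat q) - (x - of_rat r) - (y - of_rat s) \<in> Zp av" using r s q by blast
    then show ?thesis by (simp add: Zp_iff of_rat_diff of_rat_add algebra_simps)
  qed
  ultimately have "r + s - q \<in> \<int>" by (rule Zp_rat_imp_int)
  then obtain i where "r + s - q = of_int i" by (rule Ints_cases)
  then have "r + s = q + of_int i" by simp
  then have "of_rat r + of_rat s = (of_rat q + of_int i :: real)"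
    by (metis of_rat_add of_rat_of_int_eq)
  then have "2 * pi * of_rat r + 2 * pi * of_rat s = 2 * pi * of_rat q + 2 * pi * of_int i"
    by (metis distrib_left)
  then have "cis (2 * pi * of_rat r) * cis (2 * pi * of_rat s) = cis (2 * pi * of_rat q) * cis (2 * pi * of_int i)"
    by (simp only: cis_mult)
  also have "cis (2 * pi * of_int i) = 1" by (rule cis_multiple_2pi) simp
  finally show ?thesis by (simp add: add_char_def r_def s_def q_def)
qed

lemma add_char_eq_1_iff:
  assumes "x \<in> Qp av"
  shows "add_char p av x = 1 \<longleftrightarrow> x \<in> Zp av"
proof
  assume "x \<in> Zp av"
  then have "frac_part p av x = 0"
    unfolding frac_part_def
    by (intro the1_equality[OF frac_part_ex1[OF assms]]) (auto intro: exI[of _ 0])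
  then show "add_char p av x = 1" by (simp add: add_char_def)
next
  assume "add_char p av x = 1"
  then have "cos (2 * pi * of_rat (frac_part p av x)) = 1"
    unfolding add_char_def by (metis cis.sel(1) one_complex.sel(1))
  then obtain n :: int where "2 * pi * of_rat (frac_part p av x) = of_int n * 2 * pi"
    using cos_one_2pi_int by blast
  then have "of_rat (frac_part p av x) = (of_int n :: real)" by simp
  then have "frac_part p av x = of_int n" by (metis of_rat_eq_iff of_rat_of_int_eq)
  moreover have "of_int n < (of_int 1 :: rat)" "of_int (-1) < (of_int n :: rat)"
    using frac_part[OF assms] calculation by simp_all
  then have "n = 0" by (simp only: of_int_less_iff)
  ultimately show "x \<in> Zp av" using frac_part(4)[OF assms] by simp
qed

end

section \<open>The Haar integral under substitutions\<close>

lemma invariant_under_iff: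
  "invariant_under M \<phi> \<longleftrightarrow> (\<forall>x. \<forall>y \<in> (+) x ` M. \<phi> y = \<phi> x)"
  by (auto simp: invariant_under_def)

text \<open>If \<open>g\<close> permutes the cosets of each \<open>p^n L0\<close>, then
  \<open>\<phi>\<close> and its composition with \<open>g\<close> have the same periods, hence the
  same \<open>LEAST n\<close>, and \<open>g\<close> matches the two sets of cosets summed over. The
  assumption \<open>inv\<close> ensures that the \<open>LEAST\<close> is attained.\<close>

lemma haar_integral_compose:
  fixes \<phi> :: "'k::field_char_0^2^2 \<Rightarrow> complex" and av :: "'k \<Rightarrow> real" and p :: nat
  defines "M \<equiv> \<lambda>n. mscale (of_nat p ^ n) ` L0 av"
  assumes "bij g" and coset: "\<And>n x. g ` ((+) x ` M n) = (+) (g x) ` M n"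
    and zero: "\<And>n. 0 \<in> M n" and inv: "invariant_under (M m) \<phi>"
  shows "haar_integral p av (\<lambda>x. \<phi> (g x)) = haar_integral p av \<phi>"
proof -
  have *: "invariant_under (M n) (\<lambda>x. \<phi> (g x)) \<longleftrightarrow> invariant_under (M n) \<phi>" for n
  proof -
    have "invariant_under (M n) (\<lambda>x. \<phi> (g x)) \<longleftrightarrow> (\<forall>x. \<forall>y \<in> g ` ((+) x ` M n). \<phi> y = \<phi> (g x))"
      unfolding invariant_under_iff by blast
    also have "\<dots> \<longleftrightarrow> (\<forall>x. \<forall>y \<in> (+) (g x) ` M n. \<phi> y = \<phi> (g x))" unfolding coset ..
    also have "\<dots> \<longleftrightarrow> invariant_under (M n) \<phi>"
      unfolding invariant_under_iff using bij_is_surj[OF \<open>bij g\<close>] by (metis surj_def)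
    finally show ?thesis .
  qed
  define n where "n = (LEAST n. invariant_under (M n) \<phi>)"
  have n: "invariant_under (M n) \<phi>" unfolding n_def using inv by (rule LeastI)
  \<comment> \<open>The value at the representative picked by \<open>SOME\<close> is the value on
    the whole coset.\<close>
  have const: "\<phi> (SOME y. y \<in> (+) x ` M n) = \<phi> x" for x
  proof -
    have "x \<in> (+) x ` M n" using zero[of n] by force
    then have "(SOME y. y \<in> (+) x ` M n) \<in> (+) x ` M n" by (rule someI)
    then show ?thesis using n unfolding invariant_under_iff by blast
  qed
  have const': "\<phi> (g (SOME y. y \<in> (+) x ` M n)) = \<phi> (g x)" for x
  proof -
    have "x \<in> (+) x ` M n" using zero[of n] by force
    then have "(SOME y. y \<in> (+) x ` M n) \<in> (+) x ` M n" by (rule someI)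
    then have "g (SOME y. y \<in> (+) x ` M n) \<in> (+) (g x) ` M n" using coset by blast
    then show ?thesis using n unfolding invariant_under_iff by blast
  qed
  define A where "A = {(+) x ` M n | x. \<phi> (g x) \<noteq> 0}"
  define B where "B = {(+) x ` M n | x. \<phi> x \<noteq> 0}"
  have "bij_betw ((`) g) A B"
    unfolding bij_betw_def
  proof
    show "inj_on ((`) g) A" using bij_is_inj[OF \<open>bij g\<close>] by (meson inj_image_eq_iff inj_onI)
    show "(`) g ` A = B"
    proof (intro equalityI subsetI)
      fix C assume "C \<in> (`) g ` A"
      then obtain x where "C = g ` ((+) x ` M n)" "\<phi> (g x) \<noteq> 0" unfolding A_def by blast
      then show "C \<in> B" unfolding coset B_def by blast
    next
      fix C assume "C \<in> B"
      then obtain x where x: "C = (+) x ` M n" "\<phi> x \<noteq> 0" unfolding B_def by blast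
      obtain y where y: "x = g y" using bij_is_surj[OF \<open>bij g\<close>] by (meson surjD)
      have "C = g ` ((+) y ` M n)" using x y coset by simp
      moreover have "(+) y ` M n \<in> A" using x y unfolding A_def by blast
      ultimately show "C \<in> (`) g ` A" by blast
    qed
  qed
  then have "(\<Sum>C\<in>A. \<phi> (SOME y. y \<in> g ` C)) = (\<Sum>C\<in>B. \<phi> (SOME y. y \<in> C))"
    by (rule sum.reindex_bij_betw)
  moreover have "\<phi> (SOME y. y \<in> g ` C) = \<phi> (g (SOME y. y \<in> C))" if "C \<in> A" for C
  proof -
    obtain x where "C = (+) x ` M n" using \<open>C \<in> A\<close> unfolding A_def by blast
    then show ?thesis by (simp only: coset const const')
  qed
  ultimately have "(\<Sum>C\<in>A. \<phi> (g (SOME y. y \<in> C))) = (\<Sum>C\<in>B. \<phi> (SOME y. y \<in> C))" by simp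
  then show ?thesis
    unfolding haar_integral_def Let_def M_def[symmetric] * n_def[symmetric] A_def B_def by simp
qed

lemma haar_integral_mult:
  assumes "c \<noteq> 0"
  shows "haar_integral p av (\<lambda>x. c * \<phi> x) = c * haar_integral p av \<phi>"
  using assms by (simp add: haar_integral_def Let_def invariant_under_def sum_distrib_left mult_ac)

section \<open>Two by two matrices and the bilinear form\<close>

lemma mat2_eta: "x = mat2 (x $ 1 $ 1) (x $ 1 $ 2) (x $ 2 $ 1) (x $ 2 $ 2)"
  by (simp add: vec_eq_iff forall_2)

lemma mat2_cases: obtains a b c d where "x = mat2 a b c d"
  using mat2_eta by blast

lemma mat2_simps:
  "mat2 a b c d = mat2 a' b' c' d' \<longleftrightarrow> a = a' \<and> b = b' \<and> c = c' \<and> d = d'"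
  "mscale k (mat2 a b c d) = mat2 (k * a) (k * b) (k * c) (k * d)"
  "mat2 a b c d ** mat2 a' b' c' d' =
     mat2 (a * a' + b * c') (a * b' + b * d') (c * a' + d * c') (c * b' + d * d')"
  "transpose (mat2 a b c d) = mat2 a c b d"
  "det (mat2 a b c d) = a * d - b * c"
  "mat 1 = mat2 1 0 0 1"
  by (auto simp: vec_eq_iff forall_2 mscale_def map_matrix_def matrix_matrix_mult_def sum_2
      transpose_def det_2 mat_def)

lemma map_matrix_mat2: "map_matrix f (mat2 a b c d) = mat2 (f a) (f b) (f c) (f d)"
  by (simp add: vec_eq_iff forall_2 map_matrix_def)

lemma matrix_inv_mat2:
  assumes "det h \<noteq> 0"
  shows "matrix_inv h = mscale (inverse (det h)) (mat2 (h $ 2 $ 2) (- h $ 1 $ 2) (- h $ 2 $ 1) (h $ 1 $ 1))"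
proof -
  obtain a b c d where h: "h = mat2 a b c d" by (rule mat2_cases)
  define e where "e = inverse (det h)"
  let ?g = "mscale e (mat2 d (- b) (- c) a)"
  have "e * det h = 1" using assms by (simp add: e_def)
  then have "e * (a * d - b * c) = 1" by (simp add: h mat2_simps(5))
  then have g: "h ** ?g = mat 1" "?g ** h = mat 1"
    by (simp_all add: h mat2_simps(1,2,3,6) algebra_simps)
  then have "\<exists>k. h ** k = mat 1 \<and> k ** h = mat 1" by blast
  then have "h ** matrix_inv h = mat 1 \<and> matrix_inv h ** h = mat 1"
    unfolding matrix_inv_def by (rule someI_ex)
  then have "?g ** (h ** matrix_inv h) = ?g" by (simp only: matrix_mul_rid)
  then have "matrix_inv h = ?g" by (simp only: matrix_mul_assoc g matrix_mul_lid)
  then show ?thesis by (simp add: h e_def)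
qed

lemma mscale_entry [simp]: "mscale c x $ i $ j = c * x $ i $ j"
  by (simp add: mscale_def map_matrix_def)

lemma mscale_mscale: "mscale c (mscale d x) = mscale (c * d) x"
  and mscale_1: "mscale 1 x = x"
  by (simp_all add: vec_eq_iff algebra_simps)

lemma mscale_mult: "mscale c x ** y = mscale c (x ** y)" "x ** mscale c y = mscale c (x ** y)"
  by (simp_all add: vec_eq_iff forall_2 matrix_matrix_mult_def sum_2 algebra_simps)

lemma B0_eq: "B0 \<beta> x y =
    \<beta> * (x $ 1 $ 1 * y $ 2 $ 2 + y $ 1 $ 1 * x $ 2 $ 2 - x $ 1 $ 2 * y $ 2 $ 1 - y $ 1 $ 2 * x $ 2 $ 1)"
  by (simp add: B0_def Q0_def det_2 algebra_simps)

lemma B0_add_right: "B0 \<beta> x (y + z) = B0 \<beta> x y + B0 \<beta> x z"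
  and B0_commute: "B0 \<beta> x y = B0 \<beta> y x"
  and B0_mscale_left: "B0 \<beta> (mscale c x) y = c * B0 \<beta> x y"
  and B0_mscale_right: "B0 \<beta> x (mscale c y) = c * B0 \<beta> x y"
  and Q0_add: "Q0 \<beta> (x + y) = Q0 \<beta> x + Q0 \<beta> y + B0 \<beta> x y"
  by (simp_all add: B0_eq Q0_def det_2 algebra_simps)

section \<open>The lattices and the action of the group\<close>

context ramified_quadratic_basis
begin

abbreviation d :: 'k where "d \<equiv> of_nat (different_norm av)"

lemma av_d: "av d = av (4 * D)"
  using different_norm by (auto simp: av_p_power)

lemma av_4D_pos: "av (4 * D) > 0" and av_2\<theta>_pos: "av (2 * \<theta>) > 0"
  using D_neq_0 \<theta>_neq_0 by (intro av_pos; simp)+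

lemma d_neq_0: "d \<noteq> 0"
  using av_d av_4D_pos av_0 by (metis less_irrefl)

lemma av_4D_eq: "av (4 * D) = av (2 * \<theta>) * av (2 * \<theta>)"
proof -
  have "(2 * \<theta>) * (2 * \<theta>) = 4 * D" using \<theta>_mult by (simp add: mult_ac)
  then show ?thesis by (metis av_mult)
qed

lemma av_2\<theta>_le_1: "av (2 * \<theta>) \<le> 1"
  using av_\<theta>_le_1 av_of_nat_le_1[of 2] by (simp add: av_mult av_nonneg mult_le_one)

lemma av_4D_le: "av (4 * D) \<le> av (2 * \<theta>)" and av_4D_le_1: "av (4 * D) \<le> 1"
proof -
  have "av (2 * \<theta>) * av (2 * \<theta>) \<le> av (2 * \<theta>) * 1"
    using av_2\<theta>_le_1 av_nonneg by (intro mult_left_mono) auto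
  then show *: "av (4 * D) \<le> av (2 * \<theta>)" by (simp add: av_4D_eq)
  show "av (4 * D) \<le> 1" using order_trans[OF * av_2\<theta>_le_1] .
qed

lemma av_mult_le: "av x \<le> r \<Longrightarrow> av y \<le> 1 \<Longrightarrow> av (x * y) \<le> r"
  using mult_mono[of "av x" r "av y" 1] av_nonneg[of x] av_nonneg[of y] by (simp add: av_mult)

lemma av_mult_le': "av x \<le> 1 \<Longrightarrow> av y \<le> r \<Longrightarrow> av (x * y) \<le> r"
  using av_mult_le[of y r x] by (simp add: mult.commute)

lemma gal_fixed_imp_Qp:
  assumes "gal av x = x"
  shows "x \<in> Qp av"
proof -
  obtain a b where x: "a \<in> Qp av" "b \<in> Qp av" "x = a + b * \<theta>" by (rule coords)
  then have "a + (- b) * \<theta> = a + b * \<theta>" using assms gal_coords by simp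
  then have "b = 0" using \<theta>_neq_0 by simp
  with x show ?thesis by simp
qed

lemma gal_different: "av x \<le> av (2 * \<theta>) \<Longrightarrow> av (gal av x) \<le> av (2 * \<theta>)"
proof -
  assume "av x \<le> av (2 * \<theta>)"
  then have "av (x / (2 * \<theta>)) \<le> 1" using av_2\<theta>_pos by (simp add: av_divide)
  then have "av (gal av (x / (2 * \<theta>))) \<le> 1" by (rule gal_integer)
  then have "av (gal av x / (- (2 * \<theta>))) \<le> 1" by (simp add: gal_divide gal_mult gal_\<theta>)
  then show ?thesis using av_2\<theta>_pos by (simp only: av_divide av_minus) simp
qed

text \<open>In the different, the rational coordinate \<open>a\<close> of \<open>x\<close> is
  divisible by \<open>2 * D\<close>, and the trace is \<open>2 a\<close>. This gain over
  \<open>2 * \<theta>\<close> is what keeps \<open>L0\<close> stable under the group.\<close>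

lemma gal_trace_different: "av x \<le> av (2 * \<theta>) \<Longrightarrow> av (gal_trace av x) \<le> av (4 * D)"
proof -
  assume x: "av x \<le> av (2 * \<theta>)"
  obtain a b where ab: "a \<in> Qp av" "b \<in> Qp av" "x = a + b * \<theta>" by (rule coords)
  then have "av a \<le> av (2 * D)" using x different_coords_iff[of a b] different_iff by simp
  then have "av 2 * av a \<le> av 2 * av (2 * D)" using av_nonneg by (intro mult_left_mono)
  then have "av (2 * a) \<le> av (2 * (2 * D))" by (simp only: av_mult)
  then show ?thesis using ab by (simp add: gal_trace_coords)
qed

text \<open>As \<open>d\<close> has the value of \<open>(2 * \<theta>)^2\<close>, multiplying the
  inverse different by \<open>d\<close> gives the different; this explains the bound on the corner
  entry.\<close>

lemma V0_iff: "x \<in> V0 av \<longleftrightarrow> (\<forall>i j. gal av (x $ i $ j) = x $ j $ i)"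
  and L0_iff: "x \<in> L0 av \<longleftrightarrow> (\<forall>i j. gal av (x $ i $ j) = x $ j $ i) \<and>
     av (x $ 1 $ 1) \<le> av (4 * D) \<and> av (x $ 2 $ 2) \<le> av (4 * D) \<and> av (x $ 1 $ 2) \<le> av (2 * \<theta>)"
    (is "?L0 \<longleftrightarrow> ?herm x \<and> ?bd x")
proof -
  have Qp: "x $ i $ i \<in> Qp av" if "?herm x" for x i using that gal_fixed_imp_Qp by blast
  have L0: "x \<in> L0 av \<longleftrightarrow> ?herm x \<and> ?bd x" for x
  proof
    assume "x \<in> L0 av"
    then obtain a b \<nu> where x: "x = mscale d (mat2 a \<nu> (gal av \<nu>) b)"
      and ab: "a \<in> Zp av" "b \<in> Zp av" "\<nu> \<in> inv_different av" unfolding L0_def by blast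
    have "av \<nu> * av (2 * \<theta>) \<le> 1" using ab(3) by (simp only: inv_different_iff av_mult)
    then have "av (2 * \<theta>) * (av \<nu> * av (2 * \<theta>)) \<le> av (2 * \<theta>) * 1"
      using av_nonneg by (intro mult_left_mono)
    then have "av (d * \<nu>) \<le> av (2 * \<theta>)" unfolding av_mult[of d] av_d av_4D_eq by (simp add: mult_ac)
    moreover have "av (d * a) \<le> av (4 * D)" "av (d * b) \<le> av (4 * D)"
      using ab by (auto intro!: av_mult_le simp: av_d Zp_iff)
    moreover have "?herm x" using ab by (simp add: x forall_2 gal_mult gal_Qp Zp_iff)
    ultimately show "?herm x \<and> ?bd x" by (simp add: x)
  next
    assume x: "?herm x \<and> ?bd x"
    have "x = mscale d (mat2 (x $ 1 $ 1 / d) (x $ 1 $ 2 / d) (gal av (x $ 1 $ 2 / d)) (x $ 2 $ 2 / d))"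
      using x d_neq_0 by (simp add: vec_eq_iff forall_2 gal_divide)
    moreover have "x $ i $ i / d \<in> Zp av" for i
    proof -
      have "av (x $ i $ i) \<le> av (4 * D)" using x exhaust_2[of i] by auto
      then have "av (x $ i $ i / d) \<le> 1" using av_4D_pos by (simp add: av_divide av_d)
      then show ?thesis using x Qp by (auto simp: Zp_iff)
    qed
    moreover have "x $ 1 $ 2 / d \<in> inv_different av"
      unfolding inv_different_iff av_mult[of _ "2 * \<theta>"] av_divide av_d av_4D_eq
      using x av_2\<theta>_pos by (simp add: field_simps)
    ultimately show "x \<in> L0 av" unfolding L0_def by blast
  qed
  show "?L0 \<longleftrightarrow> ?herm x \<and> ?bd x" by (rule L0)
  show "x \<in> V0 av \<longleftrightarrow> ?herm x"
  proof
    assume "x \<in> V0 av"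
    then obtain c y where "c \<in> Qp av" "y \<in> L0 av" "x = mscale c y" unfolding V0_def by blast
    then show "?herm x" by (simp add: L0 gal_mult gal_Qp)
  next
    assume x: "?herm x"
    define K where "K = (av (x $ 1 $ 1) + av (x $ 2 $ 2)) / av (4 * D) + av (x $ 1 $ 2) / av (2 * \<theta>)"
    obtain n where n: "K < real p ^ n" using p_gt_1 real_arch_pow[of "real p" K] by auto
    have nonneg: "av (x $ i $ j) / av (4 * D) \<ge> 0" "av (x $ i $ j) / av (2 * \<theta>) \<ge> 0" for i j
      by (simp_all add: av_nonneg)
    have "av (x $ 1 $ 1) / av (4 * D) \<le> real p ^ n" "av (x $ 2 $ 2) / av (4 * D) \<le> real p ^ n"
      "av (x $ 1 $ 2) / av (2 * \<theta>) \<le> real p ^ n"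
      using n nonneg[of 1 1] nonneg[of 2 2] nonneg[of 1 2] unfolding K_def add_divide_distrib by linarith+
    then have "av (of_nat p ^ n * x $ 1 $ 1) \<le> av (4 * D)" "av (of_nat p ^ n * x $ 2 $ 2) \<le> av (4 * D)"
      "av (of_nat p ^ n * x $ 1 $ 2) \<le> av (2 * \<theta>)"
      unfolding av_mult[of "of_nat p ^ n"] av_p_power using av_4D_pos av_2\<theta>_pos p_pos
      by (simp_all add: field_simps)
    then have "mscale (of_nat p ^ n) x \<in> L0 av" using x unfolding L0
      by (simp add: gal_mult gal_power)
    moreover have "x = mscale (inverse (of_nat p ^ n)) (mscale (of_nat p ^ n) x)"
      by (simp add: mscale_mscale mscale_1)
    moreover have "inverse (of_nat p ^ n) \<in> Qp av" by (intro Qp_inverse Qp_power Qp_of_nat)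
    ultimately show "x \<in> V0 av" unfolding V0_def by blast
  qed
qed

lemma V0_diag_Qp: "x \<in> V0 av \<Longrightarrow> x $ i $ i \<in> Qp av"
  using gal_fixed_imp_Qp V0_iff by blast

lemma L0_V0: "x \<in> L0 av \<Longrightarrow> x \<in> V0 av"
  by (simp add: L0_iff V0_iff)

lemma V0_add: "x \<in> V0 av \<Longrightarrow> y \<in> V0 av \<Longrightarrow> x + y \<in> V0 av"
  and V0_diff: "x \<in> V0 av \<Longrightarrow> y \<in> V0 av \<Longrightarrow> x - y \<in> V0 av"
  by (simp_all add: V0_iff gal_add gal_diff)

lemma L0_0 [simp]: "0 \<in> L0 av"
  using av_4D_pos av_2\<theta>_pos by (simp add: L0_iff)

lemma L0_add: "x \<in> L0 av \<Longrightarrow> y \<in> L0 av \<Longrightarrow> x + y \<in> L0 av"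
  and L0_diff: "x \<in> L0 av \<Longrightarrow> y \<in> L0 av \<Longrightarrow> x - y \<in> L0 av"
  by (simp_all add: L0_iff gal_add gal_diff av_add_le av_diff_le)

lemma L0_mscale: "c \<in> Zp av \<Longrightarrow> x \<in> L0 av \<Longrightarrow> mscale c x \<in> L0 av"
  by (simp add: L0_iff gal_mult gal_Qp Zp_iff av_mult_le')

lemma B0_herm:
  assumes "x \<in> V0 av" "y \<in> V0 av"
  shows "B0 \<beta> x y = \<beta> * (x $ 1 $ 1 * y $ 2 $ 2 + y $ 1 $ 1 * x $ 2 $ 2 - gal_trace av (x $ 1 $ 2 * gal av (y $ 1 $ 2)))"
proof -
  have "y $ 2 $ 1 = gal av (y $ 1 $ 2)" "x $ 2 $ 1 = gal av (x $ 1 $ 2)" using assms V0_iff by metis+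
  then show ?thesis by (simp add: B0_eq gal_trace_def gal_mult mult.commute)
qed

lemma B0_Qp: "\<beta> \<in> Qp av \<Longrightarrow> x \<in> V0 av \<Longrightarrow> y \<in> V0 av \<Longrightarrow> B0 \<beta> x y \<in> Qp av"
  unfolding B0_herm by (intro Qp_mult Qp_diff Qp_add gal_trace_Qp V0_diag_Qp)

lemma Q0_Qp: "\<beta> \<in> Qp av \<Longrightarrow> x \<in> V0 av \<Longrightarrow> Q0 \<beta> x \<in> Qp av"
proof -
  assume "\<beta> \<in> Qp av" "x \<in> V0 av"
  moreover from this have "x $ 2 $ 1 = gal av (x $ 1 $ 2)" using V0_iff by metis
  ultimately show ?thesis
    unfolding Q0_def det_2 using gal_norm_Qp[of "x $ 1 $ 2"]
    by (simp add: gal_norm_def Qp_mult Qp_diff V0_diag_Qp)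
qed

text \<open>\<open>1 / (2 * \<theta>)\<close> and \<open>1 / 2\<close> span the inverse different
  over \<open>Zp\<close>, and the traces of \<open>x\<close> against their conjugates are the
  coordinates of \<open>x\<close> up to sign.\<close>

lemma integer_if_trace_integral:
  assumes "\<And>\<nu>. \<nu> \<in> inv_different av \<Longrightarrow> av (gal_trace av (x * gal av \<nu>)) \<le> 1"
  shows "av x \<le> 1"
proof -
  obtain a b where x: "a \<in> Qp av" "b \<in> Qp av" "x = a + b * \<theta>" by (rule coords)
  have "1 / (2 * \<theta>) \<in> inv_different av" "1 / 2 \<in> inv_different av"
    using \<theta>_neq_0 av_\<theta>_le_1 by (simp_all add: inv_different_iff)
  then have "av (gal_trace av (x * gal av (1 / (2 * \<theta>)))) \<le> 1" "av (gal_trace av (x * gal av (1 / 2))) \<le> 1"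
    using assms by blast+
  moreover have "x * gal av (1 / (2 * \<theta>)) = (- a + (- b) * \<theta>) / (2 * \<theta>)"
    using \<theta>_neq_0 by (simp add: x gal_divide gal_mult gal_\<theta> field_simps)
  then have "gal_trace av (x * gal av (1 / (2 * \<theta>))) = - b"
    using gal_trace_half_\<theta>[of "- a" "- b"] x Qp_minus by simp
  moreover have "x * gal av (1 / 2) = a / 2 + (b / 2) * \<theta>"
    by (simp add: x gal_divide add_divide_distrib)
  then have "gal_trace av (x * gal av (1 / 2)) = a"
    using gal_trace_coords[of "a / 2" "b / 2"] x Qp_divide by simp
  ultimately have "av b \<le> 1" "av a \<le> 1" by simp_all
  then show ?thesis using av_coords_le_1 x by simp
qed

text \<open>In the pairing with \<open>L0\<close> the factor \<open>d\<close> meets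
  \<open>\<beta>\<close> and becomes a unit. What remains is the pairing of \<open>Zp\<close> with
  itself on the diagonal and the trace pairing of the integers with the inverse different, both
  perfect.\<close>

lemma L0_dual_iff:
  assumes \<beta>: "d * \<beta> \<in> Zp_units av"
  shows "x \<in> L0_dual av \<beta> \<longleftrightarrow> x \<in> V0 av \<and> av (x $ 1 $ 1) \<le> 1 \<and> av (x $ 2 $ 2) \<le> 1 \<and> av (x $ 1 $ 2) \<le> 1"
proof -
  have u: "av (d * \<beta>) = 1" using \<beta> by (simp add: Zp_units_iff)
  have "d * \<beta> / d \<in> Qp av" using \<beta> by (intro Qp_divide) (auto simp: Zp_units_iff)
  then have \<beta>Q: "\<beta> \<in> Qp av" using d_neq_0 by simp
  have B: "B0 \<beta> x (mscale d (mat2 a \<nu> (gal av \<nu>) b)) =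
      (d * \<beta>) * (x $ 1 $ 1 * b + a * x $ 2 $ 2 - gal_trace av (x $ 1 $ 2 * gal av \<nu>))"
    if "x \<in> V0 av" for a b \<nu>
  proof -
    have "x $ 2 $ 1 = gal av (x $ 1 $ 2)" using that V0_iff by metis
    then show ?thesis
      by (simp add: B0_eq gal_trace_def gal_mult algebra_simps)
  qed
  show ?thesis
  proof
    assume "x \<in> L0_dual av \<beta>"
    then have x: "x \<in> V0 av" "\<And>y. y \<in> L0 av \<Longrightarrow> B0 \<beta> x y \<in> Zp av" unfolding L0_dual_def by blast+
    have int: "av (x $ 1 $ 1 * b + a * x $ 2 $ 2 - gal_trace av (x $ 1 $ 2 * gal av \<nu>)) \<le> 1"
      if "a \<in> Zp av" "b \<in> Zp av" "\<nu> \<in> inv_different av" for a b \<nu>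
    proof -
      have "mscale d (mat2 a \<nu> (gal av \<nu>) b) \<in> L0 av" using that unfolding L0_def by blast
      then have "(d * \<beta>) * (x $ 1 $ 1 * b + a * x $ 2 $ 2 - gal_trace av (x $ 1 $ 2 * gal av \<nu>)) \<in> Zp av"
        using x(2) B[OF x(1)] by metis
      then show ?thesis unfolding Zp_iff av_mult[of "d * \<beta>"] u by simp
    qed
    have 0: "0 \<in> inv_different av" by (simp add: inv_different_iff)
    have "av (x $ 1 $ 1) \<le> 1" using int[of 0 1 0] 0 by (simp add: gal_trace_def)
    moreover have "av (x $ 2 $ 2) \<le> 1" using int[of 1 0 0] 0 by (simp add: gal_trace_def)
    moreover have "av (x $ 1 $ 2) \<le> 1"
    proof (rule integer_if_trace_integral)
      fix \<nu> assume "\<nu> \<in> inv_different av"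
      then show "av (gal_trace av (x $ 1 $ 2 * gal av \<nu>)) \<le> 1" using int[of 0 0 \<nu>] by simp
    qed
    ultimately show "x \<in> V0 av \<and> av (x $ 1 $ 1) \<le> 1 \<and> av (x $ 2 $ 2) \<le> 1 \<and> av (x $ 1 $ 2) \<le> 1"
      using x by blast
  next
    assume x: "x \<in> V0 av \<and> av (x $ 1 $ 1) \<le> 1 \<and> av (x $ 2 $ 2) \<le> 1 \<and> av (x $ 1 $ 2) \<le> 1"
    have "B0 \<beta> x y \<in> Zp av" if y: "y \<in> L0 av" for y
    proof -
      obtain a b \<nu> where ab: "y = mscale d (mat2 a \<nu> (gal av \<nu>) b)" "a \<in> Zp av" "b \<in> Zp av" "\<nu> \<in> inv_different av"
        using y unfolding L0_def by blast
      have "gal_trace av (x $ 1 $ 2 * gal av \<nu>) = gal_trace av (\<nu> * gal av (x $ 1 $ 2))"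
        by (simp add: gal_trace_def gal_mult mult.commute)
      moreover have "gal_trace av (\<nu> * gal av (x $ 1 $ 2)) \<in> Zp av"
        using ab(4) gal_integer x by (simp add: inv_different_def integers_def)
      ultimately have "av (gal_trace av (x $ 1 $ 2 * gal av \<nu>)) \<le> 1" by (simp add: Zp_iff)
      then have "av (x $ 1 $ 1 * b + a * x $ 2 $ 2 - gal_trace av (x $ 1 $ 2 * gal av \<nu>)) \<le> 1"
        using x ab by (auto intro!: av_diff_le av_add_le av_mult_le simp: Zp_iff)
      then have "av (B0 \<beta> x y) \<le> 1" using x B unfolding ab(1) by (simp add: av_mult[of "d * \<beta>"] u)
      moreover have "B0 \<beta> x y \<in> Qp av" using \<beta>Q x L0_V0[OF y] by (intro B0_Qp) auto
      ultimately show ?thesis by (simp add: Zp_iff)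
    qed
    with x show "x \<in> L0_dual av \<beta>" unfolding L0_dual_def by blast
  qed
qed

section \<open>The group, its character and its action\<close>

lemma HH_iff: "h \<in> HH av \<longleftrightarrow> (\<forall>i j. av (h $ i $ j) \<le> 1) \<and> det h \<in> Zp_units av"
proof
  assume "h \<in> HH av"
  then show "(\<forall>i j. av (h $ i $ j) \<le> 1) \<and> det h \<in> Zp_units av"
    by (auto simp: HH_def GL2_def integers_def Zp_units_iff Zp_units_iff)
next
  assume h: "(\<forall>i j. av (h $ i $ j) \<le> 1) \<and> det h \<in> Zp_units av"
  then have "det h \<noteq> 0" by (auto simp: Zp_units_iff)
  define g where "g = mscale (inverse (det h)) (mat2 (h $ 2 $ 2) (- h $ 1 $ 2) (- h $ 2 $ 1) (h $ 1 $ 1))"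
  obtain k where "h ** k = mat 1 \<and> k ** h = mat 1"
    using invertible_det_nz[of h] \<open>det h \<noteq> 0\<close> unfolding invertible_def by blast
  then have "h ** matrix_inv h = mat 1 \<and> matrix_inv h ** h = mat 1"
    unfolding matrix_inv_def by (rule someI)
  then have "h ** g = mat 1" "g ** h = mat 1"
    using matrix_inv_mat2[OF \<open>det h \<noteq> 0\<close>] by (simp_all add: g_def)
  moreover have "\<forall>i j. g $ i $ j \<in> integers av"
    using h by (simp add: g_def forall_2 integers_def av_mult av_inverse Zp_units_iff)
  ultimately show "h \<in> HH av"
    using h unfolding HH_def GL2_def Zp_units_iff Zp_units_iff by (auto simp: integers_def)
qed

lemma HH_det: "h \<in> HH av \<Longrightarrow> det h \<in> Zp_units av"
  by (simp add: HH_iff)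

lemma HH_det_nz: "h \<in> HH av \<Longrightarrow> det h \<noteq> 0"
  by (auto simp: HH_iff Zp_units_iff)

lemma HH_mult: "h \<in> HH av \<Longrightarrow> k \<in> HH av \<Longrightarrow> h ** k \<in> HH av"
proof -
  assume h: "h \<in> HH av" and k: "k \<in> HH av"
  have "det (h ** k) \<in> Zp_units av" using h k by (auto simp: HH_iff det_mul Zp_units_iff av_mult)
  moreover have "av ((h ** k) $ i $ j) \<le> 1" for i j
    using h k by (auto simp: HH_iff matrix_matrix_mult_def sum_2 intro!: av_add_le av_mult_le)
  ultimately show ?thesis by (simp add: HH_iff)
qed

lemma HH_1: "mat 1 \<in> HH av"
  by (simp add: HH_iff Zp_units_iff) (simp add: mat_def)

lemma HH_inv:
  assumes "h \<in> HH av"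
  shows "matrix_inv h \<in> HH av" "h ** matrix_inv h = mat 1" "matrix_inv h ** h = mat 1"
    "det (matrix_inv h) = inverse (det h)"
proof -
  obtain k where "h ** k = mat 1 \<and> k ** h = mat 1"
    using assms by (auto simp: HH_def GL2_def)
  then have *: "h ** matrix_inv h = mat 1 \<and> matrix_inv h ** h = mat 1"
    unfolding matrix_inv_def by (rule someI)
  then show "h ** matrix_inv h = mat 1" "matrix_inv h ** h = mat 1" by blast+
  have "det h * det (matrix_inv h) = 1" using * by (metis det_I det_mul)
  then show det: "det (matrix_inv h) = inverse (det h)" by (metis inverse_unique)
  have "\<forall>i j. av (matrix_inv h $ i $ j) \<le> 1"
    using assms unfolding matrix_inv_mat2[OF HH_det_nz[OF assms]]
    by (simp add: forall_2 av_mult av_inverse HH_iff Zp_units_iff)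
  moreover have "det (matrix_inv h) \<in> Zp_units av"
    using HH_det[OF assms] by (auto simp: det Zp_units_iff av_inverse)
  ultimately show "matrix_inv h \<in> HH av" by (simp add: HH_iff)
qed

lemma chi_eq: "chi av h = (if is_norm (det h) then 1 else - 1)"
  by (simp add: chi_def quad_char_eq)

lemma chi_mult:
  assumes "h \<in> HH av" "k \<in> HH av"
  shows "chi av (h ** k) = chi av h * chi av k"
  using not_norm_mult[OF HH_det[OF assms(1)] _ HH_det[OF assms(2)]]
    is_norm_mult_iff[of "det k" "det h"] is_norm_mult_iff[of "det h" "det k"]
  by (auto simp: chi_eq det_mul mult.commute)

lemma chi_1: "chi av (mat 1) = 1"
  by (simp add: chi_eq is_norm_1)

lemma chi_inv: "h \<in> HH av \<Longrightarrow> chi av (matrix_inv h) = chi av h"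
  using is_norm_inverse[of "det h"] is_norm_inverse[of "inverse (det h)"] by (auto simp: chi_eq HH_inv)

lemma chi_square: "chi av h * chi av h = 1" and chi_nz: "chi av h \<noteq> 0"
  and inverse_chi: "inverse (chi av h) = chi av h"
  by (auto simp: chi_eq)

lemma act_entry: "act av h x $ i $ j = inverse (det h) *
    ((h $ i $ 1 * x $ 1 $ 1 + h $ i $ 2 * x $ 2 $ 1) * gal av (h $ j $ 1) +
     (h $ i $ 1 * x $ 1 $ 2 + h $ i $ 2 * x $ 2 $ 2) * gal av (h $ j $ 2))"
  by (simp add: act_def matrix_matrix_mult_def sum_2 transpose_def map_matrix_def)

lemma act_mult: "act av (h ** k) x = act av h (act av k x)"
proof -
  have "map_matrix (gal av) (h ** k) = map_matrix (gal av) h ** map_matrix (gal av) k"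
    by (simp add: vec_eq_iff matrix_matrix_mult_def sum_2 map_matrix_def gal_add gal_mult)
  then show ?thesis
    by (simp add: act_def matrix_transpose_mul det_mul mscale_mult mscale_mscale matrix_mul_assoc mult.commute)
qed

lemma act_1: "act av (mat 1) x = x"
  unfolding vec_eq_iff forall_2 act_entry det_I by (simp add: mat_def)

lemma act_add: "act av h (x + y) = act av h x + act av h y"
  and act_diff: "act av h (x - y) = act av h x - act av h y"
  and act_mscale: "act av h (mscale c x) = mscale c (act av h x)"
  by (simp_all add: vec_eq_iff act_entry algebra_simps)

lemma act_inv: "h \<in> HH av \<Longrightarrow> act av h (act av (matrix_inv h) x) = x"
  "h \<in> HH av \<Longrightarrow> act av (matrix_inv h) (act av h x) = x"
  by (simp_all add: act_1 HH_inv flip: act_mult)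

lemma bij_act: "h \<in> HH av \<Longrightarrow> bij (act av h)"
  by (rule bijI') (metis act_inv, metis act_inv)

lemma act_V0: "h \<in> HH av \<Longrightarrow> x \<in> V0 av \<Longrightarrow> act av h x \<in> V0 av"
  unfolding V0_iff act_entry
  by (auto simp: gal_mult gal_add gal_inverse gal_Qp HH_iff Zp_units_iff algebra_simps)

text \<open>Determinants in \<open>HH\<close> lie in \<open>Zp\<close>, so the conjugate transpose
  has the same determinant as \<open>h\<close>; the scaling by \<open>inverse (det h)\<close> then
  cancels \<open>det h\<close> twice.\<close>

lemma det_act: "h \<in> HH av \<Longrightarrow> det (act av h x) = det x"
proof -
  assume h: "h \<in> HH av"
  obtain a b c e where h': "h = mat2 a b c e" by (rule mat2_cases)
  have "gal av (det h) = det h" using h by (simp add: HH_iff Zp_units_iff gal_Qp)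
  then have gal: "gal av a * gal av e - gal av b * gal av c = det h"
    by (simp add: h' mat2_simps(5) gal_diff gal_mult)
  define y where "y = h ** x ** transpose (map_matrix (gal av) h)"
  have "det (transpose (map_matrix (gal av) h)) = det h"
    using gal by (simp add: h' map_matrix_mat2 mat2_simps(4,5) mult.commute)
  then have y: "det y = det h * det x * det h" by (simp add: y_def det_mul)
  have "det (act av h x) = inverse (det h) * inverse (det h) * det y"
    by (simp add: act_def y_def[symmetric] det_2 algebra_simps)
  then show ?thesis using HH_det_nz[OF h] by (simp add: y field_simps)
qed

lemma B0_act: "h \<in> HH av \<Longrightarrow> B0 \<beta> (act av h x) (act av h y) = B0 \<beta> x y"
  by (simp add: B0_def Q0_def det_act flip: act_add)

lemma act_diagonal:
  assumes "x \<in> V0 av"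
  shows "act av h x $ i $ i = inverse (det h) *
    (x $ 1 $ 1 * (h $ i $ 1 * gal av (h $ i $ 1)) + x $ 2 $ 2 * (h $ i $ 2 * gal av (h $ i $ 2)) +
     gal_trace av (x $ 1 $ 2 * (h $ i $ 1 * gal av (h $ i $ 2))))"
proof -
  have "x $ 2 $ 1 = gal av (x $ 1 $ 2)" using assms V0_iff by metis
  then show ?thesis by (simp add: act_entry gal_trace_def gal_mult algebra_simps)
qed

text \<open>The corner of \<open>x\<close> is divisible by \<open>2 * \<theta>\<close> only, while
  the diagonal of the image has to be divisible by \<open>4 * D\<close>. By
  \<open>act_diagonal\<close> the corner reaches the diagonal only through a trace, and
  \<open>gal_trace_different\<close> supplies the missing factor.\<close>

lemma act_L0:
  assumes h: "h \<in> HH av" and x: "x \<in> L0 av"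
  shows "act av h x \<in> L0 av"
proof -
  have V: "x \<in> V0 av" using x by (rule L0_V0)
  have hi: "av (h $ i $ j) \<le> 1" "av (gal av (h $ i $ j)) \<le> 1" for i j
    using h gal_integer by (auto simp: HH_iff)
  have x12: "av (x $ 1 $ 2) \<le> av (2 * \<theta>)" using x by (simp add: L0_iff)
  have "x $ 2 $ 1 = gal av (x $ 1 $ 2)" using V V0_iff by metis
  then have x21: "av (x $ 2 $ 1) \<le> av (2 * \<theta>)" using gal_different x12 by simp
  have xii: "av (x $ 1 $ 1) \<le> av (4 * D)" "av (x $ 2 $ 2) \<le> av (4 * D)" using x by (simp_all add: L0_iff)
  have det: "av (inverse (det h)) \<le> 1" using h by (simp add: HH_iff Zp_units_iff av_inverse)
  have "av (act av h x $ i $ i) \<le> av (4 * D)" for i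
    unfolding act_diagonal[OF V]
    by (intro av_mult_le'[OF det] av_add_le gal_trace_different av_mult_le[OF x12] av_mult_le[OF xii(1)]
        av_mult_le[OF xii(2)] av_mult_le' hi)
  moreover have "av (act av h x $ 1 $ 2) \<le> av (2 * \<theta>)"
    unfolding act_entry
    by (intro av_mult_le'[OF det] av_add_le av_mult_le[OF _ hi(2)] av_mult_le'[OF hi(1)] x12 x21
        order_trans[OF xii(1) av_4D_le] order_trans[OF xii(2) av_4D_le])
  ultimately show ?thesis using act_V0[OF h V] by (simp add: L0_iff V0_iff)
qed

lemma act_L0_dual:
  assumes \<beta>: "d * \<beta> \<in> Zp_units av" and h: "h \<in> HH av" and x: "x \<in> L0_dual av \<beta>"
  shows "act av h x \<in> L0_dual av \<beta>"
proof -
  have V: "x \<in> V0 av" using x by (simp add: L0_dual_def)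
  have "B0 \<beta> (act av h x) y \<in> Zp av" if "y \<in> L0 av" for y
  proof -
    have "act av (matrix_inv h) y \<in> L0 av" using act_L0 HH_inv(1) h that by blast
    then have "B0 \<beta> x (act av (matrix_inv h) y) \<in> Zp av" using x by (simp add: L0_dual_def)
    then show ?thesis using B0_act[OF h, of \<beta> x "act av (matrix_inv h) y"] by (simp add: act_inv h)
  qed
  then show ?thesis using act_V0[OF h V] by (simp add: L0_dual_def)
qed

lemma act_coset:
  assumes h: "h \<in> HH av"
  shows "act av h ` ((+) x ` mscale c ` L0 av) = (+) (act av h x) ` mscale c ` L0 av"
proof (intro equalityI subsetI)
  fix z assume "z \<in> act av h ` ((+) x ` mscale c ` L0 av)"
  then obtain y where "y \<in> L0 av" "z = act av h x + mscale c (act av h y)"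
    by (auto simp: act_add act_mscale)
  then show "z \<in> (+) (act av h x) ` mscale c ` L0 av" using act_L0[OF h] by blast
next
  fix z assume "z \<in> (+) (act av h x) ` mscale c ` L0 av"
  then obtain y where y: "y \<in> L0 av" "z = act av h x + mscale c y" by blast
  then have "z = act av h (x + mscale c (act av (matrix_inv h) y))"
    by (simp add: act_add act_mscale act_inv h)
  moreover have "act av (matrix_inv h) y \<in> L0 av" using act_L0 HH_inv(1) h y by blast
  ultimately show "z \<in> act av h ` ((+) x ` mscale c ` L0 av)" by blast
qed

end

section \<open>The isotypic subspace\<close>

lemma L0_coset_eq: "L0_coset av x = (+) x ` L0 av"
  by (simp add: L0_coset_def add.commute)

locale ramified_quadratic_space = ramified_quadratic_basis p av \<theta> D
  for p :: nat and av :: "'k::field_char_0 \<Rightarrow> real" and \<theta> D +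
  fixes \<beta> :: 'k
  assumes \<beta>: "d * \<beta> \<in> Zp_units av"
begin

lemma \<beta>_Qp: "\<beta> \<in> Qp av" and av_\<beta>: "av (4 * D) * av \<beta> = 1"
proof -
  have "d * \<beta> / d \<in> Qp av" using \<beta> by (intro Qp_divide) (auto simp: Zp_units_iff)
  then show "\<beta> \<in> Qp av" using d_neq_0 by simp
  show "av (4 * D) * av \<beta> = 1" using \<beta> by (simp add: Zp_units_iff av_mult av_d)
qed

lemmas L0_dual_iff = L0_dual_iff[OF \<beta>]

lemma L0_dual_V0: "x \<in> L0_dual av \<beta> \<Longrightarrow> x \<in> V0 av"
  by (simp add: L0_dual_def)

lemma L0_subset_dual: "x \<in> L0 av \<Longrightarrow> x \<in> L0_dual av \<beta>"
  using av_4D_le_1 av_2\<theta>_le_1 L0_V0[of x] unfolding L0_iff L0_dual_iff by force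

lemma L0_dual_add: "x \<in> L0_dual av \<beta> \<Longrightarrow> y \<in> L0_dual av \<beta> \<Longrightarrow> x + y \<in> L0_dual av \<beta>"
  unfolding L0_dual_iff by (auto intro: V0_add av_add_le)

lemma B0_dual: "x \<in> L0_dual av \<beta> \<Longrightarrow> y \<in> L0 av \<Longrightarrow> B0 \<beta> x y \<in> Zp av"
  by (simp add: L0_dual_def)

lemma mscale_dual: "different_norm av = p ^ f \<Longrightarrow> x \<in> L0_dual av \<beta> \<Longrightarrow> mscale (of_nat p ^ f) x \<in> L0 av"
proof -
  assume f: "different_norm av = p ^ f" and x: "x \<in> L0_dual av \<beta>"
  have "av (of_nat p ^ f) = av (4 * D)" using av_d f by simp
  then have "av (of_nat p ^ f * x $ i $ j) \<le> av (4 * D)" if "av (x $ i $ j) \<le> 1" for i j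
    using av_mult_le that by simp
  then show ?thesis
    using x av_4D_le unfolding L0_dual_iff L0_iff V0_iff by (force simp: gal_mult gal_power)
qed

text \<open>\<open>d\<close> maps the dual lattice into \<open>L0\<close>, so a function carried by
  the quotient of the two is automatically a Schwartz function.\<close>

lemma S_L0_iff:
  "\<phi> \<in> S_L0 p av \<beta> \<longleftrightarrow> (\<forall>x. \<phi> x \<noteq> 0 \<longrightarrow> x \<in> L0_dual av \<beta>) \<and> invariant_under (L0 av) \<phi>"
proof -
  have "\<phi> \<in> schwartz p av"
    if supp: "\<And>x. \<phi> x \<noteq> 0 \<Longrightarrow> x \<in> L0_dual av \<beta>" and inv: "invariant_under (L0 av) \<phi>"
  proof -
    obtain f where f: "different_norm av = p ^ f" using different_norm by blast
    have "x \<in> mscale (inverse (of_nat p ^ f)) ` L0 av" if "x \<in> L0_dual av \<beta>" for x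
    proof -
      have "x = mscale (inverse (of_nat p ^ f)) (mscale (of_nat p ^ f) x)"
        by (simp add: mscale_mscale mscale_1)
      then show ?thesis using mscale_dual[OF f that] by blast
    qed
    moreover have "invariant_under (mscale (of_nat p ^ f) ` L0 av) \<phi>"
      using inv L0_mscale[of "of_nat p ^ f"] Zp_power[OF Zp_of_nat] by (auto simp: invariant_under_def)
    ultimately show ?thesis using supp unfolding schwartz_def by blast
  qed
  then show ?thesis unfolding S_L0_def by blast
qed

lemma finite_dual_cosets: "finite ((\<lambda>x. (+) x ` L0 av) ` L0_dual av \<beta>)"
proof -
  obtain f where f: "av (4 * D) = 1 / real p ^ f" using different_norm by blast
  define T where "T = (\<lambda>(i, j, k, l). mat2 (of_nat i) (of_nat k + of_nat l * \<theta>)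
    (of_nat k - of_nat l * \<theta>) (of_nat j) :: 'k^2^2)"
  define A where "A = {..<p ^ f} \<times> {..<p ^ f} \<times> {..<p ^ f} \<times> {..<p ^ f}"
  have "(\<lambda>x. (+) x ` L0 av) ` L0_dual av \<beta> \<subseteq> (\<lambda>t. (+) (T t) ` L0 av) ` A"
  proof
    fix C assume "C \<in> (\<lambda>x. (+) x ` L0 av) ` L0_dual av \<beta>"
    then obtain x where x: "x \<in> L0_dual av \<beta>" "C = (+) x ` L0 av" by blast
    then have "x $ 1 $ 1 \<in> Zp av" "x $ 2 $ 2 \<in> Zp av"
      using V0_diag_Qp unfolding L0_dual_iff Zp_iff by blast+
    then obtain i j where i: "i < p ^ f" "av (x $ 1 $ 1 - of_nat i) \<le> 1 / real p ^ f"
      and j: "j < p ^ f" "av (x $ 2 $ 2 - of_nat j) \<le> 1 / real p ^ f" using Zp_approx_nat by metis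
    have "av (x $ 1 $ 2) \<le> 1" using x by (simp add: L0_dual_iff)
    then obtain a b where ab: "a \<in> Zp av" "b \<in> Zp av" "x $ 1 $ 2 = a + b * \<theta>" by (rule integer_coords)
    obtain k l where k: "k < p ^ f" "av (a - of_nat k) \<le> 1 / real p ^ f"
      and l: "l < p ^ f" "av (b - of_nat l) \<le> 1 / real p ^ f" using Zp_approx_nat ab by metis
    have T: "T (i, j, k, l) \<in> V0 av"
      unfolding V0_iff forall_2 T_def using gal_coords[of "of_nat k" "of_nat l"]
      by (simp add: gal_diff gal_mult gal_\<theta>)
    have "av ((a - of_nat k) + (b - of_nat l) * \<theta>) \<le> av (4 * D)"
      using k l unfolding f by (intro av_add_le av_mult_le av_\<theta>_le_1)
    also have "(a - of_nat k) + (b - of_nat l) * \<theta> = (x - T (i, j, k, l)) $ 1 $ 2"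
      by (simp add: T_def ab algebra_simps)
    finally have "av ((x - T (i, j, k, l)) $ 1 $ 2) \<le> av (2 * \<theta>)" using av_4D_le by simp
    moreover have "av ((x - T (i, j, k, l)) $ 1 $ 1) \<le> av (4 * D)" "av ((x - T (i, j, k, l)) $ 2 $ 2) \<le> av (4 * D)"
      using i j by (simp_all add: T_def f)
    ultimately have "x - T (i, j, k, l) \<in> L0 av"
      using V0_diff[OF L0_dual_V0[OF x(1)] T] unfolding L0_iff V0_iff by blast
    then have "C = (+) (T (i, j, k, l)) ` L0 av"
      using coset_eq_iff[of "L0 av"] L0_diff x by simp
    then show "C \<in> (\<lambda>t. (+) (T t) ` L0 av) ` A" using i j k l by (auto simp: A_def)
  qed
  moreover have "finite A" by (simp add: A_def)
  ultimately show ?thesis by (meson finite_imageI finite_subset)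
qed

text \<open>At such a point a \<open>\<chi>\<close>-isotypic function satisfies
  \<open>\<phi> x = - \<phi> x\<close>. Together with the orbit of \<open>ell + L0\<close>, these
  points exhaust the dual lattice (\<open>dual_cases\<close>).\<close>

definition vanishing_point :: "'k^2^2 \<Rightarrow> bool" where
  "vanishing_point x \<longleftrightarrow> (\<exists>h\<in>HH av. chi av h = - 1 \<and> act av h x - x \<in> L0 av)"

definition orbit_point :: "'k^2^2 \<Rightarrow> bool" where
  "orbit_point x \<longleftrightarrow> (\<exists>h\<in>HH av. x - act av h ell \<in> L0 av)"

lemma orbit_point_act:
  assumes "g \<in> HH av" "orbit_point (act av g x)"
  shows "orbit_point x"
proof -
  obtain h where h: "h \<in> HH av" "act av g x - act av h ell \<in> L0 av" using assms(2) by (auto simp: orbit_point_def)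
  have "act av (matrix_inv g) (act av g x - act av h ell) \<in> L0 av"
    using h assms HH_inv act_L0 by blast
  then have "x - act av (matrix_inv g ** h) ell \<in> L0 av"
    using assms by (simp add: act_diff act_inv act_mult)
  then show ?thesis using HH_mult HH_inv(1) assms(1) h(1) unfolding orbit_point_def by blast
qed

lemma vanishing_point_act:
  assumes "g \<in> HH av" "vanishing_point (act av g x)"
  shows "vanishing_point x"
proof -
  obtain h where h: "h \<in> HH av" "chi av h = - 1" "act av h (act av g x) - act av g x \<in> L0 av"
    using assms(2) by (auto simp: vanishing_point_def)
  have g: "matrix_inv g \<in> HH av" using assms(1) by (rule HH_inv)
  have "act av (matrix_inv g) (act av h (act av g x) - act av g x) \<in> L0 av"
    using h g act_L0 by blast
  then have "act av (matrix_inv g ** h ** g) x - x \<in> L0 av"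
    using assms by (simp add: act_diff act_inv act_mult)
  moreover have "matrix_inv g ** h ** g \<in> HH av" using g h assms HH_mult by blast
  moreover have "chi av (matrix_inv g ** h ** g) = - 1"
    using g h assms HH_mult chi_square[of g] by (simp add: chi_mult chi_inv)
  ultimately show ?thesis unfolding vanishing_point_def by blast
qed

lemma HH_mat2: "mat2 a b c e \<in> HH av \<longleftrightarrow>
    av a \<le> 1 \<and> av b \<le> 1 \<and> av c \<le> 1 \<and> av e \<le> 1 \<and> a * e - b * c \<in> Zp_units av"
  by (auto simp: HH_iff forall_2 det_2)

lemma diagonal_cases:
  assumes a: "a \<in> Zp_units av" and c: "c \<in> Zp av"
  shows "orbit_point (mat2 a 0 0 c) \<or> vanishing_point (mat2 a 0 0 c)"
proof (cases "av c \<le> av (4 * D)")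
  case True
  have "mat2 a 0 0 1 \<in> HH av" using a by (simp add: HH_mat2 Zp_units_iff)
  moreover have "act av (mat2 a 0 0 1) ell = mat2 a 0 0 0"
  proof -
    have "a \<noteq> 0" "gal av a = a" using a by (auto simp: Zp_units_iff gal_Qp)
    then show ?thesis by (simp add: vec_eq_iff forall_2 act_entry ell_def det_2)
  qed
  moreover have "mat2 a 0 0 c - mat2 a 0 0 0 \<in> L0 av"
    using True c av_4D_pos av_2\<theta>_pos by (simp add: L0_iff forall_2 gal_Qp Zp_iff)
  ultimately show ?thesis unfolding orbit_point_def by metis
next
  case False
  have ac: "a * c \<in> Zp av" "av (a * c) > av (4 * D)"
    using a c False by (auto simp: Zp_units_iff Zp_iff av_mult)
  obtain x y where xy: "av x \<le> 1" "av y \<le> 1" "gal_norm av x + a * c * gal_norm av y \<in> Zp_units av"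
    "\<not> is_norm (gal_norm av x + a * c * gal_norm av y)"
    using binary_form_not_norm[OF ac] by blast
  \<comment> \<open>For fixed \<open>a\<close> and \<open>c\<close> these matrices form a quaternion
    algebra with reduced norm \<open>N x + a c N y\<close>. They are similitudes of the hermitian
    form diag(a, c) with factor \<open>det k\<close>, which the normalisation of the action divides
    out.\<close>
  define k where "k = mat2 x (- (a * gal av y)) (c * y) (gal av x)"
  define e where "e = gal_norm av x + a * c * gal_norm av y"
  have acQ: "gal av a = a" "gal av c = c" using a c by (simp_all add: gal_Qp Zp_units_iff Zp_iff)
  have det: "det k = e" unfolding k_def mat2_simps(5) by (simp add: e_def gal_norm_def algebra_simps)
  have "k \<in> HH av" unfolding k_def HH_mat2
    using a c xy gal_integer[of x] gal_integer[of y] det[unfolded k_def mat2_simps(5)]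
    by (auto simp: Zp_units_iff Zp_iff e_def intro: av_mult_le)
  moreover have "chi av k = - 1" using xy by (simp add: chi_eq det e_def)
  moreover have "act av k (mat2 a 0 0 c) = mat2 a 0 0 c"
  proof -
    have "e \<noteq> 0" using xy by (auto simp: e_def Zp_units_iff)
    have "k ** mat2 a 0 0 c ** transpose (map_matrix (gal av) k) = mscale e (mat2 a 0 0 c)"
      unfolding k_def map_matrix_mat2 mat2_simps
      by (simp add: gal_minus gal_mult acQ e_def gal_norm_def algebra_simps)
    then show ?thesis using \<open>e \<noteq> 0\<close> by (simp add: act_def det mscale_mscale mscale_1)
  qed
  ultimately have "vanishing_point (mat2 a 0 0 c)" unfolding vanishing_point_def
    by (intro bexI[of _ k]) simp_all
  then show ?thesis ..
qed

text \<open>A unit pivot allows the hermitian form to be diagonalised over the integers: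
  \<open>g\<close> clears the off-diagonal entries.\<close>

lemma unit_corner_cases:
  assumes x: "x \<in> L0_dual av \<beta>" and unit: "av (x $ 1 $ 1) = 1"
  shows "orbit_point x \<or> vanishing_point x"
proof -
  define g where "g = mat2 1 0 (- (x $ 2 $ 1 / x $ 1 $ 1)) 1"
  have V: "x \<in> V0 av" using x by (rule L0_dual_V0)
  have x21: "x $ 2 $ 1 = gal av (x $ 1 $ 2)" "gal av (x $ 2 $ 1) = x $ 1 $ 2" using V V0_iff by metis+
  have "x $ 1 $ 1 \<in> Qp av" using V by (rule V0_diag_Qp)
  then have x11: "x $ 1 $ 1 \<in> Zp_units av" "gal av (x $ 1 $ 1) = x $ 1 $ 1" "x $ 1 $ 1 \<noteq> 0"
    using unit by (auto simp: Zp_units_iff gal_Qp)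
  have "av (x $ 2 $ 1) \<le> 1" using x x21 gal_integer by (simp add: L0_dual_iff)
  then have g: "g \<in> HH av" by (simp add: g_def HH_mat2 av_divide unit Zp_units_iff)
  define c where "c = act av g x $ 2 $ 2"
  have "act av g x = mat2 (x $ 1 $ 1) 0 0 c"
    using x11 x21 unfolding c_def
    by (simp add: vec_eq_iff forall_2 act_entry g_def det_2 gal_minus gal_divide)
  moreover have "c \<in> Zp av"
    using act_L0_dual[OF \<beta> g x] V0_diag_Qp unfolding c_def L0_dual_iff Zp_iff by blast
  ultimately have "orbit_point (act av g x) \<or> vanishing_point (act av g x)"
    using diagonal_cases x11 by simp
  then show ?thesis using orbit_point_act vanishing_point_act g by blast
qed

lemma dual_cases:
  assumes x: "x \<in> L0_dual av \<beta>"
  shows "orbit_point x \<or> vanishing_point x"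
proof -
  have V: "x \<in> V0 av" using x by (rule L0_dual_V0)
  note Qp = V0_diag_Qp[OF V]
  have le: "av (x $ 1 $ 1) \<le> 1" "av (x $ 2 $ 2) \<le> 1" using x by (simp_all add: L0_dual_iff)
  consider "av (x $ 1 $ 1) = 1" | "av (x $ 2 $ 2) = 1" | "av (x $ 1 $ 1) < 1" "av (x $ 2 $ 2) < 1"
    using le by linarith
  then show ?thesis
  proof cases
    case 1
    then show ?thesis using x by (intro unit_corner_cases)
  next
    case 2
    define w where "w = (mat2 0 1 (- 1) 0 :: 'k^2^2)"
    have w: "w \<in> HH av" by (simp add: w_def HH_mat2 Zp_units_iff)
    have "act av w x $ 1 $ 1 = x $ 2 $ 2" by (simp add: act_entry w_def det_2)
    then have "orbit_point (act av w x) \<or> vanishing_point (act av w x)"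
      using 2 act_L0_dual[OF \<beta> w x] by (intro unit_corner_cases) auto
    then show ?thesis using orbit_point_act vanishing_point_act w by blast
  next
    case 3
    then have p: "av (x $ 1 $ 1) \<le> 1 / real p" "av (x $ 2 $ 2) \<le> 1 / real p"
      using Qp_av_less_1 Qp by blast+
    obtain u where u: "u \<in> Zp_units av" "\<not> is_norm u" "av (of_nat p * (u - 1)) \<le> av (4 * D)"
      using not_norm_near_1 by blast
    have uQ: "gal av u = u" "u \<noteq> 0" "av u = 1" "u \<in> Qp av" using u by (auto simp: Zp_units_iff gal_Qp)
    have small: "av ((u - 1) * z) \<le> av (4 * D)" if "av z \<le> 1 / real p" for z
    proof -
      have "av (u - 1) * av z \<le> av (u - 1) * (1 / real p)" using that av_nonneg by (intro mult_left_mono)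
      also have "\<dots> = av (of_nat p * (u - 1))" by (simp add: av_mult av_p)
      finally show ?thesis using u(3) by (simp add: av_mult)
    qed
    \<comment> \<open>Conjugation fixes \<open>u\<close>, so this matrix multiplies the diagonal
      entries by \<open>u\<close> and \<open>inverse u\<close> and leaves the corner alone.\<close>
    define h where "h = mat2 u 0 0 1"
    have "h \<in> HH av" using u uQ by (simp add: h_def HH_mat2)
    moreover have "chi av h = - 1" using u by (simp add: chi_eq h_def det_2)
    moreover have "act av h x - x \<in> L0 av"
    proof -
      have "(act av h x - x) $ 1 $ 1 = (u - 1) * x $ 1 $ 1"
        using uQ by (simp add: act_entry h_def det_2 field_simps)
      moreover have "(act av h x - x) $ 2 $ 2 = - inverse u * ((u - 1) * x $ 2 $ 2)"
        using uQ by (simp add: act_entry h_def det_2 field_simps)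
      then have "av ((act av h x - x) $ 2 $ 2) = av ((u - 1) * x $ 2 $ 2)"
        using uQ by (simp add: av_mult av_inverse)
      moreover have "(act av h x - x) $ 1 $ 2 = 0"
        using uQ by (simp add: act_entry h_def det_2 field_simps)
      moreover have "act av h x - x \<in> V0 av" using act_V0[OF \<open>h \<in> HH av\<close> V] V by (rule V0_diff)
      ultimately show ?thesis
        using small[OF p(1)] small[OF p(2)] av_nonneg[of "2 * \<theta>"] unfolding L0_iff V0_iff by simp
    qed
    ultimately show ?thesis unfolding vanishing_point_def by blast
  qed
qed

section \<open>The stabiliser of \<open>ell\<close> and the function \<open>u_K\<close>\<close>

lemma ell_dual: "ell \<in> L0_dual av \<beta>"
  by (simp add: L0_dual_iff V0_iff forall_2 ell_def)

lemma av_4D_less_1: "av (4 * D) < 1"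
proof (cases "av D < 1")
  case True
  then have "av 4 * av D \<le> 1 * av D" using av_of_nat_le_1[of 4] av_nonneg by (intro mult_right_mono) auto
  then show ?thesis using True by (simp add: av_mult)
next
  case False
  then have "p = 2" using D_cases p_gt_1 by auto
  then show ?thesis by (rule even_cases) auto
qed

text \<open>The upper left entry of the image of \<open>ell\<close> is
  \<open>N (h $ 1 $ 1) / det h\<close>. As it is 1 modulo \<open>d\<close>, the determinant is
  congruent to a norm modulo the conductor, hence a norm.\<close>

lemma chi_stabilizer:
  assumes h: "h \<in> HH av" and st: "act av h ell - ell \<in> L0 av"
  shows "chi av h = 1"
proof -
  define n where "n = gal_norm av (h $ 1 $ 1)"
  have u: "det h \<in> Qp av" "av (det h) = 1" "det h \<noteq> 0" using HH_det[OF h] by (auto simp: Zp_units_iff)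
  have "(act av h ell - ell) $ 1 $ 1 = inverse (det h) * n - 1"
    by (simp add: act_entry ell_def n_def gal_norm_def)
  then have "av (inverse (det h) * n - 1) \<le> av (4 * D)" using st by (simp add: L0_iff)
  then have "av (det h * (inverse (det h) * n - 1)) \<le> av (4 * D)" using u by (simp add: av_mult)
  moreover have "det h * (inverse (det h) * n - 1) = n - det h" using u by (simp add: algebra_simps)
  ultimately have nd: "av (n - det h) \<le> av (4 * D)" by simp
  then have "av (n - det h) < av (det h)" using av_4D_less_1 u by simp
  from av_add_eq[OF this] have n1: "av n = 1" using u by simp
  then have "h $ 1 $ 1 \<noteq> 0" by (auto simp: n_def gal_norm_def)
  then have norm: "is_norm n" unfolding is_norm_def n_def by blast
  have unit: "n \<in> Zp_units av" using n1 gal_norm_Qp by (simp add: Zp_units_iff n_def)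
  have "av (det h - n) \<le> av (4 * D)" using nd by (subst av_diff_commute)
  from is_norm_cong[OF norm unit u(1) this] have "is_norm (det h)" .
  then show ?thesis by (simp add: chi_eq)
qed

lemma L0_coset_eq_iff: "(+) x ` L0 av = (+) y ` L0 av \<longleftrightarrow> x - y \<in> L0 av"
  using L0_diff by (intro coset_eq_iff) auto

lemma HH_ell_iff: "h \<in> HH_ell av \<longleftrightarrow> h \<in> HH av \<and> act av h ell - ell \<in> L0 av"
proof -
  have "act av h ` L0_coset av ell = L0_coset av ell \<longleftrightarrow> act av h ell - ell \<in> L0 av" if "h \<in> HH av"
  proof -
    have "mscale 1 ` L0 av = L0 av" by (simp add: mscale_1)
    then have "act av h ` L0_coset av ell = (+) (act av h ell) ` L0 av"
      using act_coset[OF that, of ell 1] by (simp only: L0_coset_eq)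
    then show ?thesis by (simp only: L0_coset_eq L0_coset_eq_iff)
  qed
  then show ?thesis unfolding HH_ell_def by blast
qed

text \<open>The orbit-stabiliser correspondence for the action on cosets of \<open>L0\<close>, from
  which \<open>\<chi>\<close> becomes a function on the orbit of \<open>ell + L0\<close>.\<close>

lemma left_coset_HH_ell:
  assumes "h \<in> HH av" "k \<in> HH av"
  shows "k \<in> (**) h ` HH_ell av \<longleftrightarrow> act av k ell - act av h ell \<in> L0 av"
proof
  assume "k \<in> (**) h ` HH_ell av"
  then obtain e where e: "e \<in> HH_ell av" "k = h ** e" by blast
  then have "act av h (act av e ell - ell) \<in> L0 av" using assms act_L0 by (simp add: HH_ell_iff)
  then show "act av k ell - act av h ell \<in> L0 av" by (simp add: e act_mult act_diff)
next
  assume k: "act av k ell - act av h ell \<in> L0 av"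
  define e where "e = matrix_inv h ** k"
  have "act av (matrix_inv h) (act av k ell - act av h ell) \<in> L0 av"
    using k assms HH_inv(1) act_L0 by blast
  then have "act av e ell - ell \<in> L0 av" using assms by (simp add: e_def act_mult act_diff act_inv)
  moreover have "e \<in> HH av" using assms HH_inv(1) HH_mult by (simp add: e_def)
  moreover have "k = h ** e" using assms by (simp add: e_def matrix_mul_assoc HH_inv)
  ultimately show "k \<in> (**) h ` HH_ell av" by (auto simp: HH_ell_iff)
qed

lemma left_coset_HH_ell_eq:
  assumes "h \<in> HH av" "k \<in> HH av" "act av k ell - act av h ell \<in> L0 av"
  shows "(**) k ` HH_ell av = (**) h ` HH_ell av"
proof -
  have HH: "x \<in> HH av" if "x \<in> (**) k ` HH_ell av" "k \<in> HH av" for k x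
    using that HH_mult by (auto simp: HH_ell_iff)
  have "x \<in> (**) k ` HH_ell av \<longleftrightarrow> x \<in> (**) h ` HH_ell av" if x: "x \<in> HH av" for x
    using L0_add[OF _ assms(3), of "act av x ell - act av k ell"]
      L0_diff[OF _ assms(3), of "act av x ell - act av h ell"]
    unfolding left_coset_HH_ell[OF assms(1) x] left_coset_HH_ell[OF assms(2) x] by auto
  then show ?thesis using HH[OF _ assms(1)] HH[OF _ assms(2)] by blast
qed

lemma chi_cong:
  assumes "h \<in> HH av" "k \<in> HH av" "act av k ell - act av h ell \<in> L0 av"
  shows "chi av k = chi av h"
proof -
  obtain e where e: "e \<in> HH_ell av" "k = h ** e" using left_coset_HH_ell assms by blast
  then have "chi av e = 1" "e \<in> HH av" using chi_stabilizer by (simp_all add: HH_ell_iff)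
  then show ?thesis using e assms by (simp add: chi_mult)
qed

definition left_cosets :: "('k^2^2) set set" where
  "left_cosets = (\<lambda>h. (**) h ` HH_ell av) ` HH av"

text \<open>The same \<open>SOME\<close> expression as in \<open>u_K\<close>, so that folding it
  rewrites the definition of \<open>u_K\<close>.\<close>

definition rep :: "('k^2^2) set \<Rightarrow> 'k^2^2" where
  "rep C = (SOME h. h \<in> C)"

lemma mat_1_HH_ell: "mat 1 \<in> HH_ell av"
  using HH_1 by (simp add: HH_ell_iff act_1)

lemma rep:
  assumes "h \<in> HH av" "C = (**) h ` HH_ell av"
  shows "rep C \<in> HH av" "act av (rep C) ell - act av h ell \<in> L0 av"
proof -
  have "h ** mat 1 \<in> C" unfolding assms(2) using mat_1_HH_ell by (rule imageI)
  then have C: "rep C \<in> (**) h ` HH_ell av" unfolding rep_def assms(2) by (rule someI)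
  then obtain e where e: "e \<in> HH_ell av" "rep C = h ** e" by blast
  then show HH: "rep C \<in> HH av" using assms(1) HH_mult by (simp add: HH_ell_iff)
  show "act av (rep C) ell - act av h ell \<in> L0 av"
    using C left_coset_HH_ell[OF assms(1) HH] by blast
qed

lemma left_cosets_rep:
  assumes "C \<in> left_cosets"
  shows "rep C \<in> HH av" "C = (**) (rep C) ` HH_ell av"
proof -
  obtain h where h: "h \<in> HH av" "C = (**) h ` HH_ell av" using assms unfolding left_cosets_def by blast
  show "rep C \<in> HH av" by (rule rep[OF h])
  show "C = (**) (rep C) ` HH_ell av" using left_coset_HH_ell_eq[OF h(1) rep[OF h]] h(2) by simp
qed

lemma left_cosets_eqI:
  assumes "C \<in> left_cosets" "C' \<in> left_cosets" "act av (rep C) ell - act av (rep C') ell \<in> L0 av"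
  shows "C = C'"
  using left_coset_HH_ell_eq[OF left_cosets_rep(1)[OF assms(2)] left_cosets_rep(1)[OF assms(1)] assms(3)]
    left_cosets_rep(2)[OF assms(1)] left_cosets_rep(2)[OF assms(2)] by simp

text \<open>Left cosets embed into the finite quotient of the dual lattice by \<open>L0\<close>.
  Finiteness is essential here because a sum over an infinite index set is 0 by convention.\<close>

lemma finite_left_cosets: "finite left_cosets"
proof -
  let ?f = "\<lambda>C. (+) (act av (rep C) ell) ` L0 av"
  have "inj_on ?f left_cosets"
    by (rule inj_onI, rule left_cosets_eqI) (simp_all only: L0_coset_eq_iff)
  moreover have "?f ` left_cosets \<subseteq> (\<lambda>x. (+) x ` L0 av) ` L0_dual av \<beta>"
    using left_cosets_rep(1) act_L0_dual[OF \<beta> _ ell_dual] by blast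
  ultimately show ?thesis by (rule inj_on_finite[OF _ _ finite_dual_cosets])
qed

lemma u_K_sum: "u_K av x = (\<Sum>C\<in>left_cosets. if x - act av (rep C) ell \<in> L0 av then chi av (rep C) else 0)"
proof -
  have "x \<in> L0_coset av y \<longleftrightarrow> x - y \<in> L0 av" for y
    by (auto simp: L0_coset_def intro: image_eqI[of _ _ "x - y"])
  then show ?thesis
    unfolding u_K_def left_cosets_def[symmetric] rep_def[symmetric] Let_def inverse_chi
    by (intro sum.cong) (auto simp: indicator_def)
qed

text \<open>Exactly one summand is nonzero, since different left cosets give disjoint translates of
  \<open>L0\<close>. The inverse in \<open>u_K\<close> disappears because \<open>\<chi>\<close>
  takes only the values 1 and -1.\<close>

lemma u_K_orbit:
  assumes h: "h \<in> HH av" and x: "x - act av h ell \<in> L0 av"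
  shows "u_K av x = chi av h"
proof -
  define C where "C = (**) h ` HH_ell av"
  have C: "C \<in> left_cosets" using h by (auto simp: C_def left_cosets_def)
  note r = rep[OF h C_def]
  have "x - act av (rep C') ell \<in> L0 av \<longleftrightarrow> C' = C" if C': "C' \<in> left_cosets" for C'
  proof
    assume "C' = C"
    then show "x - act av (rep C') ell \<in> L0 av" using L0_diff[OF x r(2)] by simp
  next
    assume "x - act av (rep C') ell \<in> L0 av"
    from L0_diff[OF L0_diff[OF x r(2)] this]
    have "act av (rep C') ell - act av (rep C) ell \<in> L0 av" by simp
    then show "C' = C" by (rule left_cosets_eqI[OF C' C])
  qed
  then have "u_K av x = (\<Sum>C'\<in>left_cosets. if C' = C then chi av (rep C') else 0)"
    unfolding u_K_sum by (intro sum.cong) auto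
  also have "\<dots> = chi av (rep C)" using C finite_left_cosets by (simp add: sum.delta)
  also have "\<dots> = chi av h" using h r by (rule chi_cong)
  finally show ?thesis .
qed

lemma u_K_not_orbit: "\<not> orbit_point x \<Longrightarrow> u_K av x = 0"
  unfolding u_K_sum orbit_point_def using left_cosets_rep(1) by (intro sum.neutral) auto

lemma u_K_ell: "u_K av ell = 1"
  using u_K_orbit[OF HH_1, of ell] by (simp add: act_1 chi_1)

lemma orbit_point_dual: "orbit_point x \<Longrightarrow> x \<in> L0_dual av \<beta>"
proof -
  assume "orbit_point x"
  then obtain h where h: "h \<in> HH av" "x - act av h ell \<in> L0 av" by (auto simp: orbit_point_def)
  have "act av h ell + (x - act av h ell) \<in> L0_dual av \<beta>"
    using h act_L0_dual[OF \<beta> _ ell_dual] L0_subset_dual by (intro L0_dual_add) auto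
  then show ?thesis by simp
qed

lemma orbit_point_add:
  assumes "y \<in> L0 av"
  shows "orbit_point (x + y) \<longleftrightarrow> orbit_point x"
proof -
  have "x + y - act av h ell \<in> L0 av \<longleftrightarrow> x - act av h ell \<in> L0 av" for h
    using L0_add[OF _ assms, of "x - act av h ell"] L0_diff[OF _ assms, of "x + y - act av h ell"]
    by (auto simp: algebra_simps)
  then show ?thesis by (simp add: orbit_point_def)
qed

lemma S_L0_chi_iff: "\<phi> \<in> S_L0_chi p av \<beta> \<longleftrightarrow>
    \<phi> \<in> S_L0 p av \<beta> \<and> (\<forall>h\<in>HH av. \<forall>x. \<phi> (act av h x) = chi av h * \<phi> x)"
proof -
  have "fun_act av h \<phi> = fscale (chi av h) \<phi> \<longleftrightarrow> (\<forall>x. \<phi> (act av h x) = chi av h * \<phi> x)" if h: "h \<in> HH av" for h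
  proof -
    have "fun_act av h \<phi> = fscale (chi av h) \<phi> \<longleftrightarrow> (\<forall>x. \<phi> (act av (matrix_inv h) x) = chi av h * \<phi> x)"
      by (simp add: fun_act_def fscale_def fun_eq_iff)
    also have "\<dots> \<longleftrightarrow> (\<forall>x. \<phi> x = chi av h * \<phi> (act av h x))" using act_inv[OF h] by metis
    also have "\<dots> \<longleftrightarrow> (\<forall>x. \<phi> (act av h x) = chi av h * \<phi> x)"
    proof -
      have "a = chi av h * b \<longleftrightarrow> b = chi av h * a" for a b by (auto simp: chi_eq)
      then show ?thesis by metis
    qed
    finally show ?thesis .
  qed
  then show ?thesis unfolding S_L0_chi_def by blast
qed

lemma u_K_S_L0_chi: "u_K av \<in> S_L0_chi p av \<beta>"
  unfolding S_L0_chi_iff S_L0_iff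
proof (intro conjI allI impI ballI)
  fix x assume "u_K av x \<noteq> 0"
  then show "x \<in> L0_dual av \<beta>" using u_K_not_orbit orbit_point_dual by blast
next
  show "invariant_under (L0 av) (u_K av)"
    unfolding invariant_under_def
  proof (intro allI ballI)
    fix x y assume y: "y \<in> L0 av"
    show "u_K av (x + y) = u_K av x"
    proof (cases "orbit_point x")
      case True
      then obtain h where h: "h \<in> HH av" "x - act av h ell \<in> L0 av" by (auto simp: orbit_point_def)
      have "x + y - act av h ell \<in> L0 av" using L0_add[OF h(2) y] by (simp add: algebra_simps)
      then show ?thesis using h u_K_orbit by simp
    next
      case False
      then show ?thesis using u_K_not_orbit orbit_point_add[OF y] by simp
    qed
  qed
next
  fix h x assume h: "h \<in> HH av"
  show "u_K av (act av h x) = chi av h * u_K av x"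
  proof (cases "orbit_point x")
    case True
    then obtain k where k: "k \<in> HH av" "x - act av k ell \<in> L0 av" by (auto simp: orbit_point_def)
    have "act av h x - act av (h ** k) ell \<in> L0 av"
      using act_L0[OF h k(2)] by (simp add: act_diff act_mult)
    then have "u_K av (act av h x) = chi av (h ** k)" using HH_mult h k by (intro u_K_orbit)
    then show ?thesis using u_K_orbit[OF k] chi_mult h k by simp
  next
    case False
    then show ?thesis using u_K_not_orbit orbit_point_act[OF h] by (metis mult_zero_right)
  qed
qed

lemma S_L0_chi_eq_multiple:
  assumes "\<phi> \<in> S_L0_chi p av \<beta>"
  shows "\<phi> = fscale (\<phi> ell) (u_K av)"
proof
  fix x
  have zero: "\<phi> x = 0" if v: "vanishing_point x"
  proof -
    obtain h where h: "h \<in> HH av" "chi av h = - 1" "act av h x - x \<in> L0 av"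
      using v unfolding vanishing_point_def by blast
    have "\<phi> (x + (act av h x - x)) = \<phi> x"
      using assms h unfolding S_L0_chi_iff S_L0_iff invariant_under_def by blast
    moreover have "\<phi> (act av h x) = - \<phi> x" using assms h by (simp add: S_L0_chi_iff)
    ultimately show ?thesis by simp
  qed
  have orbit: "\<phi> x = chi av h * \<phi> ell" if "h \<in> HH av" "x - act av h ell \<in> L0 av" for h
  proof -
    have "\<phi> (act av h ell + (x - act av h ell)) = \<phi> (act av h ell)"
      using assms that unfolding S_L0_chi_iff S_L0_iff invariant_under_def by blast
    then show ?thesis using assms that by (simp add: S_L0_chi_iff)
  qed
  show "\<phi> x = fscale (\<phi> ell) (u_K av) x"
  proof (cases "orbit_point x")
    case True
    then obtain h where h: "h \<in> HH av" "x - act av h ell \<in> L0 av" by (auto simp: orbit_point_def)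
    then show ?thesis using orbit[OF h] u_K_orbit[OF h] by (simp add: fscale_def)
  next
    case False
    have "\<phi> x = 0"
    proof (cases "x \<in> L0_dual av \<beta>")
      case True
      then show ?thesis using dual_cases False zero by blast
    next
      case False
      then show ?thesis using assms unfolding S_L0_chi_iff S_L0_iff by blast
    qed
    then show ?thesis using u_K_not_orbit[OF False] by (simp add: fscale_def)
  qed
qed

lemma S_L0_chi_eq_span: "S_L0_chi p av \<beta> = fun_space.span {u_K av}"
proof -
  have "fscale c (u_K av) \<in> S_L0_chi p av \<beta>" for c
    using u_K_S_L0_chi unfolding S_L0_chi_iff S_L0_iff invariant_under_def fscale_def by auto
  then show ?thesis
    using S_L0_chi_eq_multiple by (auto simp: fun_space.span_singleton)
qed

lemma dim_S_L0_chi: "fun_space.dim (S_L0_chi p av \<beta>) = 1"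
proof -
  have "u_K av \<noteq> 0" using u_K_ell by (metis zero_fun_apply zero_neq_one)
  then have "fun_space.independent {u_K av}" by (simp add: fun_space.independent_insert)
  then show ?thesis
    unfolding S_L0_chi_eq_span fun_space.dim_span by (simp add: fun_space.dim_eq_card_independent)
qed

end

section \<open>Invariance under the Weil representation\<close>

context ramified_quadratic_space
begin

section \<open>The Fourier transform on isotypic functions\<close>

definition fourier_integrand :: "('k^2^2 \<Rightarrow> complex) \<Rightarrow> 'k^2^2 \<Rightarrow> 'k^2^2 \<Rightarrow> complex" where
  "fourier_integrand \<phi> x y = \<phi> y * add_char p av (- B0 \<beta> x y)"

lemma add_char_minus_B0_add:
  assumes "x \<in> V0 av" "y \<in> V0 av" "z \<in> V0 av"
  shows "add_char p av (- B0 \<beta> x (y + z)) = add_char p av (- B0 \<beta> x y) * add_char p av (- B0 \<beta> x z)"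
proof -
  have "- B0 \<beta> x (y + z) = - B0 \<beta> x y + - B0 \<beta> x z" by (simp add: B0_add_right)
  then show ?thesis using assms \<beta>_Qp by (simp only:) (intro add_char_add Qp_minus B0_Qp)
qed

lemma add_char_B0_dual: "x \<in> L0_dual av \<beta> \<Longrightarrow> y \<in> L0 av \<Longrightarrow> add_char p av (- B0 \<beta> x y) = 1"
  using B0_dual[of x y] by (subst add_char_eq_1_iff) (auto simp: Zp_Qp)

lemma V0_scale_L0:
  assumes "x \<in> V0 av"
  shows "\<exists>n. mscale (of_nat p ^ n) x \<in> L0 av"
proof -
  obtain c y where cy: "c \<in> Qp av" "y \<in> L0 av" "x = mscale c y" using assms unfolding V0_def by blast
  obtain n where "of_nat p ^ n * c \<in> Zp av" using Qp_scale_Zp[OF cy(1)] by blast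
  then have "mscale (of_nat p ^ n) x \<in> L0 av" using L0_mscale cy by (simp add: mscale_mscale)
  then show ?thesis by blast
qed

lemma lattice_subset_L0: "mscale (of_nat p ^ n) ` L0 av \<subseteq> L0 av"
  using L0_mscale[OF Zp_power[OF Zp_of_nat]] by blast

lemma S_L0_supp: "\<phi> \<in> S_L0 p av \<beta> \<Longrightarrow> x \<notin> L0_dual av \<beta> \<Longrightarrow> \<phi> x = 0"
  and S_L0_add: "\<phi> \<in> S_L0 p av \<beta> \<Longrightarrow> y \<in> L0 av \<Longrightarrow> \<phi> (x + y) = \<phi> x"
  unfolding S_L0_iff invariant_under_def by blast+

lemma fourier_integrand_add:
  assumes \<phi>: "\<phi> \<in> S_L0 p av \<beta>" and x: "x \<in> V0 av" and z: "z \<in> L0 av"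
  shows "fourier_integrand \<phi> x (y + z) = add_char p av (- B0 \<beta> x z) * fourier_integrand \<phi> x y"
proof (cases "y \<in> L0_dual av \<beta>")
  case True
  then show ?thesis
    using add_char_minus_B0_add[OF x L0_dual_V0[OF True] L0_V0[OF z]] S_L0_add[OF \<phi> z]
    by (simp add: fourier_integrand_def)
next
  case False
  then show ?thesis using S_L0_supp[OF \<phi> False] S_L0_add[OF \<phi> z] by (simp add: fourier_integrand_def)
qed

text \<open>For \<open>x\<close> outside the dual lattice \<open>L0\<close> need not be a period. If
  \<open>p ^ n\<close> moves \<open>x\<close> into \<open>L0\<close>, then \<open>p ^ n L0\<close>
  is one, and \<open>haar_integral_compose\<close> asks for the existence of such a period.\<close>

lemma fourier_integrand_invariant:
  assumes \<phi>: "\<phi> \<in> S_L0 p av \<beta>" and x: "x \<in> V0 av"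
  shows "\<exists>n. invariant_under (mscale (of_nat p ^ n) ` L0 av) (fourier_integrand \<phi> x)"
proof -
  obtain n where n: "mscale (of_nat p ^ n) x \<in> L0 av" using V0_scale_L0[OF x] by blast
  have "fourier_integrand \<phi> x (y + mscale (of_nat p ^ n) z) = fourier_integrand \<phi> x y"
    if z: "z \<in> L0 av" for y z
  proof -
    have "B0 \<beta> x (mscale (of_nat p ^ n) z) = B0 \<beta> (mscale (of_nat p ^ n) x) z"
      by (simp only: B0_mscale_left B0_mscale_right)
    then have "add_char p av (- B0 \<beta> x (mscale (of_nat p ^ n) z)) = 1"
      using add_char_B0_dual[OF L0_subset_dual[OF n] z] by simp
    moreover have "mscale (of_nat p ^ n) z \<in> L0 av" using lattice_subset_L0 z by blast
    ultimately show ?thesis using fourier_integrand_add[OF \<phi> x] by simp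
  qed
  then show ?thesis unfolding invariant_under_def by blast
qed

text \<open>Translating the variable by an element of \<open>L\<^sub>0\<close> multiplies the integral by a character value,
  which is not \<open>1\<close> for a suitable translation when \<open>x\<close> lies outside the dual lattice.\<close>

lemma fourier_outside_dual:
  assumes \<phi>: "\<phi> \<in> S_L0 p av \<beta>" and x: "x \<in> V0 av" "x \<notin> L0_dual av \<beta>"
  shows "haar_integral p av (fourier_integrand \<phi> x) = 0"
proof -
  obtain z where z: "z \<in> L0 av" "B0 \<beta> x z \<notin> Zp av" using x by (auto simp: L0_dual_def)
  define c where "c = add_char p av (- B0 \<beta> x z)"
  have "- B0 \<beta> x z \<notin> Zp av" using z Zp_minus[of "- B0 \<beta> x z"] by auto
  moreover have "- B0 \<beta> x z \<in> Qp av" using \<beta>_Qp x L0_V0[OF z(1)] by (intro Qp_minus B0_Qp)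
  ultimately have "c \<noteq> 1" unfolding c_def by (simp add: add_char_eq_1_iff)
  have "c \<noteq> 0" by (simp add: c_def add_char_def)
  obtain n where n: "invariant_under (mscale (of_nat p ^ n) ` L0 av) (fourier_integrand \<phi> x)"
    using fourier_integrand_invariant[OF \<phi> x(1)] by blast
  have "haar_integral p av (\<lambda>y. fourier_integrand \<phi> x (y + z)) = haar_integral p av (fourier_integrand \<phi> x)"
  proof (rule haar_integral_compose[OF _ _ _ n])
    show "bij (\<lambda>y. y + z)" by (rule bijI'[of "\<lambda>y. y + z"]) (auto intro: exI[of _ "w - z" for w])
    show "(\<lambda>y. y + z) ` ((+) y ` mscale (of_nat p ^ n) ` L0 av) = (+) (y + z) ` mscale (of_nat p ^ n) ` L0 av" for y n
      by (simp add: image_image add_ac)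
    show "0 \<in> mscale (of_nat p ^ n) ` L0 av" for n
      by (rule image_eqI[of _ _ 0]) (simp_all add: vec_eq_iff)
  qed
  moreover have "(\<lambda>y. fourier_integrand \<phi> x (y + z)) = (\<lambda>y. c * fourier_integrand \<phi> x y)"
    using fourier_integrand_add[OF \<phi> x(1) z(1)] by (simp add: c_def)
  ultimately have "c * haar_integral p av (fourier_integrand \<phi> x) = haar_integral p av (fourier_integrand \<phi> x)"
    using haar_integral_mult[OF \<open>c \<noteq> 0\<close>, of p av "fourier_integrand \<phi> x"] by simp
  then show ?thesis using \<open>c \<noteq> 1\<close> by simp
qed

lemma fourier_act:
  assumes \<phi>: "\<phi> \<in> S_L0_chi p av \<beta>" and h: "h \<in> HH av" and x: "x \<in> V0 av"
  shows "haar_integral p av (fourier_integrand \<phi> (act av h x)) = chi av h * haar_integral p av (fourier_integrand \<phi> x)"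
proof -
  have \<phi>S: "\<phi> \<in> S_L0 p av \<beta>" using \<phi> by (simp add: S_L0_chi_iff)
  obtain n where n: "invariant_under (mscale (of_nat p ^ n) ` L0 av) (fourier_integrand \<phi> (act av h x))"
    using fourier_integrand_invariant[OF \<phi>S act_V0[OF h x]] by blast
  have "haar_integral p av (\<lambda>y. fourier_integrand \<phi> (act av h x) (act av h y)) =
      haar_integral p av (fourier_integrand \<phi> (act av h x))"
  proof (rule haar_integral_compose[OF bij_act[OF h] act_coset[OF h] _ n])
    show "0 \<in> mscale (of_nat p ^ n) ` L0 av" for n
      by (rule image_eqI[of _ _ 0]) (simp_all add: vec_eq_iff)
  qed
  moreover have "(\<lambda>y. fourier_integrand \<phi> (act av h x) (act av h y)) = (\<lambda>y. chi av h * fourier_integrand \<phi> x y)"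
    using \<phi> h by (simp add: fourier_integrand_def B0_act S_L0_chi_iff mult.assoc)
  ultimately show ?thesis using haar_integral_mult[OF chi_nz] by metis
qed

text \<open>The constant \<open>c\<close> is arbitrary, so this applies to the unspecified constant
  of the Weil representation, whose effect is determined later from relations between
  generators.\<close>

lemma fourier_S_L0_chi:
  assumes \<phi>: "\<phi> \<in> S_L0_chi p av \<beta>"
  shows "(\<lambda>x. if x \<in> V0 av then c * haar_integral p av (fourier_integrand \<phi> x) else 0) \<in> S_L0_chi p av \<beta>"
    (is "?F \<in> _")
proof -
  have \<phi>S: "\<phi> \<in> S_L0 p av \<beta>" using \<phi> by (simp add: S_L0_chi_iff)
  show ?thesis
    unfolding S_L0_chi_iff S_L0_iff
  proof (intro conjI allI impI ballI)
    fix x assume "?F x \<noteq> 0"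
    then show "x \<in> L0_dual av \<beta>" using fourier_outside_dual[OF \<phi>S, of x] by (auto split: if_splits)
  next
    show "invariant_under (L0 av) ?F"
      unfolding invariant_under_def
    proof (intro allI ballI)
      fix x z assume z: "z \<in> L0 av"
      have V: "x + z \<in> V0 av \<longleftrightarrow> x \<in> V0 av"
        using V0_add[OF _ L0_V0[OF z], of x] V0_diff[OF _ L0_V0[OF z], of "x + z"] by auto
      moreover have "fourier_integrand \<phi> (x + z) = fourier_integrand \<phi> x" if x: "x \<in> V0 av"
      proof
        fix y
        show "fourier_integrand \<phi> (x + z) y = fourier_integrand \<phi> x y"
        proof (cases "y \<in> L0_dual av \<beta>")
          case True
          have "add_char p av (- B0 \<beta> (x + z) y) = add_char p av (- B0 \<beta> y x) * add_char p av (- B0 \<beta> y z)"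
            unfolding B0_commute[of \<beta> "x + z"]
            by (rule add_char_minus_B0_add[OF L0_dual_V0[OF True] x L0_V0[OF z]])
          then show ?thesis using add_char_B0_dual[OF True z] B0_commute[of \<beta> x y]
            by (simp add: fourier_integrand_def)
        next
          case False
          then show ?thesis using S_L0_supp[OF \<phi>S] by (simp add: fourier_integrand_def)
        qed
      qed
      ultimately show "?F (x + z) = ?F x" by auto
    qed
  next
    fix h x assume h: "h \<in> HH av"
    have "act av h x \<in> V0 av \<longleftrightarrow> x \<in> V0 av"
      using act_V0[OF h, of x] act_V0[OF HH_inv(1)[OF h], of "act av h x"] by (auto simp: act_inv h)
    then show "?F (act av h x) = chi av h * ?F x" using fourier_act[OF \<phi> h] by simp
  qed
qed

text \<open>For \<open>x\<close> equal to the image of \<open>ell\<close> plus \<open>z\<close>, the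
  determinant of \<open>ell\<close> is 0, the cross term pairs the dual lattice with
  \<open>L0\<close>, and \<open>det z\<close> is divisible by \<open>4 * D\<close>, which cancels
  the denominator of \<open>\<beta>\<close>. Hence integral unipotent matrices fix
  \<open>u_K\<close>.\<close>

lemma Q0_orbit_point:
  assumes "orbit_point x"
  shows "Q0 \<beta> x \<in> Zp av"
proof -
  obtain h where h: "h \<in> HH av" "x - act av h ell \<in> L0 av" using assms by (auto simp: orbit_point_def)
  define z where "z = x - act av h ell"
  have z: "z \<in> L0 av" using h by (simp add: z_def)
  have "Q0 \<beta> z \<in> Zp av"
  proof -
    have bounds: "av (z $ 1 $ 1) \<le> av (4 * D)" "av (z $ 2 $ 2) \<le> av (4 * D)" "av (z $ 1 $ 2) \<le> av (2 * \<theta>)"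
      using z unfolding L0_iff by blast+
    have "gal av (z $ 1 $ 2) = z $ 2 $ 1" using L0_V0[OF z] V0_iff by metis
    then have z21: "av (z $ 2 $ 1) \<le> av (2 * \<theta>)" using gal_different[OF bounds(3)] by simp
    have "av (z $ 1 $ 1 * z $ 2 $ 2) \<le> av (4 * D)"
      using bounds(1) order_trans[OF bounds(2) av_4D_le_1] by (rule av_mult_le)
    moreover have "av (z $ 1 $ 2) * av (z $ 2 $ 1) \<le> av (2 * \<theta>) * av (2 * \<theta>)"
      using bounds z21 av_nonneg by (intro mult_mono)
    then have "av (z $ 1 $ 2 * z $ 2 $ 1) \<le> av (4 * D)" by (simp only: av_mult[of "z $ 1 $ 2"] av_4D_eq)
    ultimately have "av (det z) \<le> av (4 * D)" unfolding det_2 by (rule av_diff_le)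
    then have "av \<beta> * av (det z) \<le> av \<beta> * av (4 * D)" using av_nonneg by (intro mult_left_mono)
    then have "av (Q0 \<beta> z) \<le> 1" using av_\<beta> by (simp add: Q0_def av_mult mult.commute)
    then show ?thesis using Q0_Qp[OF \<beta>_Qp L0_V0[OF z]] by (simp add: Zp_iff)
  qed
  moreover have "Q0 \<beta> (act av h ell) = 0"
    using det_act[OF h(1), of ell] by (simp add: Q0_def ell_def det_2)
  moreover have "B0 \<beta> (act av h ell) z \<in> Zp av"
    using act_L0_dual[OF \<beta> h(1) ell_dual] z by (rule B0_dual)
  ultimately have "Q0 \<beta> (act av h ell + z) \<in> Zp av" unfolding Q0_add by (simp add: Zp_add)
  then show ?thesis by (simp add: z_def)
qed

section \<open>Generators of the special linear group and their action on \<open>u_K\<close>\<close>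

lemma SL2_mult: "g \<in> SL2 (Qp av) \<Longrightarrow> h \<in> SL2 (Qp av) \<Longrightarrow> g ** h \<in> SL2 (Qp av)"
  by (auto simp: SL2_def det_mul) (auto simp: matrix_matrix_mult_def sum_2 intro!: Qp_add Qp_mult)

lemma mat2_SL2: "mat2 a b c e \<in> SL2 R \<longleftrightarrow> a \<in> R \<and> b \<in> R \<and> c \<in> R \<and> e \<in> R \<and> a * e - b * c = 1"
  by (auto simp: SL2_def forall_2 det_2)

abbreviation weyl :: "'k^2^2" where "weyl \<equiv> mat2 0 (- 1) 1 0"

lemma weyl_SL2: "weyl \<in> SL2 (Qp av)"
  by (simp add: mat2_SL2 Qp_minus)

lemma unipotent_SL2: "b \<in> Qp av \<Longrightarrow> mat2 1 b 0 1 \<in> SL2 (Qp av)"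
  by (simp add: mat2_SL2)

context
  fixes \<omega> assumes weil: "weil_representation p av \<beta> \<omega>"
begin

lemma u_K_schwartz: "u_K av \<in> schwartz p av"
  using u_K_S_L0_chi by (simp add: S_L0_chi_def S_L0_def)

lemmas weil_conjuncts = weil[unfolded weil_representation_def, THEN conjunct2]
lemmas weil_conjuncts_2 = weil_conjuncts[THEN conjunct2, THEN conjunct2]

lemma weil_mult: "g \<in> SL2 (Qp av) \<Longrightarrow> h \<in> SL2 (Qp av) \<Longrightarrow> \<omega> (g ** h) (u_K av) = \<omega> g (\<omega> h (u_K av))"
  using weil_conjuncts_2[THEN conjunct1] u_K_schwartz by blast

lemma weil_fscale: "g \<in> SL2 (Qp av) \<Longrightarrow> \<omega> g (fscale c (u_K av)) = fscale c (\<omega> g (u_K av))"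
  using weil_conjuncts[THEN conjunct1] u_K_schwartz by blast

lemma weil_1: "\<omega> (mat 1) (u_K av) = u_K av"
  using weil_conjuncts[THEN conjunct2, THEN conjunct1] u_K_schwartz by blast

lemma weil_unipotent:
  assumes b: "b \<in> Zp av"
  shows "\<omega> (mat2 1 b 0 1) (u_K av) = u_K av"
proof -
  have "\<omega> (mat2 1 b 0 1) (u_K av) = (\<lambda>x. add_char p av (b * Q0 \<beta> x) * u_K av x)"
    by (rule weil_conjuncts_2[THEN conjunct2, THEN conjunct1, THEN bspec, THEN bspec, OF Zp_Qp[OF b] u_K_schwartz])
  also have "\<dots> = u_K av"
  proof
    fix x
    show "add_char p av (b * Q0 \<beta> x) * u_K av x = u_K av x"
    proof (cases "orbit_point x")
      case True
      then have "b * Q0 \<beta> x \<in> Zp av" using b Q0_orbit_point by (intro Zp_mult)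
      then show ?thesis by (simp add: add_char_eq_1_iff Zp_Qp)
    qed (simp add: u_K_not_orbit)
  qed
  finally show ?thesis .
qed

text \<open>The Weyl element maps \<open>u_K\<close> to \<open>l * u_K\<close>. Both \<open>w\<^sup>2\<close> and \<open>(w n(1))\<^sup>3\<close> are equal to \<open>-1\<close>, so
  \<open>l\<^sup>2 = l\<^sup>3\<close>; this fixes \<open>l\<close> without computing the Weil index.\<close>

lemma weil_weyl: "\<omega> weyl (u_K av) = u_K av"
proof -
  let ?u = "u_K av"
  obtain c where c: "\<omega> weyl ?u = (\<lambda>x. if x \<in> V0 av
       then c * haar_integral p av (\<lambda>y. ?u y * add_char p av (- B0 \<beta> x y)) else 0)"
    using weil_conjuncts_2[THEN conjunct2, THEN conjunct2, THEN conjunct2] u_K_schwartz by blast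
  have "\<omega> weyl ?u \<in> S_L0_chi p av \<beta>"
    using fourier_S_L0_chi[OF u_K_S_L0_chi, of c] unfolding c fourier_integrand_def .
  then obtain l where l: "\<omega> weyl ?u = fscale l ?u" using S_L0_chi_eq_multiple by blast
  \<comment> \<open>Scalars are read off at \<open>ell\<close>, where \<open>u_K\<close> is
    1.\<close>
  have fscale_eq: "fscale a ?u = fscale b ?u \<Longrightarrow> a = b" for a b
    using u_K_ell unfolding fscale_def by (metis mult.right_neutral)
  have fscale_fscale: "fscale a (fscale b ?u) = fscale (a * b) ?u" for a b
    by (simp add: fscale_def mult.assoc)
  have scalar: "\<omega> (g ** h) ?u = fscale (a * b) ?u"
    if "g \<in> SL2 (Qp av)" "h \<in> SL2 (Qp av)" "\<omega> g ?u = fscale a ?u" "\<omega> h ?u = fscale b ?u" for g h a b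
    using that weil_mult weil_fscale by (simp add: fscale_fscale mult.commute)
  define t where "t = (mat2 1 1 0 1 :: 'k^2^2)"
  have t: "t \<in> SL2 (Qp av)" "\<omega> t ?u = fscale 1 ?u"
    using weil_unipotent[of 1] by (simp_all add: t_def unipotent_SL2 fscale_def)
  have wt: "weyl ** t \<in> SL2 (Qp av)" "\<omega> (weyl ** t) ?u = fscale (l * 1) ?u"
    using SL2_mult scalar weyl_SL2 t l by blast+
  have wt2: "(weyl ** t) ** (weyl ** t) \<in> SL2 (Qp av)"
    "\<omega> ((weyl ** t) ** (weyl ** t)) ?u = fscale ((l * 1) * (l * 1)) ?u"
    using SL2_mult scalar wt by blast+
  have wt3: "\<omega> ((weyl ** t) ** (weyl ** t) ** (weyl ** t)) ?u = fscale ((l * 1) * (l * 1) * (l * 1)) ?u"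
    using scalar wt2 wt by blast
  have w2: "weyl ** weyl \<in> SL2 (Qp av)" "\<omega> (weyl ** weyl) ?u = fscale (l * l) ?u"
    using SL2_mult scalar weyl_SL2 l by blast+
  have "(weyl ** t) ** (weyl ** t) ** (weyl ** t) = weyl ** weyl"
    by (simp add: t_def mat2_simps(1,3))
  then have "fscale ((l * 1) * (l * 1) * (l * 1)) ?u = fscale (l * l) ?u" using wt3 w2(2) by simp
  then have l3: "(l * 1) * (l * 1) * (l * 1) = l * l" by (rule fscale_eq)
  \<comment> \<open>The fourth power of the Weyl element is 1, so \<open>l^4 = 1\<close>; this
    excludes the solution 0 of \<open>l^3 = l^2\<close>.\<close>
  have "\<omega> ((weyl ** weyl) ** (weyl ** weyl)) ?u = fscale ((l * l) * (l * l)) ?u"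
    using scalar w2 by blast
  moreover have "(weyl ** weyl) ** (weyl ** weyl) = mat 1" by (simp add: mat2_simps(1,3,6))
  ultimately have "fscale ((l * l) * (l * l)) ?u = fscale 1 ?u" using weil_1 by (simp add: fscale_def)
  then have "(l * l) * (l * l) = 1" by (rule fscale_eq)
  then have "l \<noteq> 0" by auto
  then have "l = 1" using l3 by simp
  then show ?thesis using l by (simp add: fscale_def)
qed

lemma weil_fixed_mult:
  assumes "g \<in> SL2 (Qp av)" "h \<in> SL2 (Qp av)" "\<omega> g (u_K av) = u_K av" "\<omega> h (u_K av) = u_K av"
  shows "g ** h \<in> SL2 (Qp av)" "\<omega> (g ** h) (u_K av) = u_K av"
  using assms SL2_mult weil_mult by simp_all

lemma weil_weyl_inv: "mat2 0 1 (- 1) 0 \<in> SL2 (Qp av)" "\<omega> (mat2 0 1 (- 1) 0) (u_K av) = u_K av"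
proof -
  have *: "mat2 0 1 (- 1) 0 = weyl ** weyl ** weyl" by (simp add: mat2_simps(1,3))
  note w2 = weil_fixed_mult[OF weyl_SL2 weyl_SL2 weil_weyl weil_weyl]
  note w3 = weil_fixed_mult[OF w2(1) weyl_SL2 w2(2) weil_weyl]
  show "mat2 0 1 (- 1) 0 \<in> SL2 (Qp av)" unfolding * by (rule w3)
  show "\<omega> (mat2 0 1 (- 1) 0) (u_K av) = u_K av" unfolding * by (rule w3)
qed

text \<open>A Bruhat-type factorisation: the middle factor is the lower unipotent matrix with entry
  \<open>c\<close>, written as a Weyl conjugate of an upper one. The two outer parameters are
  integral because \<open>c\<close> is a unit.\<close>

lemma weil_unit_corner:
  assumes g: "mat2 a b c e \<in> SL2 (Zp av)" and c: "av c = 1"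
  shows "mat2 a b c e \<in> SL2 (Qp av)" "\<omega> (mat2 a b c e) (u_K av) = u_K av"
proof -
  have abce: "a \<in> Zp av" "b \<in> Zp av" "c \<in> Zp av" "e \<in> Zp av" "a * e - b * c = 1"
    using g by (simp_all add: mat2_SL2)
  have c0: "c \<noteq> 0" using c by auto
  have "(a - 1) / c \<in> Zp av" "(e - 1) / c \<in> Zp av" "- c \<in> Zp av"
    using abce c by (auto simp: Zp_iff av_divide intro!: av_diff_le Qp_divide Qp_diff)
  note n = this[THEN weil_unipotent] this[THEN Zp_Qp, THEN unipotent_SL2]
  have b: "b = (a * e - 1) / c" using abce(5) c0 by (simp add: field_simps)
  have *: "mat2 a b c e = mat2 1 ((a - 1) / c) 0 1 ** (weyl ** mat2 1 (- c) 0 1 ** mat2 0 1 (- 1) 0) ** mat2 1 ((e - 1) / c) 0 1"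
    unfolding b mat2_simps(3) mat2_simps(1) using c0 by (simp add: field_simps)
  note 1 = weil_fixed_mult[OF weyl_SL2 n(6) weil_weyl n(3)]
  note 2 = weil_fixed_mult[OF 1(1) weil_weyl_inv(1) 1(2) weil_weyl_inv(2)]
  note 3 = weil_fixed_mult[OF n(4) 2(1) n(1) 2(2)]
  note 4 = weil_fixed_mult[OF 3(1) n(5) 3(2) n(2)]
  show "mat2 a b c e \<in> SL2 (Qp av)" "\<omega> (mat2 a b c e) (u_K av) = u_K av"
    unfolding * by (rule 4)+
qed

text \<open>\<open>Zp\<close> is local, so \<open>a * e - b * c = 1\<close> makes \<open>a\<close>
  or \<open>c\<close> a unit; if only \<open>a\<close> is one, multiplication by the Weyl element
  moves it to the lower left corner.\<close>

lemma weil_SL2_Zp: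
  assumes "g \<in> SL2 (Zp av)"
  shows "\<omega> g (u_K av) = u_K av"
proof -
  obtain a b c e where g: "g = mat2 a b c e" by (rule mat2_cases)
  have abce: "a \<in> Zp av" "b \<in> Zp av" "c \<in> Zp av" "e \<in> Zp av" "a * e - b * c = 1"
    using assms by (simp_all add: g mat2_SL2)
  show ?thesis
  proof (cases "av c = 1")
    case True
    then show ?thesis using weil_unit_corner assms by (simp add: g)
  next
    case False
    have "av a = 1"
    proof (rule ccontr)
      assume "av a \<noteq> 1"
      then have "av a < 1" "av c < 1" using False abce by (auto simp: Zp_iff)
      then have "av (a * e) < 1" "av (b * c) < 1"
        using abce mult_right_le_one_le[of "av a" "av e"] mult_left_le_one_le[of "av c" "av b"] av_nonneg
        by (force simp: Zp_iff av_mult)+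
      then have "av (a * e - b * c) < 1" by (rule av_diff_less)
      then show False using abce by simp
    qed
    moreover have "mat2 (- c) (- e) a b \<in> SL2 (Zp av)" using abce by (auto simp: mat2_SL2 algebra_simps)
    ultimately have "mat2 (- c) (- e) a b \<in> SL2 (Qp av)" "\<omega> (mat2 (- c) (- e) a b) (u_K av) = u_K av"
      using weil_unit_corner by blast+
    from weil_fixed_mult(2)[OF weil_weyl_inv(1) this(1) weil_weyl_inv(2) this(2)]
    have "\<omega> (mat2 0 1 (- 1) 0 ** mat2 (- c) (- e) a b) (u_K av) = u_K av" .
    moreover have "mat2 0 1 (- 1) 0 ** mat2 (- c) (- e) a b = g" by (simp add: g mat2_simps(1,3))
    ultimately show ?thesis by simp
  qed
qed

end

end

theorem proposition5p2:
  fixes p :: nat and av :: "'k::field_char_0 \<Rightarrow> real" and \<beta> :: 'k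
  assumes "ramified_quadratic_extension p av"
    and "of_nat (different_norm av) * \<beta> \<in> Zp_units av"
  shows "fun_space.dim (S_L0_chi p av \<beta>) = 1 \<and>
         S_L0_chi p av \<beta> = fun_space.span {u_K av} \<and>
         (\<forall>\<omega>. weil_representation p av \<beta> \<omega> \<longrightarrow>
              (\<forall>g \<in> SL2 (Zp av). \<omega> g (u_K av) = u_K av))"
proof -
  interpret ramified_quadratic_extension p av by (rule assms(1))
  obtain \<theta> D where "ramified_quadratic_basis_axioms p av \<theta> D"
    using normal_form unfolding ramified_quadratic_basis_axioms_def by blast
  then interpret ramified_quadratic_basis p av \<theta> D
    using assms(1) by (simp add: ramified_quadratic_basis_def)
  interpret ramified_quadratic_space p av \<theta> D \<beta>
    by unfold_locales (rule assms(2))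
  show ?thesis using dim_S_L0_chi S_L0_chi_eq_span weil_SL2_Zp by blast
qed

end
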